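(* Let $P_T$ be any non-trivial probability distribution on element trees, and let $\mathcal{Q}_{P_T}$ be the associated BP operator on LLR distributions. Then $\mathcal{Q}_{P_T}$ has at most one non-trivial fixed point $\mu^*$ among LLR distributions, and it is symmetric. For every non-trivial LLR distribution $\mu$, the sequence $\mathcal{Q}_{P_T}^h\mu$ converges weakly as $h\to\infty$ to the same fixed point: to $\mu^*$ if it exists, and to the trivial distribution $\delta_0$ otherwise.
   Context: A probability distribution $\mu$ on $(-\infty,+\infty]$ is symmetric if $\mu[E]=\int e^{-r}\mathbf{1}\{-r\in E\}\,d\mu(r)$ for every measurable $E\subseteq(-\infty,+\infty)$. It is an LLR distribution if $\int e^{-r}d\mu(r)\le 1$; its complement is the (unique) probability distribution $\mu^-$ on $[-\infty,+\infty)$ with $\mu^-[E]=\int e^{-r}\mathbf{1}\{r\in E\}\,d\mu(r)$ for every measurable $E\subseteq(-\infty,+\infty)$. The trivial distribution is $\delta_0$, the unit mass at $0$. Weak convergence is that of probability measures on $(-\infty,+\infty]$. Element tree: a tuple $T$ consisting of (a) a finite rooted tree; (b) a parameter $\delta_e\in[0,1]$, $\delta_e\neq\frac12$, for each edge $e$; (c) a subset $V_G$ of the leaves, called growing points (a one-vertex tree may consist of a single growing point); (d) a symmetric distribution $\mu_v$ (survey distribution) for each vertex $v\notin V_G$. BP operator of a fixed $T$: if $T$ is a single growing point, $\mathcal{Q}_T$ is the identity. Otherwise let $o$ be the root, $e_1,\dots,e_d$ its incident edges, and $T_1,\dots,T_d$ the corresponding subtrees rooted at the children; $\mathcal{Q}_T\mu$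 is the law of $R_s+\sum_{u=1}^dF_{\delta_{e_u}}(\hat R_u)$, where $F_\delta(x)=\ln\frac{(1-\delta)e^x+\delta}{\delta e^x+1-\delta}$ (extended continuously to $\pm\infty$), $R_s\sim\mu_o$, $\hat R_u\sim(1-\delta_{e_u})\hat\mu_u+\delta_{e_u}\hat\mu_u^-$, all jointly independent, with $\hat\mu_u=\mathcal{Q}_{T_u}\mu$ and $\hat\mu_u^-$ its complement. For a distribution $P_T$ on element trees, $\mathcal{Q}_{P_T}\mu=\mathbb{E}_{T\sim P_T}[\mathcal{Q}_T\mu]$ (mixture). $\mu$ is a fixed point if $\mathcal{Q}_{P_T}\mu=\mu$. An element tree is simple if it has exactly one growing point, all edges on the path from the growing point to the root have $\delta_e\in\{0,1\}$, and all survey distributions $\mu_v$ are trivial. $P_T$ is trivial if $T$ is simple with probability $1$, and non-trivial otherwise. *)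

theory Defs
  imports "HOL-Probability.Probability" "HOL-Real_Asymp.Real_Asymp"
begin

section \<open>Distributions on the extended real line\<close>

text \<open>
  Distributions on \<open>(-\<infinity>, \<infinity>]\<close> and on \<open>[-\<infinity>, \<infinity>)\<close> are both represented as Borel probability
  measures on \<^typ>\<open>ereal\<close> that give the missing endpoint measure zero.
\<close>

definition distribution_gt_MInf :: "ereal measure \<Rightarrow> bool" where
  "distribution_gt_MInf \<mu> \<longleftrightarrow>
     prob_space \<mu> \<and> sets \<mu> = sets borel \<and> emeasure \<mu> {-\<infinity>} = 0"

definition distribution_lt_PInf :: "ereal measure \<Rightarrow> bool" where
  "distribution_lt_PInf \<mu> \<longleftrightarrow>
     prob_space \<mu> \<and> sets \<mu> = sets borel \<and> emeasure \<mu> {\<infinity>} = 0"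

text \<open>The function \<open>r \<mapsto> e\<^sup>-\<^sup>r\<close>. Its value at \<open>-\<infinity>\<close> is immaterial below.\<close>

fun exp_neg :: "ereal \<Rightarrow> ennreal" where
  "exp_neg (ereal r) = ennreal (exp (- r))"
| "exp_neg PInfty = 0"
| "exp_neg MInfty = \<infinity>"

definition symmetric_dist :: "ereal measure \<Rightarrow> bool" where
  "symmetric_dist \<mu> \<longleftrightarrow> distribution_gt_MInf \<mu> \<and>
     (\<forall>E \<in> sets borel. E \<subseteq> {-\<infinity><..<\<infinity>} \<longrightarrow>
        emeasure \<mu> E = (\<integral>\<^sup>+ r. exp_neg r * indicator E (- r) \<partial>\<mu>))"

definition LLR_dist :: "ereal measure \<Rightarrow> bool" where
  "LLR_dist \<mu> \<longleftrightarrow> distribution_gt_MInf \<mu> \<and> (\<integral>\<^sup>+ r. exp_neg r \<partial>\<mu>) \<le> 1"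

definition is_complement :: "ereal measure \<Rightarrow> ereal measure \<Rightarrow> bool" where
  "is_complement \<mu> \<nu> \<longleftrightarrow> distribution_lt_PInf \<nu> \<and>
     (\<forall>E \<in> sets borel. E \<subseteq> {-\<infinity><..<\<infinity>} \<longrightarrow>
        emeasure \<nu> E = (\<integral>\<^sup>+ r. exp_neg r * indicator E r \<partial>\<mu>))"

definition complement :: "ereal measure \<Rightarrow> ereal measure" where
  "complement \<mu> = (THE \<nu>. is_complement \<mu> \<nu>)"

definition trivial_dist :: "ereal measure" where
  "trivial_dist = return borel 0"

definition weakly_converges :: "(nat \<Rightarrow> ereal measure) \<Rightarrow> ereal measure \<Rightarrow> bool" where
  "weakly_converges M \<mu> \<longleftrightarrow>
     (\<forall>f :: ereal \<Rightarrow> real. continuous_on {-\<infinity><..} f \<longrightarrow> bounded (f ` {-\<infinity><..}) \<longrightarrow>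
        (\<lambda>n. LINT x:{-\<infinity><..}|M n. f x) \<longlonglongrightarrow> (LINT x:{-\<infinity><..}|\<mu>. f x))"


section \<open>Element trees\<close>

text \<open>
  \<open>Growing\<close> is a growing point. \<open>Node s cs\<close> is any other vertex, with survey distribution \<open>s\<close>;
  \<open>cs\<close> lists, in an arbitrary order, the parameters of the edges to its children, each with the
  subtree at that child. A leaf that is not a growing point is \<open>Node s []\<close>.
\<close>

datatype etree = Growing | Node "ereal measure" "(real \<times> etree) list"

fun element_tree :: "etree \<Rightarrow> bool" where
  "element_tree Growing \<longleftrightarrow> True"
| "element_tree (Node s cs) \<longleftrightarrow> symmetric_dist s \<and>
     (\<forall>(\<delta>, T) \<in> set cs. 0 \<le> \<delta> \<and> \<delta> \<le> 1 \<and> \<delta> \<noteq> 1/2 \<and> element_tree T)"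

text \<open>
  The measurable structure on element trees: the (countable) disjoint union over all tree shapes
  of the product of the Borel \<open>\<sigma>\<close>-algebras for the edge parameters and of the standard
  \<open>\<sigma>\<close>-algebras on the spaces of probability measures (\<^const>\<open>prob_algebra\<close>) for the survey
  distributions. It is generated by the following measurable rectangles.
\<close>

inductive_set etree_rectangles :: "etree set set" where
  "{Growing} \<in> etree_rectangles"
| "S \<in> sets (prob_algebra borel) \<Longrightarrow>
   (\<forall>p \<in> set DCs. fst p \<in> sets borel \<and> snd p \<in> etree_rectangles) \<Longrightarrow>
   {Node s cs | s cs. s \<in> S \<and> list_all2 (\<lambda>(\<delta>, T) (D, C). \<delta> \<in> D \<and> T \<in> C) cs DCs}
     \<in> etree_rectangles"

definition etree_space :: "etree measure" where
  "etree_space = restrict_space (sigma UNIV etree_rectangles) {T. element_tree T}"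

fun growing_points :: "etree \<Rightarrow> nat" where
  "growing_points Growing = 1"
| "growing_points (Node s cs) = (\<Sum>(\<delta>, T) \<leftarrow> cs. growing_points T)"

text \<open>
  All edges on a path from a growing point to the root, i.e. all edges with a growing point
  below them, have parameter 0 or 1.
\<close>

fun growing_paths_01 :: "etree \<Rightarrow> bool" where
  "growing_paths_01 Growing \<longleftrightarrow> True"
| "growing_paths_01 (Node s cs) \<longleftrightarrow>
     (\<forall>(\<delta>, T) \<in> set cs. growing_points T > 0 \<longrightarrow> \<delta> \<in> {0, 1} \<and> growing_paths_01 T)"

fun trivial_surveys :: "etree \<Rightarrow> bool" where
  "trivial_surveys Growing \<longleftrightarrow> True"
| "trivial_surveys (Node s cs) \<longleftrightarrow>
     s = trivial_dist \<and> (\<forall>(\<delta>, T) \<in> set cs. trivial_surveys T)"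

definition simple_etree :: "etree \<Rightarrow> bool" where
  "simple_etree T \<longleftrightarrow> growing_points T = 1 \<and> growing_paths_01 T \<and> trivial_surveys T"

definition etree_distribution :: "etree measure \<Rightarrow> bool" where
  "etree_distribution P \<longleftrightarrow> prob_space P \<and> sets P = sets etree_space"

definition trivial_etree_distribution :: "etree measure \<Rightarrow> bool" where
  "trivial_etree_distribution P \<longleftrightarrow> (AE T in P. simple_etree T)"


section \<open>The BP operator\<close>

text \<open>The values at \<open>\<plusminus>\<infinity>\<close> are the limits of the finite ones; see the lemmas below.\<close>

fun F_edge :: "real \<Rightarrow> ereal \<Rightarrow> ereal" where
  "F_edge \<delta> (ereal x) = ereal (ln (((1 - \<delta>) * exp x + \<delta>) / (\<delta> * exp x + 1 - \<delta>)))"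
| "F_edge \<delta> PInfty =
     (if \<delta> = 0 then \<infinity> else if \<delta> = 1 then -\<infinity> else ereal (ln ((1 - \<delta>) / \<delta>)))"
| "F_edge \<delta> MInfty =
     (if \<delta> = 0 then -\<infinity> else if \<delta> = 1 then \<infinity> else ereal (ln (\<delta> / (1 - \<delta>))))"

definition mixture :: "real \<Rightarrow> ereal measure \<Rightarrow> ereal measure \<Rightarrow> ereal measure" where
  "mixture \<delta> \<mu> \<nu> = measure_of UNIV (sets borel)
     (\<lambda>E. ennreal (1 - \<delta>) * emeasure \<mu> E + ennreal \<delta> * emeasure \<nu> E)"

text \<open>
  The law of \<open>R\<^sub>s + \<Sum>\<^sub>u F\<^bsub>\<delta>\<^sub>u\<^esub>(R\<^sub>u)\<close> for independent \<open>R\<^sub>s \<sim> s\<close> and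
  \<open>R\<^sub>u \<sim> (1 - \<delta>\<^sub>u) \<nu>\<^sub>u + \<delta>\<^sub>u \<nu>\<^sub>u\<^sup>-\<close>, where the list \<open>xs\<close> contains the pairs \<open>(\<delta>\<^sub>u, \<nu>\<^sub>u)\<close>. For LLR
  distributions \<open>\<nu>\<^sub>u\<close> all summands are almost surely different from \<open>-\<infinity>\<close>, so the convention
  for \<open>\<infinity> - \<infinity>\<close> does not matter.
\<close>

definition BP_node :: "ereal measure \<Rightarrow> (real \<times> ereal measure) list \<Rightarrow> ereal measure" where
  "BP_node s xs =
     distr
       (s \<Otimes>\<^sub>M (\<Pi>\<^sub>M u\<in>{..<length xs}.
          mixture (fst (xs ! u)) (snd (xs ! u)) (complement (snd (xs ! u)))))
       borel
       (\<lambda>(r, x). r + (\<Sum>u<length xs. F_edge (fst (xs ! u)) (x u)))"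

fun BP_tree :: "etree \<Rightarrow> ereal measure \<Rightarrow> ereal measure" where
  "BP_tree Growing \<mu> = \<mu>"
| "BP_tree (Node s cs) \<mu> = BP_node s (map (\<lambda>(\<delta>, T). (\<delta>, BP_tree T \<mu>)) cs)"

definition BP :: "etree measure \<Rightarrow> ereal measure \<Rightarrow> ereal measure" where
  "BP P \<mu> = P \<bind> (\<lambda>T. BP_tree T \<mu>)"

definition nontrivial_fixed_point :: "etree measure \<Rightarrow> ereal measure \<Rightarrow> bool" where
  "nontrivial_fixed_point P \<mu> \<longleftrightarrow> LLR_dist \<mu> \<and> \<mu> \<noteq> trivial_dist \<and> BP P \<mu> = \<mu>"


section \<open>Well-definedness\<close>

lemma exp_neg_infinity [simp]: "exp_neg \<infinity> = 0" "exp_neg (-\<infinity>) = \<infinity>"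
  using exp_neg.simps(2,3) by simp_all

lemma F_edge_infinity:
  "F_edge \<delta> \<infinity> =
     (if \<delta> = 0 then \<infinity> else if \<delta> = 1 then -\<infinity> else ereal (ln ((1 - \<delta>) / \<delta>)))"
  "F_edge \<delta> (-\<infinity>) =
     (if \<delta> = 0 then -\<infinity> else if \<delta> = 1 then \<infinity> else ereal (ln (\<delta> / (1 - \<delta>))))"
  using F_edge.simps(2,3)[of \<delta>] by simp_all

lemma F_edge_at_top:
  assumes "0 \<le> \<delta>" "\<delta> \<le> 1"
  shows "((\<lambda>x. F_edge \<delta> (ereal x)) \<longlongrightarrow> F_edge \<delta> \<infinity>) at_top"
proof -
  consider "\<delta> = 0" | "\<delta> = 1" | "0 < \<delta>" "\<delta> < 1" using assms by linarith
  then show ?thesis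
  proof cases
    case 3
    have "((\<lambda>x. ln (((1 - \<delta>) * exp x + \<delta>) / (\<delta> * exp x + 1 - \<delta>))) \<longlongrightarrow> ln ((1 - \<delta>) / \<delta>)) at_top"
      using 3 by (real_asymp simp: field_simps)
    then show ?thesis using 3 by (simp add: F_edge_infinity)
  next
    case 1 then show ?thesis
      by (auto simp: F_edge_infinity tendsto_PInfty eventually_at_top_dense)
  next
    case 2
    have "\<forall>\<^sub>F x in at_top. - x < r" for r :: real
      using eventually_gt_at_top[of "- r"] by eventually_elim simp
    with 2 show ?thesis by (simp add: F_edge_infinity tendsto_MInfty ln_div)
  qed
qed

lemma F_edge_at_bot:
  assumes "0 \<le> \<delta>" "\<delta> \<le> 1"
  shows "((\<lambda>x. F_edge \<delta> (ereal x)) \<longlongrightarrow> F_edge \<delta> (-\<infinity>)) at_bot"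
proof -
  consider "\<delta> = 0" | "\<delta> = 1" | "0 < \<delta>" "\<delta> < 1" using assms by linarith
  then show ?thesis
  proof cases
    case 3
    have "((\<lambda>x. ln (((1 - \<delta>) * exp x + \<delta>) / (\<delta> * exp x + 1 - \<delta>))) \<longlongrightarrow> ln (\<delta> / (1 - \<delta>))) at_bot"
      using 3 by (real_asymp simp: field_simps)
    then show ?thesis using 3 by (simp add: F_edge_infinity)
  next
    case 1 then show ?thesis
      by (auto simp: F_edge_infinity tendsto_MInfty eventually_at_bot_dense)
  next
    case 2
    have "\<forall>\<^sub>F x in at_bot. r < - x" for r :: real
      using eventually_gt_at_bot[of "- r"] by eventually_elim simp
    with 2 show ?thesis by (simp add: F_edge_infinity tendsto_PInfty ln_div)
  qed
qed

lemma measurable_exp_neg [measurable]: "exp_neg \<in> borel_measurable borel"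
proof -
  have "exp_neg = (\<lambda>x. if x = \<infinity> then 0 else if x = -\<infinity> then \<infinity>
                          else ennreal (exp (- real_of_ereal x)))"
  proof
    fix x show "exp_neg x = (if x = \<infinity> then 0 else if x = -\<infinity> then \<infinity>
                          else ennreal (exp (- real_of_ereal x)))"
      by (cases x) simp_all
  qed
  also have "\<dots> \<in> borel_measurable borel" by measurable
  finally show ?thesis .
qed

lemma ex1_complement:
  assumes "LLR_dist \<mu>"
  shows "\<exists>!\<nu>. is_complement \<mu> \<nu>"
proof (rule ex_ex1I)
  have [measurable_cong, simp]: "sets \<mu> = sets borel"
    and le1: "(\<integral>\<^sup>+ r. exp_neg r \<partial>\<mu>) \<le> 1"
    and "emeasure \<mu> {-\<infinity>} = 0"
    using assms by (auto simp: LLR_dist_def distribution_gt_MInf_def)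
  have sp[simp]: "space \<mu> = UNIV" using sets_eq_imp_space_eq[of \<mu> borel] by simp
  define c where "c = 1 - (\<integral>\<^sup>+ r. exp_neg r \<partial>\<mu>)"
  define D where "D = density \<mu> exp_neg"
  define f where "f E = emeasure D E + c * indicator E (-\<infinity>)" for E
  define \<nu> where "\<nu> = measure_of UNIV (sets borel) f"
  have sD: "sets D = sets borel" by (simp add: D_def)
  have eD: "emeasure D E = (\<integral>\<^sup>+ r. exp_neg r * indicator E r \<partial>\<mu>)" if "E \<in> sets borel" for E
    using that unfolding D_def by (subst emeasure_density) auto
  have sa: "sigma_sets UNIV (sets (borel :: ereal measure)) = sets borel"
    by (metis sets.sigma_sets_eq space_borel)
  have "countably_additive (sets borel) f"
  proof (rule countably_additiveI)
    fix A :: "nat \<Rightarrow> ereal set"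
    assume A: "range A \<subseteq> sets borel" "disjoint_family A"
    have "(\<Sum>i. emeasure D (A i)) = emeasure D (\<Union>i. A i)"
      using A by (intro suminf_emeasure) (auto simp: sD)
    moreover have "(\<Sum>i. c * indicator (A i) (-\<infinity>)) = c * indicator (\<Union>i. A i) (-\<infinity>)"
      using A(2) by (subst ennreal_suminf_cmult) (simp add: suminf_indicator)
    ultimately show "(\<Sum>i. f (A i)) = f (\<Union>i. A i)"
      unfolding f_def by (subst suminf_add[symmetric]) auto
  qed
  then have em: "emeasure \<nu> E = f E" if "E \<in> sets borel" for E
    unfolding \<nu>_def using that
    by (intro emeasure_measure_of_sigma)
       (auto simp: positive_def f_def sets.sigma_algebra_axioms[of borel, simplified])
  have s\<nu>: "sets \<nu> = sets borel" and sp\<nu>: "space \<nu> = UNIV"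
    by (simp_all add: \<nu>_def sa)
  have "emeasure \<nu> UNIV = 1"
    using le1 by (simp add: em f_def eD c_def add_diff_inverse_ennreal)
  moreover have "emeasure \<nu> {\<infinity>} = 0"
  proof -
    have "(\<integral>\<^sup>+ r. exp_neg r * indicator {\<infinity>} r \<partial>\<mu>) = (\<integral>\<^sup>+ r. 0 \<partial>\<mu>)"
      by (intro nn_integral_cong) (auto simp: indicator_def)
    then show ?thesis by (simp add: em f_def eD)
  qed
  moreover have "emeasure \<nu> E = (\<integral>\<^sup>+ r. exp_neg r * indicator E r \<partial>\<mu>)"
    if "E \<in> sets borel" "E \<subseteq> {-\<infinity><..<\<infinity>}" for E
    using that by (auto simp: em f_def eD indicator_def)
  ultimately have "is_complement \<mu> \<nu>"
    by (auto simp: is_complement_def distribution_lt_PInf_def s\<nu> sp\<nu> intro!: prob_spaceI)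
  then show "\<exists>\<nu>. is_complement \<mu> \<nu>" ..
next
  fix \<nu> \<nu>' assume c: "is_complement \<mu> \<nu>" "is_complement \<mu> \<nu>'"
  have split: "emeasure \<rho> E = emeasure \<rho> (E \<inter> {-\<infinity><..<\<infinity>})
      + (1 - emeasure \<rho> {-\<infinity><..<\<infinity>}) * indicator E (-\<infinity>)"
    if "is_complement \<mu> \<rho>" "E \<in> sets borel" for \<rho> E
  proof -
    have s: "sets \<rho> = sets borel" and n: "emeasure \<rho> {\<infinity>} = 0" and "prob_space \<rho>"
      using that by (auto simp: is_complement_def distribution_lt_PInf_def)
    then interpret prob_space \<rho> by simp
    have sp: "space \<rho> = UNIV" using sets_eq_imp_space_eq[OF s] by simp
    have U: "UNIV = {-\<infinity><..<\<infinity>::ereal} \<union> {-\<infinity>} \<union> {\<infinity>}"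
    proof -
      have "x \<in> {-\<infinity><..<\<infinity>} \<union> {-\<infinity>} \<union> {\<infinity>}" for x :: ereal by (cases x) auto
      then show ?thesis by blast
    qed
    have null: "emeasure \<rho> (A \<inter> {\<infinity>}) = 0" for A
      using emeasure_mono[of "A \<inter> {\<infinity>}" "{\<infinity>}" \<rho>] n s by auto
    have dec: "emeasure \<rho> A = emeasure \<rho> (A \<inter> {-\<infinity><..<\<infinity>}) + emeasure \<rho> (A \<inter> {-\<infinity>})"
      if A: "A \<in> sets borel" for A
    proof -
      have "emeasure \<rho> A = emeasure \<rho> ((A \<inter> {-\<infinity><..<\<infinity>} \<union> A \<inter> {-\<infinity>}) \<union> A \<inter> {\<infinity>})"
        using U by (intro arg_cong[where f = "emeasure \<rho>"]) blast
      also have "\<dots> = emeasure \<rho> (A \<inter> {-\<infinity><..<\<infinity>} \<union> A \<inter> {-\<infinity>}) + emeasure \<rho> (A \<inter> {\<infinity>})"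
        using A s by (intro plus_emeasure[symmetric]) auto
      also have "emeasure \<rho> (A \<inter> {-\<infinity><..<\<infinity>} \<union> A \<inter> {-\<infinity>})
          = emeasure \<rho> (A \<inter> {-\<infinity><..<\<infinity>}) + emeasure \<rho> (A \<inter> {-\<infinity>})"
        using A s by (intro plus_emeasure[symmetric]) auto
      finally show ?thesis by (simp add: null)
    qed
    have "1 = emeasure \<rho> {-\<infinity><..<\<infinity>} + emeasure \<rho> {-\<infinity>}"
      using dec[of UNIV] emeasure_space_1 sp by simp
    then have "emeasure \<rho> {-\<infinity>} = 1 - emeasure \<rho> {-\<infinity><..<\<infinity>}"
      by (metis emeasure_finite ennreal_add_diff_cancel_left)
    then show ?thesis using dec[OF that(2)] by (auto simp: indicator_def)
  qed
  have eq: "emeasure \<nu> E = emeasure \<nu>' E" if "E \<in> sets borel" "E \<subseteq> {-\<infinity><..<\<infinity>}" for E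
    using c that by (auto simp: is_complement_def)
  have "emeasure \<nu> E = emeasure \<nu>' E" if "E \<in> sets borel" for E
    using split[OF c(1) that] split[OF c(2) that] eq[of "E \<inter> {-\<infinity><..<\<infinity>}"] eq[of "{-\<infinity><..<\<infinity>}"] that
    by simp
  then show "\<nu> = \<nu>'"
    using c by (intro measure_eqI) (auto simp: is_complement_def distribution_lt_PInf_def)
qed

end

(*
  An LLR distribution is encoded by the law on [-1,1] of the posterior mean tanh(r/2) under a uniform
  prior (an arbitrary law of mean 0); symmetric LLR distributions become symmetric laws, an edge of
  parameter \<delta> becomes multiplication by 1 - 2\<delta>, and the degradation order becomes the convex
  order. All of this is read off from the function absdev(x,y) = E|x + y a|, which determines the law.

  The BP operator Q is monotone for degradation, and the stringy tree lemma (independent noise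
  on the branches beats common noise before branching) makes it sublinear: t Q m is degraded with respect
  to Q (t m) for symmetric m and 0 <= t <= 1. Let M be the limit of Q^h applied to the perfect law on
  {-1,1}. Every nontrivial law dominates t M for some t > 0, so everything reduces to showing that the
  increasing limit N of Q^h (t M) equals M. Let t be maximal such that N dominates t M and suppose t < 1.
  Comparing how mass near the top of the support of N is produced shows that N and M have supports of the
  same radius. Then consider the largest k at which the potential functions E(|a| - k)^+ of N and t M touch
  at a positive value. An element tree that combines two nontrivial components can only preserve a contact
  at k if there is a contact at some k' > k, whereas a tree that merely scales its input strictly decreases
  the potential function unless it is simple; so P would be trivial. If there is no contact, t was not maximal.
*)
theory Submission
  imports Defs
begin

section \<open>Posterior laws\<close>

text \<open>The step from a maximal t < 1 to a contradiction needs either a largest contact at a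
  positive value or a uniform gap. Both could fail at the edge of the supports, where the potential
  functions tend to 0. This is why the radii are compared first: if N and M share the radius r, then
  t M ends at t r < r, the contacts form a compact set inside [0, t r], and in the absence of
  contacts the gap is bounded below on [0, c] for t r < c < r, while a slightly larger multiple of M
  still ends before c. Contacts move upwards because an independent observation with posterior mean
  b replaces the threshold k by (k + b) / (1 + k b), which exceeds k for 0 < b and k < 1. Symmetry
  enters through the comparison of noise before and after branching, but an arbitrary LLR
  distribution only has to be squeezed between the orbits of two symmetric laws. The lower orbit
  starts at t M instead of a multiple of the perfect law, because sublinearity at the fixed point M
  makes that orbit increasing.\<close>

definition posterior_law :: "real measure \<Rightarrow> bool" where
  "posterior_law m \<longleftrightarrow> real_distribution m \<and> (AE a in m. \<bar>a\<bar> \<le> 1) \<and> (LINT a|m. a) = 0"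

text \<open>The two-argument form makes the family closed under both operations: scaling acts on
  \<open>y\<close>, and conditioning on an independent observation b sends (x, y) to (x + y b, y + x
  b).\<close>

definition absdev :: "real measure \<Rightarrow> real \<Rightarrow> real \<Rightarrow> real" where
  "absdev m x y = (LINT a|m. \<bar>x + y * a\<bar>)"

lemma posterior_lawD:
  assumes "posterior_law m"
  shows "prob_space m" "sets m = sets borel" "space m = UNIV" "AE a in m. \<bar>a\<bar> \<le> 1"
    "(LINT a|m. a) = 0" "real_distribution m"
  using assms by (auto simp: posterior_law_def real_distribution_def real_distribution_axioms_def
      real_distribution.space_eq_univ)

lemma posterior_law_integrable:
  fixes f :: "real \<Rightarrow> real"
  assumes "posterior_law m" "f \<in> borel_measurable borel" "\<And>a. \<bar>a\<bar> \<le> 1 \<Longrightarrow> \<bar>f a\<bar> \<le> B"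
  shows "integrable m f"
proof -
  interpret prob_space m using posterior_lawD(1)[OF assms(1)] .
  show ?thesis
  proof (rule integrable_const_bound[where B=B])
    show "AE a in m. norm (f a) \<le> B"
      using posterior_lawD(4)[OF assms(1)] assms(3) by auto
    show "f \<in> borel_measurable m"
      using assms(2) measurable_cong_sets[OF posterior_lawD(2)[OF assms(1)] refl] by blast
  qed
qed

lemma posterior_law_affine:
  assumes "posterior_law m"
  shows "(LINT a|m. p + q * a) = p" "integrable m (\<lambda>a. p + q * a)"
proof -
  interpret prob_space m using posterior_lawD(1)[OF assms(1)] .
  have "integrable m (\<lambda>a. q * a)"
    by (rule posterior_law_integrable[OF assms, where B="\<bar>q\<bar>"])
      (auto simp: abs_mult mult_left_le)
  then show "(LINT a|m. p + q * a) = p" "integrable m (\<lambda>a. p + q * a)"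
    using posterior_lawD(5)[OF assms] by (simp_all add: prob_space)
qed

lemma absdev_integrable:
  assumes "posterior_law m"
  shows "integrable m (\<lambda>a. \<bar>x + y * a\<bar>)"
  using posterior_law_affine(2)[OF assms] by (rule integrable_abs)

lemma absdev_ge_abs:
  assumes "posterior_law m"
  shows "\<bar>x\<bar> \<le> absdev m x y"
  using integral_abs_bound[of m "\<lambda>a. x + y * a"] posterior_law_affine(1)[OF assms]
  by (simp add: absdev_def)

text \<open>A convex function on [-1, 1] lies below its chord, and an affine function integrates to
  its value at the mean 0. The bound is attained by the uniform law on {-1, 1}, see
  \<open>absdev_perfect\<close>.\<close>

lemma absdev_le_max:
  assumes "posterior_law m"
  shows "absdev m x y \<le> max \<bar>x\<bar> \<bar>y\<bar>"
proof -
  \<comment> \<open>\<open>?p + ?q * a\<close> is the chord of \<open>\<bar>x + y * a\<bar>\<close>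
    through the endpoints -1 and 1.\<close>
  let ?p = "(\<bar>x+y\<bar> + \<bar>x-y\<bar>)/2" and ?q = "(\<bar>x+y\<bar> - \<bar>x-y\<bar>)/2"
  have "absdev m x y \<le> (LINT a|m. ?p + ?q * a)"
    unfolding absdev_def
  proof (rule integral_mono_AE[OF absdev_integrable[OF assms] posterior_law_affine(2)[OF assms]])
    show "AE a in m. \<bar>x + y * a\<bar> \<le> ?p + ?q * a"
      using posterior_lawD(4)[OF assms]
    proof eventually_elim
      case (elim a)
      have "x + y * a = (1+a)/2 * (x+y) + (1-a)/2*(x-y)" by (simp add: field_simps)
      also have "\<bar>\<dots>\<bar> \<le> (1+a)/2 * \<bar>x+y\<bar> + (1-a)/2*\<bar>x-y\<bar>"
        using elim by (intro order.trans[OF abs_triangle_ineq]) (simp add: abs_mult)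
      also have "\<dots> = ?p + ?q * a" by (simp add: field_simps)
      finally show ?case .
    qed
  qed
  also have "\<dots> = max \<bar>x\<bar> \<bar>y\<bar>" unfolding posterior_law_affine(1)[OF assms] by (auto
      simp: max_def abs_if)
  finally show ?thesis .
qed

lemma absdev_nonneg: "0 \<le> absdev m x y"
  by (simp add: absdev_def)

lemma absdev_homogeneous: "absdev m (c * x) (c * y) = \<bar>c\<bar> * absdev m x y"
proof -
  have "absdev m (c * x) (c * y) = (LINT a|m. \<bar>c\<bar> * \<bar>x + y * a\<bar>)"
    unfolding absdev_def by (intro Bochner_Integration.integral_cong) (auto
        simp: abs_mult[symmetric] algebra_simps)
  then show ?thesis by (simp add: absdev_def)
qed

lemma absdev_uminus: "absdev m (- x) (- y) = absdev m x y"
  using absdev_homogeneous[of m "-1" x y] by simp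

lemma absdev_diff_le:
  assumes "posterior_law m"
  shows "\<bar>absdev m x y - absdev m x' y'\<bar> \<le> \<bar>x - x'\<bar> + \<bar>y - y'\<bar>"
proof -
  interpret prob_space m using posterior_lawD(1)[OF assms(1)] .
  have "absdev m x y - absdev m x' y' = (LINT a|m. \<bar>x + y * a\<bar> - \<bar>x' + y' * a\<bar>)"
    unfolding absdev_def by (intro Bochner_Integration.integral_diff[symmetric] absdev_integrable assms)
  also have "\<bar>\<dots>\<bar> \<le> (LINT a|m. \<bar>\<bar>x + y * a\<bar> - \<bar>x' + y' * a\<bar>\<bar>)"
    by (rule integral_abs_bound)
  also have "\<dots> \<le> (LINT a|m. \<bar>x - x'\<bar> + \<bar>y - y'\<bar>)"
  proof (rule integral_mono_AE)
    show "AE a in m. \<bar>\<bar>x + y * a\<bar> - \<bar>x' + y' * a\<bar>\<bar> \<le> \<bar>x - x'\<bar> + \<bar>y - y'\<bar>"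
      using posterior_lawD(4)[OF assms]
    proof eventually_elim
      case (elim a)
      have "\<bar>(y - y') * a\<bar> \<le> \<bar>y - y'\<bar>" using elim by (simp add: abs_mult mult_left_le)
      then show ?case by (simp add: algebra_simps)
    qed
  qed (intro integrable_abs Bochner_Integration.integrable_diff absdev_integrable assms | simp)+
  also have "\<dots> = \<bar>x - x'\<bar> + \<bar>y - y'\<bar>" by (simp add: prob_space)
  finally show ?thesis .
qed

lemma continuous_on_absdev:
  assumes "posterior_law m" "continuous_on S f" "continuous_on S g"
  shows "continuous_on S (\<lambda>z. absdev m (f z) (g z))"
proof -
  have "isCont (\<lambda>p. absdev m (fst p) (snd p)) p" for p
    unfolding isCont_def
  proof (rule Lim_null_comparison[THEN LIM_zero_cancel])
    show "\<forall>\<^sub>F q in at p. norm (absdev m (fst q) (snd q) - absdev m (fst p) (snd p))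
        \<le> \<bar>fst q - fst p\<bar> + \<bar>snd q - snd p\<bar>"
      using absdev_diff_le[OF assms(1)] by (intro always_eventually) simp
    have "((\<lambda>q. \<bar>fst q - fst p\<bar> + \<bar>snd q - snd p\<bar>) \<longlongrightarrow> \<bar>fst p - fst p\<bar> + \<bar>snd p - snd p\<bar>) (at p)"
      by (intro tendsto_intros)
    then show "((\<lambda>q. \<bar>fst q - fst p\<bar> + \<bar>snd q - snd p\<bar>) \<longlongrightarrow> 0) (at p)" by simp
  qed
  then have "continuous_on UNIV (\<lambda>p. absdev m (fst p) (snd p))"
    by (simp add: continuous_at_imp_continuous_on)
  from continuous_on_compose2[OF this continuous_on_Pair[OF assms(2,3)]] show ?thesis by simp
qed

lemma absdev_measurable:
  assumes "posterior_law m"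
    and [measurable]: "f \<in> borel_measurable N" "g \<in> borel_measurable N"
  shows "(\<lambda>z. absdev m (f z) (g z)) \<in> borel_measurable N"
proof -
  have [measurable]: "(\<lambda>p. absdev m (fst p) (snd p)) \<in> borel_measurable borel"
    by (intro borel_measurable_continuous_onI continuous_on_absdev assms continuous_intros)
  have "(\<lambda>z. (\<lambda>p. absdev m (fst p) (snd p)) (f z, g z)) \<in> borel_measurable N"
    by measurable
  then show ?thesis by simp
qed

text \<open>The right difference quotient of E|a - k| as a function of k tends to P(a \<le> k) - P(a
  > k). Taking it from the right matches the right-continuous \<open>cdf\<close>, so atoms need no
  special treatment, and the law is recovered from \<open>absdev\<close>.\<close>

lemma absdev_unique_limit:
  assumes "posterior_law m"
  shows "(\<lambda>n. real (Suc n) * (absdev m (- k - 1 / real (Suc n)) 1 - absdev m (- k) 1)) \<longlonglongrightarrow> 2 * cdf m k - 1"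
proof -
  interpret real_distribution m using posterior_lawD(6)[OF assms(1)] .
  let ?h = "\<lambda>n::nat. 1 / real (Suc n)"
  let ?s = "\<lambda>n a. real (Suc n) * (\<bar>- k - ?h n + a\<bar> - \<bar>- k + a\<bar>)"
  let ?f = "\<lambda>a. if a \<le> k then 1 else - 1 :: real"
  have "(\<lambda>n. LINT a|m. ?s n a) \<longlonglongrightarrow> (LINT a|m. ?f a)"
  proof (rule integral_dominated_convergence[where w="\<lambda>_. 1"])
    show "AE a in m. (\<lambda>n. ?s n a) \<longlonglongrightarrow> ?f a"
    proof (rule AE_I2)
      fix a
      have "\<forall>\<^sub>F n in sequentially. ?s n a = ?f a"
      proof (cases "a \<le> k")
        case True
        then have "\<bar>- k - ?h n + a\<bar> = k + ?h n - a" "\<bar>- k + a\<bar> = k - a" for n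
        proof -
          have "0 \<le> ?h n" by simp
          then show "\<bar>- k - ?h n + a\<bar> = k + ?h n - a" "\<bar>- k + a\<bar> = k - a" using True by linarith+
        qed
        then have "?s n a = ?f a" for n using True by simp
        then show ?thesis by simp
      next
        case False
        have "?h \<longlonglongrightarrow> 0" by real_asymp
        then have "\<forall>\<^sub>F n in sequentially. ?h n < a - k"
          using False by (intro order_tendstoD(2)[of _ 0]) auto
        then show ?thesis
        proof eventually_elim
          case (elim n)
          then have "\<bar>- k - ?h n + a\<bar> = - k - ?h n + a" "\<bar>- k + a\<bar> = - k + a" using False by auto
          then show ?case using False by simp
        qed
      qed
      then show "(\<lambda>n. ?s n a) \<longlonglongrightarrow> ?f a" by (rule tendsto_eventually)
    qed
    show "AE a in m. norm (?s n a) \<le> 1" for n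
    proof (rule AE_I2)
      fix a
      have "0 \<le> ?h n" by simp
      then have "\<bar>\<bar>- k - ?h n + a\<bar> - \<bar>- k + a\<bar>\<bar> \<le> ?h n" by linarith
      then have "real (Suc n) * \<bar>\<bar>- k - ?h n + a\<bar> - \<bar>- k + a\<bar>\<bar> \<le> real (Suc n) * ?h n"
        by (intro mult_left_mono) auto
      then show "norm (?s n a) \<le> 1" by (simp add: abs_mult)
    qed
  qed simp_all
  moreover have "(LINT a|m. ?s n a) = real (Suc n) * (absdev m (- k - ?h n) 1 - absdev m (- k) 1)"
      for n
    unfolding absdev_def
    using absdev_integrable[OF assms, of "- k - ?h n" 1] absdev_integrable[OF assms, of "-k" 1]
    by (subst Bochner_Integration.integral_diff[symmetric]) auto
  moreover have "(LINT a|m. ?f a) = 2 * cdf m k - 1"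
  proof -
    have "(LINT a|m. ?f a) = (LINT a|m. 2 * indicator {..k} a - 1)"
      by (intro Bochner_Integration.integral_cong) (auto simp: indicator_def)
    also have "\<dots> = 2 * cdf m k - 1"
    proof -
      have "integrable m (indicator {..k} :: real \<Rightarrow> real)"
        by (rule integrable_const_bound[where B=1]) auto
      then show ?thesis
        using prob_space by (subst Bochner_Integration.integral_diff) (auto simp: cdf_def)
    qed
    finally show ?thesis .
  qed
  ultimately show ?thesis by simp
qed

lemma absdev_unique:
  assumes "posterior_law m" "posterior_law m'" "\<And>x y. absdev m x y = absdev m' x y"
  shows "m = m'"
proof (rule cdf_unique[OF posterior_lawD(6)[OF assms(1)] posterior_lawD(6)[OF assms(2)]], rule ext)
  fix k
  from absdev_unique_limit[OF assms(1), of k] absdev_unique_limit[OF assms(2), of k]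
  show "cdf m k = cdf m' k"
    unfolding assms(3) by (auto dest: LIMSEQ_unique)
qed

text \<open>Weak convergence on the real line tests bounded continuous functions. Composing with the
  retraction onto [-1, 1] makes affine integrands admissible without changing their integrals
  against posterior laws.\<close>

definition clamp1 :: "real \<Rightarrow> real" where "clamp1 a = max (- 1) (min 1 a)"

lemma clamp1_id: "\<bar>a\<bar> \<le> 1 \<Longrightarrow> clamp1 a = a"
  and clamp1_bound: "\<bar>clamp1 a\<bar> \<le> 1"
  by (auto simp: clamp1_def)

lemma isCont_clamp1: "isCont clamp1 a"
  unfolding clamp1_def by (intro continuous_intros)

lemma clamp1_measurable [measurable]: "clamp1 \<in> borel_measurable borel"
  unfolding clamp1_def by measurable

lemma integral_clamp1:
  fixes f :: "real \<Rightarrow> real"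
  assumes "posterior_law m" "f \<in> borel_measurable borel"
  shows "(LINT a|m. f (clamp1 a)) = (LINT a|m. f a)"
proof (rule integral_cong_AE)
  have [measurable_cong]: "sets m = sets borel" using posterior_lawD(2)[OF assms(1)] .
  note assms(2)[measurable]
  show "(\<lambda>a. f (clamp1 a)) \<in> borel_measurable m" "f \<in> borel_measurable m" by measurable
  show "AE a in m. f (clamp1 a) = f a"
    using posterior_lawD(4)[OF assms(1)] by eventually_elim (simp add: clamp1_id)
qed

lemma tight_posterior_laws:
  assumes "\<And>n. posterior_law (m n)"
  shows "tight m"
  unfolding tight_def
proof (intro conjI allI impI)
  show "real_distribution (m n)" for n using posterior_lawD(6)[OF assms] .
  fix e :: real assume "0 < e"
  have "1 - e < measure (m n) {-2<..1}" for n
  proof -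
    interpret real_distribution "m n" using posterior_lawD(6)[OF assms] .
    have "prob {-2<..1} = 1"
      by (subst prob_eq_1) (use posterior_lawD(4)[OF assms, of n] in \<open>auto elim!: eventually_mono\<close>)
    then show ?thesis using \<open>0 < e\<close> by simp
  qed
  then show "\<exists>a b. a < b \<and> (\<forall>n. 1 - e < measure (m n) {a<..b})"
    by (intro exI[of _ "-2"] exI[of _ 1]) simp
qed

lemma posterior_law_weak_limit:
  assumes m: "\<And>n. posterior_law (m n)" and M: "real_distribution M" and conv: "weak_conv_m m M"
  shows "posterior_law M" "\<And>x y. (\<lambda>n. absdev (m n) x y) \<longlonglongrightarrow> absdev M x y"
proof -
  interpret M: real_distribution M by fact
  have lim: "(\<lambda>n. LINT a|m n. f a) \<longlonglongrightarrow> (LINT a|M. f a)"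
    if "\<And>x. isCont f x" "\<And>x. norm (f x) \<le> B" for f :: "real \<Rightarrow> real" and B
  proof -
    interpret real_distribution "m n" for n using posterior_lawD(6)[OF m] .
    show ?thesis
      using weak_conv_imp_integral_bdd_continuous_conv[OF posterior_lawD(6)[OF m] M conv that] .
  qed
  \<comment> \<open>A bounded continuous function that vanishes exactly on [-1, 1]: its zero
    integral is inherited by the limit and confines the limit to that interval.\<close>
  let ?f = "\<lambda>a::real. min 1 (max 0 (\<bar>a\<bar> - 1))"
  have "(LINT a|m n. ?f a) = 0" for n
    using posterior_lawD(4)[OF m[of n]]
    by (intro integral_eq_zero_AE) (auto elim!: eventually_mono)
  moreover have "(\<lambda>n. LINT a|m n. ?f a) \<longlonglongrightarrow> (LINT a|M. ?f a)"
    by (rule lim[of ?f 1]) (auto intro!: continuous_intros)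
  ultimately have "(LINT a|M. ?f a) = 0" by (simp add: LIMSEQ_const_iff)
  then have "AE a in M. ?f a = 0"
    by (subst (asm) integral_nonneg_eq_0_iff_AE)
      (auto intro!: M.integrable_const_bound[of _ 1])
  then have ae: "AE a in M. \<bar>a\<bar> \<le> 1"
    by eventually_elim (auto simp: min_def max_def split: if_splits)
  have "(\<lambda>n. LINT a|m n. clamp1 a) \<longlonglongrightarrow> (LINT a|M. clamp1 a)"
    by (rule lim[of clamp1 1]) (auto intro!: isCont_clamp1 clamp1_bound)
  moreover have "(LINT a|m n. clamp1 a) = 0" for n
    using integral_clamp1[OF m[of n], of "\<lambda>a. a"] posterior_lawD(5)[OF m[of n]] by simp
  ultimately have "(LINT a|M. clamp1 a) = 0" by (simp add: LIMSEQ_const_iff)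
  moreover have "(LINT a|M. clamp1 a) = (LINT a|M. a)"
    by (rule integral_cong_AE) (use ae in \<open>auto elim!: eventually_mono simp: clamp1_id\<close>)
  ultimately show pM: "posterior_law M" using ae M by (simp add: posterior_law_def)
  fix x y
  have "(\<lambda>n. LINT a|m n. \<bar>x + y * clamp1 a\<bar>) \<longlonglongrightarrow> (LINT a|M. \<bar>x + y * clamp1 a\<bar>)"
  proof (rule lim[of _ "\<bar>x\<bar> + \<bar>y\<bar>"])
    show "isCont (\<lambda>a. \<bar>x + y * clamp1 a\<bar>) a" for a by (intro continuous_intros isCont_clamp1)
    show "norm \<bar>x + y * clamp1 a\<bar> \<le> \<bar>x\<bar> + \<bar>y\<bar>" for a
      using clamp1_bound[of a] abs_triangle_ineq[of x "y * clamp1 a"]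
        mult_left_mono[of "\<bar>clamp1 a\<bar>" 1 "\<bar>y\<bar>"] by (simp add: abs_mult)
  qed
  then show "(\<lambda>n. absdev (m n) x y) \<longlonglongrightarrow> absdev M x y"
    using integral_clamp1[OF m, of "\<lambda>a. \<bar>x + y * a\<bar>"] integral_clamp1[OF pM, of "\<lambda>a. \<bar>x + y * a\<bar>"]
    by (simp add: absdev_def)
qed

text \<open>Tightness yields a limit law along a subsequence; convergence of every
  \<open>absdev\<close> along the whole sequence then forces the limits to be the values of this
  law.\<close>

lemma absdev_convergent_imp_limit:
  assumes m: "\<And>n. posterior_law (m n)" and conv: "\<And>x y. convergent (\<lambda>n. absdev (m n) x y)"
  obtains M where "posterior_law M" "\<And>x y. (\<lambda>n. absdev (m n) x y) \<longlonglongrightarrow> absdev M x y"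
proof -
  obtain r M where r: "strict_mono r" and M: "real_distribution M" "weak_conv_m (m \<circ> id \<circ> r) M"
    using tight_imp_convergent_subsubsequence[OF tight_posterior_laws[of m, OF m], of id]
    by (auto simp: strict_mono_id)
  have M': "posterior_law M" "(\<lambda>n. absdev (m (r n)) x y) \<longlonglongrightarrow> absdev M x y" for x y
    using posterior_law_weak_limit[of "m \<circ> id \<circ> r" M] m M by auto
  have "(\<lambda>n. absdev (m n) x y) \<longlonglongrightarrow> absdev M x y" for x y
  proof -
    obtain L where L: "(\<lambda>n. absdev (m n) x y) \<longlonglongrightarrow> L"
      using conv[of x y] by (auto simp: convergent_def)
    then have "(\<lambda>n. absdev (m (r n)) x y) \<longlonglongrightarrow> L"
      using LIMSEQ_subseq_LIMSEQ[OF L r] by (simp add: comp_def)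
    then have "L = absdev M x y" using M'(2) LIMSEQ_unique by blast
    with L show ?thesis by simp
  qed
  with M'(1) that show thesis by blast
qed

text \<open>Every weak subsequential limit has the same \<open>absdev\<close> as \<open>M\<close>
  and hence equals \<open>M\<close>; tightness does the rest.\<close>

lemma absdev_tendsto_imp_weak_conv:
  assumes m: "\<And>n. posterior_law (m n)" and M: "posterior_law M"
    and conv: "\<And>x y. (\<lambda>n. absdev (m n) x y) \<longlonglongrightarrow> absdev M x y"
  shows "weak_conv_m m M"
proof (rule tight_subseq_weak_converge)
  show "real_distribution (m n)" for n using posterior_lawD(6)[OF m] .
  show "real_distribution M" using posterior_lawD(6)[OF M] .
  show "tight m" by (rule tight_posterior_laws[OF m])
  fix s \<nu> assume s: "strict_mono (s :: nat \<Rightarrow> nat)" and \<nu>: "real_distribution \<nu>"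
      "weak_conv_m (m \<circ> s) \<nu>"
  have *: "posterior_law \<nu>" "(\<lambda>n. absdev (m (s n)) x y) \<longlonglongrightarrow> absdev \<nu> x y" for x y
    using posterior_law_weak_limit[of "m \<circ> s" \<nu>] m \<nu> by auto
  have "absdev \<nu> x y = absdev M x y" for x y
    using LIMSEQ_subseq_LIMSEQ[OF conv s, of x y] *(2)[of x y] LIMSEQ_unique
    by (auto simp: comp_def)
  then have "\<nu> = M" using absdev_unique[OF *(1) M] by blast
  then show "weak_conv_m (m \<circ> s) M" using \<nu> by simp
qed

section \<open>Scaling and combination of posterior laws\<close>

definition scale :: "real \<Rightarrow> real measure \<Rightarrow> real measure" where
  "scale s m = distr m borel (\<lambda>a. s * a)"

text \<open>
  The posterior mean given two independent observations with posterior means \<open>a\<close> and \<open>b\<close>: under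
  either value of the input these have densities \<open>(1 + a) * (1 + b)\<close> and \<open>(1 - a) * (1 - b)\<close>, whose
  average is \<open>1 + a * b\<close>.
\<close>

definition combine :: "real measure \<Rightarrow> real measure \<Rightarrow> real measure" where
  "combine m1 m2 = distr (density (m1 \<Otimes>\<^sub>M m2) (\<lambda>(a, b). ennreal (1 + a * b))) borel
     (\<lambda>(a, b). (a + b) / (1 + a * b))"

lemma posterior_law_scale:
  assumes "posterior_law m" "\<bar>s\<bar> \<le> 1"
  shows "posterior_law (scale s m)"
  unfolding posterior_law_def
proof (intro conjI)
  have [measurable_cong]: "sets m = sets borel" using posterior_lawD(2)[OF assms(1)] .
  interpret prob_space m using posterior_lawD(1)[OF assms(1)] .
  show "real_distribution (scale s m)" by (simp add: scale_def)
  have "AE a in m. \<bar>s * a\<bar> \<le> 1"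
    using posterior_lawD(4)[OF assms(1)] assms(2)
    by (auto elim!: eventually_mono simp: abs_mult intro: mult_le_one)
  then show "AE a in scale s m. \<bar>a\<bar> \<le> 1"
    unfolding scale_def by (subst AE_distr_iff) auto
  show "(LINT a|scale s m. a) = 0"
    unfolding scale_def
    using posterior_law_affine(1)[OF assms(1), of 0 s] by (subst integral_distr) auto
qed

lemma absdev_scale:
  assumes "posterior_law m"
  shows "absdev (scale s m) x y = absdev m x (s * y)"
proof -
  have [measurable_cong]: "sets m = sets borel" using posterior_lawD(2)[OF assms(1)] .
  show ?thesis unfolding scale_def absdev_def by (subst integral_distr) (auto simp: ac_simps)
qed

lemma abs_one_plus_mult: "\<bar>a::real\<bar> \<le> 1 \<Longrightarrow> \<bar>b\<bar> \<le> 1 \<Longrightarrow> 0 \<le> 1 + a * b"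
  using abs_le_iff[of "a * b" 1] mult_le_one[of "\<bar>a\<bar>" "\<bar>b\<bar>"] by (simp add: abs_mult)

text \<open>Expand (1 - a)(1 - b) \<ge> 0 and (1 + a)(1 + b) \<ge> 0. Besides keeping the combined
  posterior mean in [-1, 1], this makes a + b vanish whenever 1 + a b does, so that the value 0 of a
  division by zero is harmless.\<close>

lemma abs_add_le_one_plus_mult: "\<bar>a::real\<bar> \<le> 1 \<Longrightarrow> \<bar>b\<bar> \<le> 1 \<Longrightarrow> \<bar>a + b\<bar> \<le> 1 + a * b"
  using mult_nonneg_nonneg[of "1 - a" "1 - b"] mult_nonneg_nonneg[of "1 + a" "1 + b"]
  by (auto simp: algebra_simps abs_le_iff)

lemma absdev_combine_bound:
  fixes a b :: real
  assumes "\<bar>a\<bar> \<le> 1" "\<bar>b\<bar> \<le> 1"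
  shows "\<bar>\<bar>x * (1 + a * b) + y * (a + b)\<bar>\<bar> \<le> \<bar>x\<bar> * 2 + \<bar>y\<bar> * 2"
proof -
  have "\<bar>a * b\<bar> \<le> 1" using assms by (simp add: abs_mult mult_le_one)
  then have "\<bar>1 + a * b\<bar> \<le> 2" "\<bar>a + b\<bar> \<le> 2" using assms by auto
  then have "\<bar>x * (1 + a * b)\<bar> \<le> \<bar>x\<bar> * 2" "\<bar>y * (a + b)\<bar> \<le> \<bar>y\<bar> * 2"
    by (auto simp: abs_mult intro!: mult_left_mono)
  then show ?thesis by linarith
qed

context
  fixes m1 m2
  assumes m1: "posterior_law m1" and m2: "posterior_law m2"
begin

lemma pair_posterior_AE: "AE p in m1 \<Otimes>\<^sub>M m2. \<bar>fst p\<bar> \<le> 1 \<and> \<bar>snd p\<bar> \<le> 1"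
proof -
  interpret prob_space m2 using posterior_lawD(1)[OF m2] .
  interpret m1: prob_space m1 using posterior_lawD(1)[OF m1] .
  interpret pair_sigma_finite m1 m2 ..
  have [measurable_cong]: "sets m1 = sets borel" "sets m2 = sets borel"
    using posterior_lawD(2)[OF m1] posterior_lawD(2)[OF m2] .
  have "AE a in m1. AE b in m2. \<bar>fst (a, b)\<bar> \<le> 1 \<and> \<bar>snd (a, b)\<bar> \<le> 1"
    using posterior_lawD(4)[OF m1]
  proof eventually_elim
    case (elim a)
    show ?case using posterior_lawD(4)[OF m2] by eventually_elim (simp add: elim)
  qed
  then show ?thesis by (subst AE_pair_iff[symmetric]) auto
qed

lemma pair_posterior_integral:
  fixes f :: "real \<Rightarrow> real \<Rightarrow> real"
  assumes [measurable]: "case_prod f \<in> borel_measurable (borel \<Otimes>\<^sub>M borel)"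
    and bd: "\<And>a b. \<bar>a\<bar> \<le> 1 \<Longrightarrow> \<bar>b\<bar> \<le> 1 \<Longrightarrow> \<bar>f a b\<bar> \<le> B"
  shows "integrable (m1 \<Otimes>\<^sub>M m2) (case_prod f)"
    "(LINT p|(m1 \<Otimes>\<^sub>M m2). case_prod f p) = (LINT a|m1. LINT b|m2. f a b)"
    "(LINT p|(m1 \<Otimes>\<^sub>M m2). case_prod f p) = (LINT b|m2. LINT a|m1. f a b)"
proof -
  interpret m2: prob_space m2 using posterior_lawD(1)[OF m2] .
  interpret m1: prob_space m1 using posterior_lawD(1)[OF m1] .
  interpret pair_prob_space m1 m2 ..
  have [measurable_cong]: "sets m1 = sets borel" "sets m2 = sets borel"
    using posterior_lawD(2)[OF m1] posterior_lawD(2)[OF m2] .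
  show i: "integrable (m1 \<Otimes>\<^sub>M m2) (case_prod f)"
  proof (rule integrable_const_bound[where B=B])
    show "AE p in m1 \<Otimes>\<^sub>M m2. norm (case_prod f p) \<le> B"
      using pair_posterior_AE by eventually_elim (auto simp: bd split: prod.splits)
  qed measurable
  show "(LINT p|(m1 \<Otimes>\<^sub>M m2). case_prod f p) = (LINT a|m1. LINT b|m2. f a b)"
    by (rule integral_fst'[OF i, symmetric, simplified])
  show "(LINT p|(m1 \<Otimes>\<^sub>M m2). case_prod f p) = (LINT b|m2. LINT a|m1. f a b)"
    by (rule integral_snd[OF i, symmetric])
qed

lemma nn_integral_combine:
  assumes [measurable]: "f \<in> borel_measurable borel"
  shows "(\<integral>\<^sup>+ c. f c \<partial>combine m1 m2)
    = (\<integral>\<^sup>+ p. ennreal (1 + fst p * snd p) * f ((fst p + snd p) / (1 + fst p * snd p)) \<partial>(m1 \<Otimes>\<^sub>M m2))"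
proof -
  have [measurable_cong]: "sets m1 = sets borel" "sets m2 = sets borel"
    using posterior_lawD(2)[OF m1] posterior_lawD(2)[OF m2] .
  show ?thesis
    unfolding combine_def
    by (subst nn_integral_distr, simp, simp, subst nn_integral_density)
      (auto simp: case_prod_unfold)
qed

lemma integral_combine:
  fixes f :: "real \<Rightarrow> real"
  assumes [measurable]: "f \<in> borel_measurable borel"
  shows "(LINT c|combine m1 m2. f c)
    = (LINT p|(m1 \<Otimes>\<^sub>M m2). (1 + fst p * snd p) * f ((fst p + snd p) / (1 + fst p * snd p)))"
proof -
  have [measurable_cong]: "sets m1 = sets borel" "sets m2 = sets borel"
    using posterior_lawD(2)[OF m1] posterior_lawD(2)[OF m2] .
  have meas: "(\<lambda>(a, b). (a + b) / (1 + a * b))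
      \<in> borel_measurable (density (m1 \<Otimes>\<^sub>M m2) (\<lambda>(a, b). ennreal (1 + a * b)))"
    by measurable
  have "AE p in m1 \<Otimes>\<^sub>M m2. 0 \<le> 1 + fst p * snd p"
    by (rule eventually_mono[OF pair_posterior_AE]) (simp add: abs_one_plus_mult)
  then show ?thesis
    unfolding combine_def integral_distr[OF meas assms]
    unfolding case_prod_unfold
    by (subst integral_density) auto
qed

lemma posterior_law_combine: "posterior_law (combine m1 m2)"
  unfolding posterior_law_def
proof (intro conjI)
  interpret m2: prob_space m2 using posterior_lawD(1)[OF m2] .
  interpret m1: prob_space m1 using posterior_lawD(1)[OF m1] .
  interpret pair_prob_space m1 m2 ..
  have [measurable_cong]: "sets m1 = sets borel" "sets m2 = sets borel"
    using posterior_lawD(2)[OF m1] posterior_lawD(2)[OF m2] .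
  let ?D = "density (m1 \<Otimes>\<^sub>M m2) (\<lambda>(a, b). ennreal (1 + a * b))"
  have le2: "\<bar>1 + a * b\<bar> \<le> 2" if "\<bar>a\<bar> \<le> 1" "\<bar>b\<bar> \<le> 1" for a b :: real
    using abs_triangle_ineq[of 1 "a * b"] mult_le_one[of "\<bar>a\<bar>" "\<bar>b\<bar>"] that by (simp add: abs_mult)
  have "(LINT p|(m1 \<Otimes>\<^sub>M m2). (\<lambda>(a, b). 1 + a * b) p) = (LINT a|m1. LINT b|m2. 1 + a * b)"
    by (rule pair_posterior_integral(2)[where B=2])
      (measurable, use le2 in simp)
  also have "\<dots> = 1" by (simp add: posterior_law_affine(1)[OF m2] m1.prob_space)
  finally have one: "(LINT p|(m1 \<Otimes>\<^sub>M m2). (\<lambda>(a, b). 1 + a * b) p) = 1" .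
  have int: "integrable (m1 \<Otimes>\<^sub>M m2) (\<lambda>(a, b). 1 + a * b)"
    by (rule pair_posterior_integral(1)[where B=2])
      (measurable, use le2 in simp)
  have "emeasure ?D (space ?D) = (\<integral>\<^sup>+ p. ennreal ((\<lambda>(a, b). 1 + a * b) p) \<partial>(m1 \<Otimes>\<^sub>M m2))"
    by (subst emeasure_density) (auto intro!: nn_integral_cong split: prod.splits)
  also have "\<dots> = 1"
  proof (subst nn_integral_eq_integral[OF int])
    show "AE p in m1 \<Otimes>\<^sub>M m2. 0 \<le> (\<lambda>(a, b). 1 + a * b) p"
      using pair_posterior_AE by eventually_elim (simp add: case_prod_unfold abs_one_plus_mult)
  qed (use one in simp)
  finally interpret D: prob_space ?D by (rule prob_spaceI)
  show "real_distribution (combine m1 m2)"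
    unfolding combine_def by (rule D.real_distribution_distr) measurable
  have "AE p in m1 \<Otimes>\<^sub>M m2. \<bar>(fst p + snd p) / (1 + fst p * snd p)\<bar> \<le> 1"
    using pair_posterior_AE
  proof eventually_elim
    case (elim p)
    then show ?case
      using abs_add_le_one_plus_mult[of "fst p" "snd p"] abs_one_plus_mult[of "fst p" "snd p"]
      by (auto simp: abs_divide divide_le_eq_1)
  qed
  then show "AE a in combine m1 m2. \<bar>a\<bar> \<le> 1"
    unfolding combine_def
    by (subst AE_distr_iff, simp, simp, subst AE_density) (auto
        simp: case_prod_unfold elim!: eventually_mono)
  have "(LINT a|combine m1 m2. a) = (LINT p|(m1 \<Otimes>\<^sub>M m2). (\<lambda>(a, b). a + b) p)"
    unfolding integral_combine[OF measurable_ident_sets[OF refl]]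
  proof (rule integral_cong_AE)
    show "AE p in m1 \<Otimes>\<^sub>M m2. (1 + fst p * snd p) * ((fst p + snd p) / (1 + fst p * snd p))
        = (\<lambda>(a, b). a + b) p"
      using pair_posterior_AE
    proof eventually_elim
      case (elim p)
      then show ?case
        using abs_add_le_one_plus_mult[of "fst p" "snd p"]
        by (cases "1 + fst p * snd p = 0") (auto simp: case_prod_unfold)
    qed
  qed measurable
  also have "\<dots> = (LINT a|m1. LINT b|m2. a + 1 * b)"
    by (subst pair_posterior_integral(2)[where B=2]) auto
  also have "\<dots> = 0" using posterior_lawD(5)[OF m1] by (subst posterior_law_affine(1)[OF m2]) simp
  finally show "(LINT a|combine m1 m2. a) = 0" .
qed

lemma absdev_combine_pair: "absdev (combine m1 m2) x y
    = (LINT p|(m1 \<Otimes>\<^sub>M m2). (\<lambda>(a, b). \<bar>x * (1 + a * b) + y * (a + b)\<bar>) p)"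
proof -
  have [measurable_cong]: "sets m1 = sets borel" "sets m2 = sets borel"
    using posterior_lawD(2)[OF m1] posterior_lawD(2)[OF m2] .
  show ?thesis
    unfolding absdev_def
  proof (subst integral_combine)
    show "(LINT p|(m1 \<Otimes>\<^sub>M m2). (1 + fst p * snd p) * \<bar>x + y * ((fst p + snd p) / (1 + fst p * snd p))\<bar>)
      = (LINT p|(m1 \<Otimes>\<^sub>M m2). (\<lambda>(a, b). \<bar>x * (1 + a * b) + y * (a + b)\<bar>) p)"
    proof (rule integral_cong_AE)
      show "AE p in m1 \<Otimes>\<^sub>M m2. (1 + fst p * snd p) * \<bar>x + y * ((fst p + snd p) / (1 + fst p * snd p))\<bar>
        = (\<lambda>(a, b). \<bar>x * (1 + a * b) + y * (a + b)\<bar>) p"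
        using pair_posterior_AE
      proof eventually_elim
        case (elim p)
        obtain a b where p: "p = (a, b)" by (cases p)
        have 0: "0 \<le> 1 + a * b" "\<bar>a + b\<bar> \<le> 1 + a * b"
          using elim abs_one_plus_mult[of a b] abs_add_le_one_plus_mult[of a b] by (auto simp: p)
        show ?case
        proof (cases "1 + a * b = 0")
          case True
          with 0 have "a + b = 0" by simp
          with True show ?thesis by (simp add: p)
        next
          case False
          have "(1 + a * b) * \<bar>x + y * ((a + b) / (1 + a * b))\<bar>
              = \<bar>(1 + a * b) * (x + y * ((a + b) / (1 + a * b)))\<bar>"
            using 0 by (simp add: abs_mult)
          also have "(1 + a * b) * (x + y * ((a + b) / (1 + a * b)))
              = x * (1 + a * b) + y * (a + b)"
            using False by (simp add: field_simps)
          finally show ?thesis by (simp add: p)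
        qed
      qed
    qed measurable
  qed measurable
qed

text \<open>Regrouping x (1 + a b) + y (a + b) = (x + y b) + (y + x b) a shows that an independent
  observation b acts on the arguments by a linear substitution. Monotonicity, contacts and limits of
  combinations are read off from this formula.\<close>

lemma absdev_combine: "absdev (combine m1 m2) x y = (LINT b|m2. absdev m1 (x + y * b) (y + x * b))"
proof -
  have "absdev (combine m1 m2) x y = (LINT b|m2. LINT a|m1. \<bar>x * (1 + a * b) + y * (a + b)\<bar>)"
    unfolding absdev_combine_pair
    by (rule pair_posterior_integral(3)[OF _ absdev_combine_bound]) measurable
  then show ?thesis unfolding absdev_def
    by (simp add: algebra_simps)
qed

lemma absdev_combine': "absdev (combine m1 m2) x y = (LINT a|m1. absdev m2 (x + y * a) (y + x * a))"
proof -
  have "absdev (combine m1 m2) x y = (LINT a|m1. LINT b|m2. \<bar>x * (1 + a * b) + y * (a + b)\<bar>)"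
    unfolding absdev_combine_pair
    by (rule pair_posterior_integral(2)[OF _ absdev_combine_bound]) measurable
  then show ?thesis unfolding absdev_def
    by (simp add: algebra_simps)
qed

end

section \<open>Symmetry and degradation\<close>

definition sym_law :: "real measure \<Rightarrow> bool" where
  "sym_law m \<longleftrightarrow> posterior_law m \<and> scale (- 1) m = m"

lemma sym_lawD: "sym_law m \<Longrightarrow> posterior_law m"
  by (simp add: sym_law_def)

lemma sym_law_iff:
  assumes "posterior_law m"
  shows "sym_law m \<longleftrightarrow> (\<forall>x y. absdev m x (- y) = absdev m x y)"
proof
  assume "sym_law m"
  then show "\<forall>x y. absdev m x (- y) = absdev m x y"
    using absdev_scale[OF assms, of "- 1"] by (simp add: sym_law_def)
next
  assume "\<forall>x y. absdev m x (- y) = absdev m x y"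
  then have "scale (- 1) m = m"
    by (intro absdev_unique posterior_law_scale assms) (simp_all add: absdev_scale[OF assms])
  with assms show "sym_law m" by (simp add: sym_law_def)
qed

lemma sym_law_absdev:
  assumes "sym_law m"
  shows "absdev m x (- y) = absdev m x y" "absdev m (- x) y = absdev m x y"
proof -
  show *: "absdev m x (- y) = absdev m x y" for x y
    using assms sym_law_iff[OF sym_lawD[OF assms]] by blast
  show "absdev m (- x) y = absdev m x y"
    using *[of "- x" y] by (simp add: absdev_uminus)
qed

lemma sym_law_absdev_abs: "sym_law m \<Longrightarrow> absdev m \<bar>x\<bar> \<bar>y\<bar> = absdev m x y"
  by (auto simp: sym_law_absdev abs_if)

lemma sym_law_integral:
  fixes f :: "real \<Rightarrow> real"
  assumes "sym_law m" and [measurable]: "f \<in> borel_measurable borel"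
  shows "(LINT a|m. f (- a)) = (LINT a|m. f a)"
proof -
  have [measurable_cong]: "sets m = sets borel" using posterior_lawD(2) sym_lawD assms(1) by blast
  have "(LINT a|scale (- 1) m. f a) = (LINT a|m. f (- a))"
    unfolding scale_def by (subst integral_distr) auto
  then show ?thesis using assms(1) by (simp add: sym_law_def)
qed

lemma sym_law_scale:
  assumes "sym_law m" "\<bar>s\<bar> \<le> 1"
  shows "sym_law (scale s m)"
  using posterior_law_scale[OF sym_lawD[OF assms(1)] assms(2)] assms(1)
  by (simp add: sym_law_iff absdev_scale sym_lawD sym_law_absdev)

lemma sym_law_combine:
  assumes "sym_law m1" "sym_law m2"
  shows "sym_law (combine m1 m2)"
proof -
  have p: "posterior_law m1" "posterior_law m2" using assms sym_lawD by auto
  have "absdev (combine m1 m2) x (- y) = absdev (combine m1 m2) x y" for x y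
  proof -
    have "absdev (combine m1 m2) x (- y) = (LINT b|m2. absdev m1 (x + y * (- b)) (y + x * (- b)))"
      unfolding absdev_combine[OF p]
    proof (intro Bochner_Integration.integral_cong refl)
      fix b
      have "- (y + x * (- b)) = - y + x * b" by simp
      then show "absdev m1 (x + (- y) * b) (- y + x * b)
          = absdev m1 (x + y * (- b)) (y + x * (- b))"
        using sym_law_absdev(1)[OF assms(1), of "x + y * (- b)" "y + x * (- b)"] by simp
    qed
    also have "\<dots> = (LINT b|m2. absdev m1 (x + y * b) (y + x * b))"
      by (rule sym_law_integral[OF assms(2)])
        (intro absdev_measurable p borel_measurable_add borel_measurable_times, simp_all)
    finally show ?thesis unfolding absdev_combine[OF p] .
  qed
  then show ?thesis using sym_law_iff[OF posterior_law_combine[OF p]] by blast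
qed

text \<open>Average over the sign of a and use |u + v| + |u - v| = 2 max |u| |v|.\<close>

lemma absdev_max:
  assumes "sym_law m"
  shows "absdev m x y = (LINT a|m. max \<bar>x\<bar> \<bar>y * a\<bar>)"
proof -
  have p: "posterior_law m" using assms sym_lawD by auto
  have "2 * absdev m x y = absdev m x y + absdev m x (- y)" using assms
      by (simp add: sym_law_absdev)
  also have "\<dots> = (LINT a|m. \<bar>x + y * a\<bar> + \<bar>x + (- y) * a\<bar>)"
    unfolding absdev_def by (intro Bochner_Integration.integral_add[symmetric] absdev_integrable p)
  also have "\<dots> = (LINT a|m. 2 * max \<bar>x\<bar> \<bar>y * a\<bar>)"
  proof (intro Bochner_Integration.integral_cong refl)
    have pm: "\<bar>u + v\<bar> + \<bar>u - v\<bar> = 2 * max \<bar>u\<bar> \<bar>v\<bar>" for u v :: real by (auto simp: max_def abs_if)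
    show "\<bar>x + y * a\<bar> + \<bar>x + (- y) * a\<bar> = 2 * max \<bar>x\<bar> \<bar>y * a\<bar>" for a
      using pm[of x "y * a"] by simp
  qed
  finally show ?thesis by simp
qed

lemma integrable_absdev_boost:
  assumes "posterior_law m1" "posterior_law m2"
  shows "integrable m2 (\<lambda>b. absdev m1 (x + y * b) (y + x * b))"
proof (rule posterior_law_integrable[OF assms(2), where B="\<bar>x\<bar> + \<bar>y\<bar>"])
  show "(\<lambda>b. absdev m1 (x + y * b) (y + x * b)) \<in> borel_measurable borel"
    by (intro absdev_measurable assms borel_measurable_add borel_measurable_times) simp_all
  fix b :: real assume "\<bar>b\<bar> \<le> 1"
  then have "\<bar>y * b\<bar> \<le> \<bar>y\<bar>" "\<bar>x * b\<bar> \<le> \<bar>x\<bar>" by (auto simp: abs_mult mult_left_le)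
  then show "\<bar>absdev m1 (x + y * b) (y + x * b)\<bar> \<le> \<bar>x\<bar> + \<bar>y\<bar>"
    using absdev_le_max[OF assms(1), of "x + y * b" "y + x * b"] absdev_nonneg[of m1 "x + y * b"
        "y + x * b"]
    by (simp add: max_def split: if_splits)
qed

definition degraded :: "real measure \<Rightarrow> real measure \<Rightarrow> bool" where
  "degraded m m' \<longleftrightarrow> (\<forall>x y. absdev m x y \<le> absdev m' x y)"

lemma degradedD: "degraded m m' \<Longrightarrow> absdev m x y \<le> absdev m' x y"
  by (simp add: degraded_def)

lemma degraded_refl: "degraded m m"
  by (simp add: degraded_def)

lemma degraded_trans: "degraded m m' \<Longrightarrow> degraded m' m'' \<Longrightarrow> degraded m m''"
  unfolding degraded_def by (meson order.trans)

lemma degraded_antisym: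
  "posterior_law m \<Longrightarrow> posterior_law m' \<Longrightarrow> degraded m m' \<Longrightarrow> degraded m' m \<Longrightarrow> m = m'"
  by (intro absdev_unique) (auto simp: degraded_def intro: antisym)

lemma degraded_scale:
  "posterior_law m \<Longrightarrow> posterior_law m' \<Longrightarrow> degraded m m' \<Longrightarrow> degraded (scale s m) (scale s m')"
  by (simp add: degraded_def absdev_scale)

lemma combine_commute:
  assumes "posterior_law m1" "posterior_law m2"
  shows "combine m1 m2 = combine m2 m1"
  by (intro absdev_unique posterior_law_combine assms)
    (simp add: absdev_combine[OF assms] absdev_combine'[OF assms(2,1)])

text \<open>Conditionally on the second observation, the comparison is the hypothesis at the
  substituted arguments.\<close>

lemma degraded_combine_left:
  assumes "posterior_law m1" "posterior_law m2" "posterior_law m1'" "degraded m1 m1'"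
  shows "degraded (combine m1 m2) (combine m1' m2)"
  unfolding degraded_def absdev_combine[OF assms(1,2)] absdev_combine[OF assms(3,2)]
  by (intro allI integral_mono integrable_absdev_boost assms degradedD)

lemma degraded_combine:
  assumes "posterior_law m1" "posterior_law m2" "posterior_law m1'" "posterior_law m2'"
    "degraded m1 m1'" "degraded m2 m2'"
  shows "degraded (combine m1 m2) (combine m1' m2')"
proof (rule degraded_trans)
  show "degraded (combine m1 m2) (combine m1' m2)" by (rule degraded_combine_left) fact+
  show "degraded (combine m1' m2) (combine m1' m2')"
    unfolding combine_commute[OF assms(3,2)] combine_commute[OF assms(3,4)]
    by (rule degraded_combine_left) fact+
qed

section \<open>Noise before and after combination\<close>

lemma scale_one:
  assumes "posterior_law m" shows "scale 1 m = m"
  using posterior_lawD(2)[OF assms] by (simp add: scale_def distr_id2)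

text \<open>
  Twice the average of \<open>\<bar>x * (1 + p * (a * b)) + Y * (a + b)\<bar>\<close> over the signs of \<open>a\<close> and \<open>b\<close>. With
  \<open>Y = t * y\<close>, noise \<open>t\<close> applied after combining two laws is the case \<open>p = 1\<close>, and noise \<open>t\<close> applied
  to each of them is the case \<open>p = t\<^sup>2\<close>.
\<close>

definition noise_gain :: "real \<Rightarrow> real \<Rightarrow> real \<Rightarrow> real \<Rightarrow> real \<Rightarrow> real" where
  "noise_gain x Y a b p = max (x * (1 + p * (a * b))) (Y * \<bar>a + b\<bar>) + max (x * (1 - p * (a * b))) (Y * \<bar>a - b\<bar>)"

lemma noise_gain_commute: "noise_gain x Y a b p = noise_gain x Y b a p"
  unfolding noise_gain_def by (simp add: mult.commute[of a b] add.commute[of a b] abs_minus_commute)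

lemma noise_gain_uminus: "noise_gain x Y (- a) b p = noise_gain x Y a b p"
proof -
  have "\<bar>- a + b\<bar> = \<bar>a - b\<bar>" "\<bar>- a - b\<bar> = \<bar>a + b\<bar>" by auto
  then show ?thesis unfolding noise_gain_def by simp
qed

lemma noise_gain_abs: "noise_gain x Y \<bar>a\<bar> \<bar>b\<bar> p = noise_gain x Y a b p"
proof -
  have "noise_gain x Y a (- b) p = noise_gain x Y a b p" for a b
    using noise_gain_uminus[of x Y b a p] by (simp add: noise_gain_commute[of x Y a])
  then show ?thesis
    by (cases "a < 0"; cases "b < 0") (simp_all add: noise_gain_uminus)
qed

text \<open>As the last argument grows, the first maximum can gain at most what the falling term of
  the second one loses. A net gain would need the first maximum to be growing while the second is
  already constant, which b \<le> a \<le> 1 and q \<le> 1 exclude. Under the strict hypotheses the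
  second maximum is falling at p while the first is still constant, so the sum drops.\<close>

lemma noise_gain_aux:
  fixes x Y a b p q :: real
  assumes xY: "0 \<le> x" "x \<le> Y" and ab: "0 \<le> b" "b \<le> a" "a \<le> 1" and pq: "0 \<le> p" "p \<le> q" "q \<le> 1"
  shows "noise_gain x Y a b q \<le> noise_gain x Y a b p"
    and "0 < x \<Longrightarrow> 0 < b \<Longrightarrow> p < q \<Longrightarrow> Y * (a - b) < x * (1 - p * (a * b)) \<Longrightarrow> x * (1 + p * (a * b))
        < Y * (a + b)
      \<Longrightarrow> noise_gain x Y a b q < noise_gain x Y a b p"
proof -
  define P Q where "P = x * (p * (a * b))" and "Q = x * (q * (a * b))"
  have ab0: "0 \<le> a * b" using ab by simp
  have PQ: "P \<le> Q" unfolding P_def Q_def using xY pq ab0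
      by (intro mult_left_mono mult_right_mono) auto
  have eq: "noise_gain x Y a b r
      = max (x + x * (r * (a * b))) (Y * (a + b)) + max (x - x * (r * (a * b))) (Y * (a - b))" for r
    using ab by (simp add: noise_gain_def algebra_simps)
  \<comment> \<open>Where the first maximum grows with the noise parameter, the second one falls at the same rate.\<close>
  have key: "\<not> (Y * (a + b) < x + Q \<and> x - Q < Y * (a - b))"
  proof
    assume *: "Y * (a + b) < x + Q \<and> x - Q < Y * (a - b)"
    have "a * b * q \<le> b * (q * a)" by (simp add: ac_simps)
    also have "q * a \<le> 1" using pq ab by (intro mult_le_one) auto
    then have "b * (q * a) \<le> b" using ab by (simp add: mult_left_le)
    finally have c: "q * (a * b) \<le> b" by (simp add: ac_simps)
    have "0 < a"
    proof (rule ccontr)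
      assume "\<not> 0 < a"
      then have "a = 0" "b = 0" using ab by auto
      with * show False using xY by (simp add: Q_def)
    qed
    have "a * (x - Q) < a * (Y * (a - b))" using * \<open>0 < a\<close> by (intro mult_strict_left_mono) auto
    have x: "(1 - q * (a * b)) * x < Y * (a - b)" "Y * (a + b) < (1 + q * (a * b)) * x"
      using * by (auto simp: Q_def algebra_simps)
    \<comment> \<open>Multiplying the two inequalities crosswise by a - b and a + b eliminates Y and
      leaves b < a r, against r \<le> b and a \<le> 1.\<close>
    let ?r = "q * (a * b)"
    have r1: "?r \<le> 1" "0 \<le> ?r" using c ab pq by auto
    have "(a - b) * (1 + ?r) * x \<ge> (a - b) * (Y * (a + b))"
      using mult_left_mono[OF less_imp_le[OF x(2)], of "a - b"] ab by (simp add: ac_simps)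
    moreover have "(a + b) * ((1 - ?r) * x) < (a + b) * (Y * (a - b))"
      using x(1) \<open>0 < a\<close> ab by (intro mult_strict_left_mono) auto
    ultimately have "(a + b) * (1 - ?r) * x < (a - b) * (1 + ?r) * x" by (simp add: ac_simps)
    then have "2 * (b - a * ?r) * x < 0" by (simp add: algebra_simps)
    moreover have "a * ?r \<le> b" using c r1 ab mult_left_le_one_le[of ?r a] by linarith
    then have "0 \<le> 2 * (b - a * ?r) * x" using xY by (intro mult_nonneg_nonneg) auto
    ultimately show False by linarith
  qed
  show "noise_gain x Y a b q \<le> noise_gain x Y a b p"
    unfolding eq using PQ key unfolding P_def[symmetric] Q_def[symmetric] by (auto simp: max_def)
  assume s: "0 < x" "0 < b" "p < q" "Y * (a - b) < x * (1 - p * (a * b))" "x * (1 + p * (a * b))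
      < Y * (a + b)"
  have "P < Q" unfolding P_def Q_def
    using s ab by (intro mult_strict_left_mono mult_strict_right_mono) auto
  moreover have "Y * (a - b) < x - P" "x + P < Y * (a + b)" using s by (auto
      simp: P_def algebra_simps)
  ultimately show "noise_gain x Y a b q < noise_gain x Y a b p"
    unfolding eq using key unfolding P_def[symmetric] Q_def[symmetric] by (auto simp: max_def)
qed

lemma noise_gain_antimono:
  assumes "0 \<le> x" "x \<le> Y" "\<bar>a\<bar> \<le> 1" "\<bar>b\<bar> \<le> 1" "0 \<le> p" "p \<le> q" "q \<le> 1"
  shows "noise_gain x Y a b q \<le> noise_gain x Y a b p"
proof (cases "\<bar>b\<bar> \<le> \<bar>a\<bar>")
  case True
  then show ?thesis using noise_gain_aux(1)[of x Y "\<bar>b\<bar>" "\<bar>a\<bar>" p q] assms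
      by (simp add: noise_gain_abs)
next
  case False
  then show ?thesis using noise_gain_aux(1)[of x Y "\<bar>a\<bar>" "\<bar>b\<bar>" p q] assms
    by (simp add: noise_gain_abs noise_gain_commute[of x Y a b])
qed

lemma noise_gain_strict:
  assumes "0 < x" "x \<le> Y" "0 < a" "a \<le> 1" "0 < b" "b \<le> 1" "0 \<le> p" "p < q" "q \<le> 1"
    "Y * \<bar>a - b\<bar> < x * (1 - p * (a * b))" "x * (1 + p * (a * b)) < Y * (a + b)"
  shows "noise_gain x Y a b q < noise_gain x Y a b p"
proof (cases "b \<le> a")
  case True
  then show ?thesis using noise_gain_aux(2)[of x Y b a p q] assms by simp
next
  case False
  then show ?thesis using noise_gain_aux(2)[of x Y a b p q] assms
    by (simp add: noise_gain_commute[of x Y a b] mult.commute[of a b] add.commute[of a b])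
qed

lemma noise_gain_bound:
  assumes "0 \<le> x" "0 \<le> Y" "\<bar>a\<bar> \<le> 1" "\<bar>b\<bar> \<le> 1" "\<bar>p\<bar> \<le> 1"
  shows "\<bar>noise_gain x Y a b p\<bar> \<le> 4 * x + 4 * Y"
proof -
  have "\<bar>p * (a * b)\<bar> \<le> 1" using assms by (simp add: abs_mult mult_le_one)
  then have "0 \<le> 1 + p * (a * b)" "1 + p * (a * b) \<le> 2" "0 \<le> 1 - p * (a * b)" "1 - p * (a * b) \<le> 2"
      by auto
  moreover have "\<bar>a + b\<bar> \<le> 2" "\<bar>a - b\<bar> \<le> 2" using assms by auto
  ultimately have "0 \<le> x * (1 + p * (a * b))" "x * (1 + p * (a * b)) \<le> x * 2"
    "0 \<le> x * (1 - p * (a * b))" "x * (1 - p * (a * b)) \<le> x * 2" "Y * \<bar>a + b\<bar> \<le> Y * 2" "Y * \<bar>a - b\<bar>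
        \<le> Y * 2"
    "0 \<le> Y * \<bar>a + b\<bar>" "0 \<le> Y * \<bar>a - b\<bar>"
    using assms by (auto intro!: mult_left_mono)
  then show ?thesis unfolding noise_gain_def using assms by (auto simp: max_def)
qed

lemma noise_gain_measurable [measurable]:
  "(\<lambda>z. noise_gain x Y (fst z) (snd z) p) \<in> borel_measurable (borel \<Otimes>\<^sub>M borel)"
  unfolding noise_gain_def by measurable

text \<open>By symmetry the four sign patterns of (a, b) contribute equally. Opposite patterns pair
  up through |u + v| + |u - v| = 2 max |u| |v|; equal signs give the first summand of
  \<open>noise_gain\<close>, unequal signs the second.\<close>

lemma noise_gain_integral:
  assumes "sym_law m1" "sym_law m2" "\<bar>p\<bar> \<le> 1"
  shows "2 * (LINT b|m2. LINT a|m1. \<bar>x * (1 + p * (a * b)) + Y * (a + b)\<bar>)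
    = (LINT z|(m1 \<Otimes>\<^sub>M m2). noise_gain \<bar>x\<bar> \<bar>Y\<bar> (fst z) (snd z) p)"
proof -
  have P: "posterior_law m1" "posterior_law m2" using assms sym_lawD by auto
  define f where "f a b = \<bar>x * (1 + p * (a * b)) + Y * (a + b)\<bar>" for a b
  have fm: "case_prod f \<in> borel_measurable (borel \<Otimes>\<^sub>M borel)" unfolding f_def by measurable
  have fb: "\<bar>f a b\<bar> \<le> 2 * \<bar>x\<bar> + 2 * \<bar>Y\<bar>" if "\<bar>a\<bar> \<le> 1" "\<bar>b\<bar> \<le> 1" for a b
  proof -
    have "\<bar>p * (a * b)\<bar> \<le> 1" using assms that by (simp add: abs_mult mult_le_one)
    then have "\<bar>1 + p * (a * b)\<bar> \<le> 2" "\<bar>a + b\<bar> \<le> 2" using that by auto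
    then have "\<bar>x * (1 + p * (a * b))\<bar> \<le> \<bar>x\<bar> * 2" "\<bar>Y * (a + b)\<bar> \<le> \<bar>Y\<bar> * 2"
      by (auto simp: abs_mult intro!: mult_left_mono)
    then show ?thesis unfolding f_def by linarith
  qed
  define g where "g \<sigma> \<tau> a b = f (\<sigma> * a) (\<tau> * b)" for \<sigma> \<tau> a b :: real
  have gm: "case_prod (g \<sigma> \<tau>) \<in> borel_measurable (borel \<Otimes>\<^sub>M borel)" for \<sigma> \<tau>
    unfolding g_def f_def by measurable
  have gb: "\<bar>g \<sigma> \<tau> a b\<bar> \<le> 2 * \<bar>x\<bar> + 2 * \<bar>Y\<bar>" if "\<bar>a\<bar> \<le> 1" "\<bar>b\<bar> \<le> 1" "\<bar>\<sigma>\<bar> = 1" "\<bar>\<tau>\<bar> = 1" for \<sigma> \<tau> a b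
    unfolding g_def using that by (intro fb) (auto simp: abs_mult)
  define I where "I \<sigma> \<tau> = (LINT z|(m1 \<Otimes>\<^sub>M m2). case_prod (g \<sigma> \<tau>) z)" for \<sigma> \<tau>
  \<comment> \<open>Both orders of integration are recorded so that each sign flip can be made in
    the inner integral.\<close>
  have I1: "I \<sigma> \<tau> = (LINT b|m2. LINT a|m1. g \<sigma> \<tau> a b)" if "\<bar>\<sigma>\<bar> = 1" "\<bar>\<tau>\<bar> = 1" for \<sigma> \<tau>
    unfolding I_def by (rule pair_posterior_integral(3)[OF P gm gb[OF _ _ that]])
  have I2: "I \<sigma> \<tau> = (LINT a|m1. LINT b|m2. g \<sigma> \<tau> a b)" if "\<bar>\<sigma>\<bar> = 1" "\<bar>\<tau>\<bar> = 1" for \<sigma> \<tau>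
    unfolding I_def by (rule pair_posterior_integral(2)[OF P gm gb[OF _ _ that]])
  have fla: "(LINT a|m1. g (- 1) \<tau> a b) = (LINT a|m1. g 1 \<tau> a b)" for \<tau> b
    using sym_law_integral[OF assms(1), of "\<lambda>a. g 1 \<tau> a b"] by (simp add: g_def f_def)
  have flb: "(LINT b|m2. g \<sigma> (- 1) a b) = (LINT b|m2. g \<sigma> 1 a b)" for \<sigma> a
    using sym_law_integral[OF assms(2), of "\<lambda>b. g \<sigma> 1 a b"] by (simp add: g_def f_def)
  have "I (- 1) 1 = I 1 1" "I (- 1) (- 1) = I 1 (- 1)" 
    using I1[of "- 1" 1] I1[of 1 1] I1[of "- 1" "- 1"] I1[of 1 "- 1"] by (simp_all add: fla)
  moreover have "I 1 (- 1) = I 1 1" using I2[of 1 "- 1"] I2[of 1 1] by (simp add: flb)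
  ultimately have eqs: "I (- 1) 1 = I 1 1" "I 1 (- 1) = I 1 1" "I (- 1) (- 1) = I 1 1" by auto
  have int: "integrable (m1 \<Otimes>\<^sub>M m2) (case_prod (g \<sigma> \<tau>))" if "\<bar>\<sigma>\<bar> = 1" "\<bar>\<tau>\<bar> = 1" for \<sigma> \<tau>
    by (rule pair_posterior_integral(1)[OF P gm gb[OF _ _ that]])
  have "4 * I 1 1 = I 1 1 + I (- 1) 1 + I 1 (- 1) + I (- 1) (- 1)" using eqs by simp
  also have "\<dots> = (LINT z|(m1 \<Otimes>\<^sub>M m2). case_prod (g 1 1) z + case_prod (g (- 1) 1) z
      + case_prod (g 1 (- 1)) z + case_prod (g (- 1) (- 1)) z)"
    unfolding I_def using int by simp
  also have "\<dots> = (LINT z|(m1 \<Otimes>\<^sub>M m2). 2 * noise_gain \<bar>x\<bar> \<bar>Y\<bar> (fst z) (snd z) p)"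
  proof (rule integral_cong_AE)
    have [measurable_cong]: "sets m1 = sets borel" "sets m2 = sets borel"
      using posterior_lawD(2) P by auto
    note gm[measurable]
    show "(\<lambda>z. case_prod (g 1 1) z + case_prod (g (- 1) 1) z
      + case_prod (g 1 (- 1)) z + case_prod (g (- 1) (- 1)) z) \<in> borel_measurable (m1 \<Otimes>\<^sub>M m2)"
      by measurable
    show "(\<lambda>z. 2 * noise_gain \<bar>x\<bar> \<bar>Y\<bar> (fst z) (snd z) p) \<in> borel_measurable (m1 \<Otimes>\<^sub>M m2)"
      by measurable
    show "AE z in m1 \<Otimes>\<^sub>M m2. case_prod (g 1 1) z + case_prod (g (- 1) 1) z
      + case_prod (g 1 (- 1)) z + case_prod (g (- 1) (- 1)) z
          = 2 * noise_gain \<bar>x\<bar> \<bar>Y\<bar> (fst z) (snd z) p"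
      using pair_posterior_AE[OF P]
    proof eventually_elim
      case (elim z)
      obtain a b where z: "z = (a, b)" by (cases z)
      have "\<bar>p * (a * b)\<bar> \<le> 1" using elim assms(3) by (simp add: z abs_mult mult_le_one)
      then have 1: "0 \<le> 1 + p * (a * b)" "0 \<le> 1 - p * (a * b)" by auto
      have pm: "\<bar>u + v\<bar> + \<bar>u - v\<bar> = 2 * max \<bar>u\<bar> \<bar>v\<bar>" for u v :: real by (auto simp: max_def abs_if)
      have "g 1 1 a b + g (-1) (-1) a b = 2 * max (\<bar>x\<bar> * (1 + p * (a * b))) (\<bar>Y\<bar> * \<bar>a + b\<bar>)"
      proof -
        have "Y * (- a - b) = - (Y * (a + b))" by (simp add: algebra_simps)
        then have "g 1 1 a b + g (-1) (-1) a b
            = \<bar>x * (1 + p * (a * b)) + Y * (a + b)\<bar> + \<bar>x * (1 + p * (a * b)) - Y * (a + b)\<bar>"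
          by (simp add: g_def f_def)
        then show ?thesis unfolding pm using 1 by (simp add: abs_mult)
      qed
      moreover have "g 1 (-1) a b + g (-1) 1 a b
          = 2 * max (\<bar>x\<bar> * (1 - p * (a * b))) (\<bar>Y\<bar> * \<bar>a - b\<bar>)"
      proof -
        have "Y * (- a + b) = - (Y * (a - b))" by (simp add: algebra_simps)
        then have "g 1 (-1) a b + g (-1) 1 a b
            = \<bar>x * (1 - p * (a * b)) + Y * (a - b)\<bar> + \<bar>x * (1 - p * (a * b)) - Y * (a - b)\<bar>"
          by (simp add: g_def f_def)
        then show ?thesis unfolding pm using 1 by (simp add: abs_mult)
      qed
      ultimately show ?case by (simp add: z noise_gain_def)
    qed
  qed
  finally have "2 * I 1 1 = (LINT z|(m1 \<Otimes>\<^sub>M m2). noise_gain \<bar>x\<bar> \<bar>Y\<bar> (fst z) (snd z) p)" by simp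
  then show ?thesis using I1[of 1 1] by (simp add: g_def f_def)
qed

section \<open>Potential functions of symmetric laws\<close>

text \<open>For symmetric m and k \<ge> 0 this is E(|a| - k)^+, see \<open>excess_eq\<close>.
  Defined through \<open>absdev\<close>, it inherits the order and the Lipschitz continuity
  directly.\<close>

definition excess :: "real measure \<Rightarrow> real \<Rightarrow> real" where
  "excess m k = absdev m k 1 - k"

lemma excess_eq:
  assumes "sym_law m" "0 \<le> k"
  shows "excess m k = (LINT a|m. max 0 (\<bar>a\<bar> - k))" "integrable m (\<lambda>a. max 0 (\<bar>a\<bar> - k))"
proof -
  have p: "posterior_law m" using assms sym_lawD by auto
  interpret prob_space m using posterior_lawD(1)[OF p] .
  show i: "integrable m (\<lambda>a. max 0 (\<bar>a\<bar> - k))"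
    by (rule posterior_law_integrable[OF p, where B="1"]) (use assms in auto)
  have "absdev m k 1 = (LINT a|m. k + max 0 (\<bar>a\<bar> - k))"
    unfolding absdev_max[OF assms(1)] using assms(2)
        by (intro Bochner_Integration.integral_cong) (auto simp: max_def)
  also have "\<dots> = k + (LINT a|m. max 0 (\<bar>a\<bar> - k))"
    using i by (simp add: prob_space)
  finally show "excess m k = (LINT a|m. max 0 (\<bar>a\<bar> - k))" by (simp add: excess_def)
qed

lemma excess_nonneg: "sym_law m \<Longrightarrow> 0 \<le> k \<Longrightarrow> 0 \<le> excess m k"
  using absdev_ge_abs[of m k 1] sym_lawD by (auto simp: excess_def)

lemma excess_antimono:
  assumes "sym_law m" "0 \<le> k" "k \<le> k'"
  shows "excess m k' \<le> excess m k"
  using assms excess_eq[of m k] excess_eq[of m k'] by (auto intro!: integral_mono)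

lemma excess_eq_0_iff:
  assumes "sym_law m" "0 \<le> k"
  shows "excess m k = 0 \<longleftrightarrow> (AE a in m. \<bar>a\<bar> \<le> k)"
proof -
  have "excess m k = 0 \<longleftrightarrow> (AE a in m. max 0 (\<bar>a\<bar> - k) = 0)"
    unfolding excess_eq(1)[OF assms]
        by (intro integral_nonneg_eq_0_iff_AE excess_eq(2)[OF assms]) simp
  also have "\<dots> \<longleftrightarrow> (AE a in m. \<bar>a\<bar> \<le> k)"
    by (intro eventually_cong[OF always_eventually]) (auto simp: max_def)
  finally show ?thesis .
qed

lemma excess_eq_0_ge_1: "sym_law m \<Longrightarrow> 1 \<le> k \<Longrightarrow> excess m k = 0"
  using absdev_le_max[of m k 1] absdev_ge_abs[of m k 1] sym_lawD[of m] by (auto simp: excess_def)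

lemma excess_mono: "degraded m m' \<Longrightarrow> excess m k \<le> excess m' k"
  by (simp add: excess_def degradedD)

text \<open>By homogeneity the one-variable potential carries all of \<open>absdev\<close> for y >
  0; this is why a contact is described by a single threshold.\<close>

lemma absdev_eq_excess:
  assumes "posterior_law m" "0 < y"
  shows "absdev m x y = x + y * excess m (x / y)"
proof -
  have "absdev m x y = absdev m (y * (x / y)) (y * 1)" using assms by simp
  also have "\<dots> = y * absdev m (x / y) 1" unfolding absdev_homogeneous using assms by simp
  finally show ?thesis using assms by (simp add: excess_def algebra_simps)
qed

lemma excess_scale:
  assumes "posterior_law m" "0 < t"
  shows "excess (scale t m) k = t * excess m (k / t)"
  using absdev_eq_excess[OF assms, of k]
      by (simp add: excess_def[of "scale t m"] absdev_scale assms)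

lemma AE_scale:
  assumes "posterior_law m" "AE a in scale t m. Q a"
  shows "AE a in m. Q (t * a)"
proof -
  have [measurable_cong]: "sets m = sets borel" using posterior_lawD(2)[OF assms(1)] .
  show ?thesis using assms(2) unfolding scale_def by (intro AE_distrD[where f="\<lambda>a. t * a"]) auto
qed

lemma AE_sym_abs:
  assumes "sym_law m" "AE a in m. Q a"
  shows "AE a in m. Q \<bar>a\<bar>"
proof -
  have eq: "scale (- 1) m = m" using assms by (simp add: sym_law_def)
  have "AE a in m. Q (- 1 * a)"
    by (rule AE_scale[OF sym_lawD[OF assms(1)]]) (simp only: eq assms(2))
  with assms(2) show ?thesis by eventually_elim (auto simp: abs_if)
qed

lemma absdev_combine_scaled:
  assumes "posterior_law m1" "posterior_law m2" "\<bar>t\<bar> \<le> 1"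
  shows "absdev (combine (scale t m1) (scale t m2)) x y
    = (LINT b|m2. LINT a|m1. \<bar>x * (1 + t\<^sup>2 * (a * b)) + t * y * (a + b)\<bar>)"
proof -
  have [measurable_cong]: "sets m1 = sets borel" "sets m2 = sets borel"
    using posterior_lawD(2)[OF assms(1)] posterior_lawD(2)[OF assms(2)] .
  note P = posterior_law_scale[OF assms(1,3)] posterior_law_scale[OF assms(2,3)]
  have "absdev (combine (scale t m1) (scale t m2)) x y
      = (LINT b|m2. absdev (scale t m1) (x + y * (t * b)) (y + x * (t * b)))"
    unfolding absdev_combine[OF P] unfolding scale_def[of t m2]
    by (subst integral_distr)
      (auto intro!: absdev_measurable P(1) borel_measurable_add borel_measurable_times)
  also have "\<dots> = (LINT b|m2. LINT a|m1. \<bar>x * (1 + t\<^sup>2 * (a * b)) + t * y * (a + b)\<bar>)"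
    unfolding absdev_scale[OF assms(1)] by (simp add: absdev_def algebra_simps power2_eq_square)
  finally show ?thesis .
qed

lemma absdev_combine_noise_gain:
  assumes "sym_law m1" "sym_law m2" "\<bar>t\<bar> \<le> 1"
  shows "2 * absdev (combine m1 m2) x y
      = (LINT z|(m1 \<Otimes>\<^sub>M m2). noise_gain \<bar>x\<bar> \<bar>y\<bar> (fst z) (snd z) 1)"
    and "2 * absdev (combine (scale t m1) (scale t m2)) x y
      = (LINT z|(m1 \<Otimes>\<^sub>M m2). noise_gain \<bar>x\<bar> \<bar>t * y\<bar> (fst z) (snd z) (t\<^sup>2))"
proof -
  have P: "posterior_law m1" "posterior_law m2" using assms sym_lawD by auto
  show "2 * absdev (combine (scale t m1) (scale t m2)) x y
      = (LINT z|(m1 \<Otimes>\<^sub>M m2). noise_gain \<bar>x\<bar> \<bar>t * y\<bar> (fst z) (snd z) (t\<^sup>2))"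
    unfolding absdev_combine_scaled[OF P assms(3)]
    by (rule noise_gain_integral[OF assms(1,2)]) (use assms(3) in \<open>simp add: abs_square_le_1\<close>)
  from noise_gain_integral[OF assms(1,2), of 1 x y]
  show "2 * absdev (combine m1 m2) x y = (LINT z|(m1 \<Otimes>\<^sub>M m2). noise_gain \<bar>x\<bar> \<bar>y\<bar> (fst z) (snd z) 1)"
    using absdev_combine_scaled[OF P, of 1 x y] scale_one[OF P(1)] scale_one[OF P(2)] by simp
qed

lemma integrable_noise_gain:
  assumes "posterior_law m1" "posterior_law m2" "0 \<le> x" "0 \<le> Y" "\<bar>p\<bar> \<le> 1"
  shows "integrable (m1 \<Otimes>\<^sub>M m2) (\<lambda>z. noise_gain x Y (fst z) (snd z) p)"
  using pair_posterior_integral(1)[OF assms(1,2), of "\<lambda>a b. noise_gain x Y a b p" "4 * x + 4 * Y"]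
    noise_gain_bound[OF assms(3,4) _ _ assms(5)] by (simp add: case_prod_unfold)

text \<open>For |x| \<le> |t y| the comparison holds pointwise in (a, b): common noise is
  \<open>noise_gain\<close> with p = 1, independent noise is p = t^2, and the gain decreases in p.
  For |x| > |t y| the left side takes the value |x|, which is a lower bound for every law.\<close>

lemma stringy_tree:
  assumes "sym_law m1" "sym_law m2" "0 \<le> t" "t \<le> 1"
  shows "degraded (scale t (combine m1 m2)) (combine (scale t m1) (scale t m2))"
  unfolding degraded_def
proof (intro allI)
  fix x y
  have P: "posterior_law m1" "posterior_law m2" using assms sym_lawD by auto
  have t: "\<bar>t\<bar> \<le> 1" "t\<^sup>2 \<le> 1" using assms by (auto simp: power_le_one)
  note C = posterior_law_combine[OF P] posterior_law_combine[OF posterior_law_scale[OF P(1) t(1)]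
      posterior_law_scale[OF P(2) t(1)]]
  show "absdev (scale t (combine m1 m2)) x y \<le> absdev (combine (scale t m1) (scale t m2)) x y"
  proof (cases "\<bar>x\<bar> \<le> \<bar>t * y\<bar>")
    case True
    have "(LINT z|(m1 \<Otimes>\<^sub>M m2). noise_gain \<bar>x\<bar> \<bar>t * y\<bar> (fst z) (snd z) 1)
      \<le> (LINT z|(m1 \<Otimes>\<^sub>M m2). noise_gain \<bar>x\<bar> \<bar>t * y\<bar> (fst z) (snd z) (t\<^sup>2))"
    proof (intro integral_mono_AE integrable_noise_gain P)
      show "AE z in m1 \<Otimes>\<^sub>M m2. noise_gain \<bar>x\<bar> \<bar>t * y\<bar> (fst z) (snd z) 1
          \<le> noise_gain \<bar>x\<bar> \<bar>t * y\<bar> (fst z) (snd z) (t\<^sup>2)"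
        using pair_posterior_AE[OF P]
            by eventually_elim (use True t in \<open>auto intro!: noise_gain_antimono\<close>)
    qed (use t in auto)
    then show ?thesis
      using absdev_combine_noise_gain(1)[OF assms(1,2) t(1), of x "t * y"]
          absdev_combine_noise_gain(2)[OF assms(1,2) t(1), of x y]
      by (simp add: absdev_scale[OF C(1)])
  next
    case False
    then show ?thesis
      using absdev_le_max[OF C(1), of x "t * y"] absdev_ge_abs[OF C(2), of x y]
          by (simp add: absdev_scale[OF C(1)])
  qed
qed

section \<open>Contacts under combination\<close>

lemma combine_contact_AE:
  assumes "posterior_law A1" "posterior_law C1" "posterior_law C2" "degraded C1 A1" "0 \<le> k"
    and eq: "absdev (combine A1 C2) k 1 = absdev (combine C1 C2) k 1"
  shows "AE b in C2. 0 < b \<longrightarrow> excess A1 ((k + b) / (1 + k * b)) = excess C1 ((k + b) / (1 + k * b))"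
proof -
  \<comment> \<open>The integrand is nonnegative by \<open>degraded C1 A1\<close>, so its zero
    integral makes the two functions agree at almost every substituted argument; homogeneity turns
    this into equality of potentials at (k + b) / (1 + k b).\<close>
  have "(LINT b|C2. absdev A1 (k + 1 * b) (1 + k * b) - absdev C1 (k + 1 * b) (1 + k * b)) = 0"
    using eq integrable_absdev_boost[OF assms(1,3), of k 1] integrable_absdev_boost[OF assms(2,3), of k 1]
    unfolding absdev_combine[OF assms(1,3)] absdev_combine[OF assms(2,3)] by simp
  then have "AE b in C2. absdev A1 (k + 1 * b) (1 + k * b) - absdev C1 (k + 1 * b) (1 + k * b) = 0"
    using integrable_absdev_boost[OF assms(1,3), of k 1] integrable_absdev_boost[OF assms(2,3), of k 1] degradedD[OF assms(4)]
    by (subst (asm) integral_nonneg_eq_0_iff_AE) auto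
  then show ?thesis
  proof eventually_elim
    case (elim b)
    show ?case
    proof
      assume "0 < b"
      then have "0 < 1 + k * b" using \<open>0 \<le> k\<close> by (simp add: add_pos_nonneg)
      then show "excess A1 ((k + b) / (1 + k * b)) = excess C1 ((k + b) / (1 + k * b))"
        using elim absdev_eq_excess[OF assms(1), of "1 + k * b"
            "k + b"] absdev_eq_excess[OF assms(2), of "1 + k * b" "k + b"]
        by simp
    qed
  qed
qed

text \<open>Equality at k passes to the thresholds (k + b) / (1 + k b) > k, where the hypothesis
  \<open>no\<close> allows it only if the potential of A1 has vanished. So these thresholds lie
  beyond any c at which that potential is positive.\<close>

lemma combine_no_contact_AE:
  assumes "sym_law A1" "sym_law C1" "sym_law C2" "degraded C1 A1" "0 \<le> k" "k < 1"
    and eq: "absdev (combine A1 C2) k 1 = absdev (combine C1 C2) k 1"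
    and c: "0 \<le> c" "0 < excess A1 c"
    and no: "\<And>k'. k < k' \<Longrightarrow> excess A1 k' = excess C1 k' \<Longrightarrow> excess A1 k' \<le> 0"
  shows "AE b in C2. 0 < b \<longrightarrow> c * (1 + k * b) < k + b"
  using combine_contact_AE[OF sym_lawD[OF assms(1)] sym_lawD[OF assms(2)] sym_lawD[OF assms(3)] assms(4,5) eq]
proof eventually_elim
  case (elim b)
  show ?case
  proof
    assume b: "0 < b"
    let ?k = "(k + b) / (1 + k * b)"
    have pos: "0 < 1 + k * b" using b assms by (simp add: add_pos_nonneg)
    have "0 < b * (1 - k * k)" using b assms mult_left_mono[of k 1 k] by (intro mult_pos_pos) auto
    then have "k < ?k" using pos by (simp add: less_divide_eq algebra_simps)
    moreover have "excess A1 ?k = excess C1 ?k" using elim b by simp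
    ultimately have "excess A1 ?k \<le> 0" by (rule no)
    then have "\<not> ?k \<le> c" using c excess_antimono[OF assms(1), of ?k c] \<open>k < ?k\<close> assms(5) by auto
    then show "c * (1 + k * b) < k + b" using pos by (simp add: divide_le_eq)
  qed
qed

text \<open>Suppose there is no contact above k. Contact at k turns every inequality between the
  noisy combination of B1, B2 and the combination of A1, A2 into an equality. For absolute values a,
  b from the supports of the two scaled laws, the monotonicity steps then force |a - b| < k (1 - a
  b), and the equality case of \<open>stringy_tree\<close> forces a + b \<le> k (1 + a b). So the
  combination of the scaled laws lives in [-k, k] and its potential at k is 0, contrary to contact
  at a positive value.\<close>

lemma contact_combine:
  assumes A: "sym_law A1" "sym_law A2" and B: "sym_law B1" "sym_law B2" and t: "0 < t" "t < 1"
    and deg: "degraded (scale t B1) A1" "degraded (scale t B2) A2"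
    and c1: "0 \<le> c1" "excess (scale t B1) c1 = 0" "0 < excess A1 c1"
    and c2: "0 \<le> c2" "excess (scale t B2) c2 = 0" "0 < excess A2 c2"
    and nt: "0 < excess B1 0" "0 < excess B2 0"
    and k: "0 \<le> k" "excess (combine A1 A2) k = excess (scale t (combine B1 B2)) k" "0
        < excess (combine A1 A2) k"
  shows "\<exists>k'>k. (excess A1 k' = excess (scale t B1) k' \<and> 0 < excess A1 k') \<or> (excess A2 k'
      = excess (scale t B2) k' \<and> 0 < excess A2 k')"
proof (rule ccontr)
  assume no: "\<not> ?thesis"
  have no1: "excess A1 k' \<le> 0" if "k < k'" "excess A1 k' = excess (scale t B1) k'" for k'
    using no that by force
  have no2: "excess A2 k' \<le> 0" if "k < k'" "excess A2 k' = excess (scale t B2) k'" for k'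
    using no that by force
  define C1 C2 where "C1 = scale t B1" and "C2 = scale t B2"
  have t': "\<bar>t\<bar> \<le> 1" "0 \<le> t" "t \<le> 1" using t by auto
  have C: "sym_law C1" "sym_law C2" unfolding C1_def C2_def using B t' by (auto
      intro: sym_law_scale)
  note pA = A[THEN sym_lawD] and pB = B[THEN sym_lawD] and pC = C[THEN sym_lawD]
  have pBB: "posterior_law (combine B1 B2)" by (intro posterior_law_combine pB)
  \<comment> \<open>All five values agree at k: the outer ones by contact, the others by squeezing.
    The two routes, through \<open>combine A1 C2\<close> and through \<open>combine C1 A2\<close>,
    give information on either factor.\<close>
  have ch: "absdev (scale t (combine B1 B2)) k 1 \<le> absdev (combine C1 C2) k 1"
    "absdev (combine C1 C2) k 1 \<le> absdev (combine A1 C2) k 1" "absdev (combine A1 C2) k 1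
        \<le> absdev (combine A1 A2) k 1"
    "absdev (combine C1 C2) k 1 \<le> absdev (combine C1 A2) k 1" "absdev (combine C1 A2) k 1
        \<le> absdev (combine A1 A2) k 1"
    using deg unfolding C1_def[symmetric] C2_def[symmetric]
    by (auto intro!: degradedD degraded_combine pA pC degraded_refl)
      (simp add: C1_def C2_def stringy_tree B t')
  have eqs: "absdev (combine A1 C2) k 1 = absdev (combine C1 C2) k 1" "absdev (combine C1 A2) k 1
      = absdev (combine C1 C2) k 1"
    "absdev (combine C1 C2) k 1 = absdev (scale t (combine B1 B2)) k 1"
    using ch k(2) by (auto simp: excess_def)
  \<comment> \<open>The scaled combination lives in [-t, t], so a positive potential at k needs k <
    t. This provides the condition x \<le> Y of the \<open>noise_gain\<close> lemmas with x = k and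
    Y = t.\<close>
  have kt: "k < t"
  proof -
    have "k < absdev (combine B1 B2) k t" using k(2,3)
        by (simp add: excess_def absdev_scale[OF pBB])
    then show ?thesis using absdev_le_max[OF pBB, of k t] k(1) t by auto
  qed
  then have k1: "k < 1" using t by simp
  have "AE b in C2. 0 < b \<longrightarrow> c1 * (1 + k * b) < k + b"
    by (rule combine_no_contact_AE[OF A(1) C(1,2) _ k(1) k1 eqs(1) c1(1,3)])
      (use deg(1) no1 in \<open>auto simp: C1_def\<close>)
  moreover have "AE b in C2. \<bar>b\<bar> \<le> c2" using c2(1,2) excess_eq_0_iff[OF C(2)] by (simp add: C2_def)
  ultimately have "AE b in C2. \<bar>b\<bar> \<le> c2 \<and> (0 < b \<longrightarrow> c1 * (1 + k * b) < k + b)"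
      by eventually_elim auto
  from AE_sym_abs[OF B(2) AE_scale[OF pB(2) this[unfolded C2_def]]]
  have ae2: "AE b in B2. t * \<bar>b\<bar> \<le> c2 \<and> (b \<noteq> 0 \<longrightarrow> c1 * (1 + k * (t * \<bar>b\<bar>)) < k + t * \<bar>b\<bar>)"
    by eventually_elim (use t in \<open>auto simp: abs_mult\<close>)
  have "AE b in C1. 0 < b \<longrightarrow> c2 * (1 + k * b) < k + b"
    by (rule combine_no_contact_AE[OF A(2) C(2,1) _ k(1) k1 _ c2(1,3)])
      (use deg(2) no2 eqs(2) in \<open>auto
          simp: C2_def[symmetric] combine_commute[OF pC(2,1)] combine_commute[OF pA(2) pC(1)]\<close>)
  moreover have "AE b in C1. \<bar>b\<bar> \<le> c1" using c1(1,2) excess_eq_0_iff[OF C(1)] by (simp add: C1_def)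
  ultimately have "AE b in C1. \<bar>b\<bar> \<le> c1 \<and> (0 < b \<longrightarrow> c2 * (1 + k * b) < k + b)"
      by eventually_elim auto
  from AE_sym_abs[OF B(1) AE_scale[OF pB(1) this[unfolded C1_def]]]
  have ae1: "AE a in B1. t * \<bar>a\<bar> \<le> c1 \<and> (a \<noteq> 0 \<longrightarrow> c2 * (1 + k * (t * \<bar>a\<bar>)) < k + t * \<bar>a\<bar>)"
    by eventually_elim (use t in \<open>auto simp: abs_mult\<close>)

  interpret B2: prob_space B2 using posterior_lawD(1)[OF pB(2)] .
  interpret B1: prob_space B1 using posterior_lawD(1)[OF pB(1)] .
  interpret pair_sigma_finite B1 B2 ..
  let ?g = "\<lambda>p z. noise_gain k t (fst z) (snd z) p"
  have t2: "0 < t\<^sup>2" "t\<^sup>2 < 1" "\<bar>t\<^sup>2\<bar> \<le> 1" using t by (auto simp: power_less_one_iff power_le_one)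
  have int: "integrable (B1 \<Otimes>\<^sub>M B2) (?g (t\<^sup>2))" "integrable (B1 \<Otimes>\<^sub>M B2) (?g 1)"
    using k(1) t2 t' by (auto intro!: integrable_noise_gain pB)
  have "(LINT z|(B1 \<Otimes>\<^sub>M B2). ?g (t\<^sup>2) z - ?g 1 z) = 0"
    using eqs(3) absdev_combine_noise_gain(1)[OF B t'(1), of k t] absdev_combine_noise_gain(2)[OF B t'(1), of k 1] k(1) t' int
    by (simp add: absdev_scale[OF pBB] C1_def C2_def)
  moreover have "AE z in B1 \<Otimes>\<^sub>M B2. 0 \<le> ?g (t\<^sup>2) z - ?g 1 z"
    using pair_posterior_AE[OF pB]
    by eventually_elim (use k(1) kt t2 in \<open>auto intro!: noise_gain_antimono\<close>)
  ultimately have "AE z in B1 \<Otimes>\<^sub>M B2. ?g (t\<^sup>2) z - ?g 1 z = 0"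
    using integral_nonneg_eq_0_iff_AE[OF Bochner_Integration.integrable_diff[OF int]] by simp
  then have gain: "AE a in B1. AE b in B2. ?g (t\<^sup>2) (a, b) = ?g 1 (a, b)"
    using AE_pair[of "\<lambda>z. ?g (t\<^sup>2) z - ?g 1 z = 0"] by (auto elim!: eventually_mono)
  \<comment> \<open>R says that in both maxima of \<open>noise_gain k t a b (t\<^sup>2)\<close> the
    term with k dominates: the combined posterior means of the pair stay within [-k, k].\<close>
  define R where "R a b \<longleftrightarrow> t * (\<bar>a\<bar> + \<bar>b\<bar>) \<le> k * (1 + t\<^sup>2 * (\<bar>a\<bar> * \<bar>b\<bar>)) \<and> t * \<bar>\<bar>a\<bar> - \<bar>b\<bar>\<bar>
      \<le> k * (1 - t\<^sup>2 * (\<bar>a\<bar> * \<bar>b\<bar>))" for a b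
  have R: "AE a in B1. AE b in B2. a \<noteq> 0 \<longrightarrow> b \<noteq> 0 \<longrightarrow> R a b"
    using gain ae1 posterior_lawD(4)[OF pB(1)]
  proof eventually_elim
    case (elim a)
    show ?case using elim(1) ae2 posterior_lawD(4)[OF pB(2)]
    proof eventually_elim
      case (elim b)
      show ?case
      proof (intro impI)
        assume n: "a \<noteq> 0" "b \<noteq> 0"
        note e1 = \<open>t * \<bar>a\<bar> \<le> c1 \<and> (a \<noteq> 0 \<longrightarrow> c2 * (1 + k * (t * \<bar>a\<bar>)) < k + t * \<bar>a\<bar>)\<close> \<open>\<bar>a\<bar> \<le> 1\<close>
        have p1: "0 \<le> 1 + k * (t * \<bar>b\<bar>)" "0 \<le> 1 + k * (t * \<bar>a\<bar>)" using k(1) t by auto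
        \<comment> \<open>c1 and c2 bound the supports of the scaled laws and are at the same time
          below the shifted thresholds: t |a| \<le> c1 < (k + t |b|) / (1 + k t |b|), and
          symmetrically.\<close>
        have "t * \<bar>a\<bar> * (1 + k * (t * \<bar>b\<bar>)) \<le> c1 * (1 + k * (t * \<bar>b\<bar>))"
          using e1 by (intro mult_right_mono p1) auto
        also have "\<dots> < k + t * \<bar>b\<bar>" using elim n by auto
        finally have i1: "t * (\<bar>a\<bar> - \<bar>b\<bar>) < k * (1 - t\<^sup>2 * (\<bar>a\<bar> * \<bar>b\<bar>))"
          by (simp add: algebra_simps power2_eq_square)
        have "t * \<bar>b\<bar> * (1 + k * (t * \<bar>a\<bar>)) \<le> c2 * (1 + k * (t * \<bar>a\<bar>))"
          using elim by (intro mult_right_mono p1) auto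
        also have "\<dots> < k + t * \<bar>a\<bar>" using e1 n by auto
        finally have i2: "t * (\<bar>b\<bar> - \<bar>a\<bar>) < k * (1 - t\<^sup>2 * (\<bar>a\<bar> * \<bar>b\<bar>))"
          by (simp add: algebra_simps power2_eq_square)
        have i: "t * \<bar>\<bar>a\<bar> - \<bar>b\<bar>\<bar> < k * (1 - t\<^sup>2 * (\<bar>a\<bar> * \<bar>b\<bar>))"
          using i1 i2 by (cases "\<bar>b\<bar> \<le> \<bar>a\<bar>") (auto simp: abs_of_nonneg abs_of_nonpos)
        have "k \<noteq> 0"
        proof
          assume "k = 0"
          with i1 i2 t show False by (auto simp: mult_less_0_iff)
        qed
        \<comment> \<open>Otherwise the gain would be strictly larger for p = t^2 than for p = 1,
          against \<open>gain\<close>.\<close>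
        have "\<not> k * (1 + t\<^sup>2 * (\<bar>a\<bar> * \<bar>b\<bar>)) < t * (\<bar>a\<bar> + \<bar>b\<bar>)"
        proof
          assume "k * (1 + t\<^sup>2 * (\<bar>a\<bar> * \<bar>b\<bar>)) < t * (\<bar>a\<bar> + \<bar>b\<bar>)"
          then have "noise_gain k t \<bar>a\<bar> \<bar>b\<bar> 1 < noise_gain k t \<bar>a\<bar> \<bar>b\<bar> (t\<^sup>2)"
            using i n e1(2) elim \<open>k \<noteq> 0\<close> k(1) kt t2 by (intro noise_gain_strict) auto
          then show False using elim by (simp add: noise_gain_abs)
        qed
        with i show "R a b" by (auto simp: R_def)
      qed
    qed
  qed
  \<comment> \<open>Adding a nonnegative observation does not lower the posterior mean, so a bound k
    on the combined mean bounds each of the two.\<close>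
  have R_le: "t * \<bar>a\<bar> \<le> k" "t * \<bar>b\<bar> \<le> k" if "R a b" "\<bar>a\<bar> \<le> 1" "\<bar>b\<bar> \<le> 1" for a b
  proof -
    have s: "t * \<bar>a\<bar> + t * \<bar>b\<bar> \<le> k + k * (t * \<bar>a\<bar>) * (t * \<bar>b\<bar>)"
      using that(1) by (simp add: R_def algebra_simps power2_eq_square)
    have ab: "0 \<le> t * \<bar>a\<bar>" "0 \<le> t * \<bar>b\<bar>" using t by auto
    have "k * k \<le> 1" using k(1) k1 by (intro mult_le_one) auto
    then have kk: "k * (k * (t * \<bar>a\<bar>)) \<le> t * \<bar>a\<bar>" "k * (k * (t * \<bar>b\<bar>)) \<le> t * \<bar>b\<bar>"
      using mult_right_mono[of "k * k" 1 "t * \<bar>a\<bar>"] mult_right_mono[of "k * k" 1 "t * \<bar>b\<bar>"] ab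
          by (auto simp: ac_simps)
    have lt: "k * (t * \<bar>a\<bar>) < 1" "k * (t * \<bar>b\<bar>) < 1"
    proof -
      have "t * \<bar>a\<bar> \<le> 1" "t * \<bar>b\<bar> \<le> 1" using that t by (auto intro!: mult_le_one)
      then show "k * (t * \<bar>a\<bar>) < 1" "k * (t * \<bar>b\<bar>) < 1"
        using mult_left_mono[of "t * \<bar>a\<bar>" 1 k] mult_left_mono[of "t * \<bar>b\<bar>" 1 k] k(1) k1 by auto
    qed
    show "t * \<bar>a\<bar> \<le> k"
    proof (rule ccontr)
      assume "\<not> t * \<bar>a\<bar> \<le> k"
      then have "0 < (t * \<bar>a\<bar> - k) * (1 - k * (t * \<bar>b\<bar>))" using lt by (intro mult_pos_pos) auto
      then show False using s kk by (simp add: algebra_simps)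
    qed
    show "t * \<bar>b\<bar> \<le> k"
    proof (rule ccontr)
      assume "\<not> t * \<bar>b\<bar> \<le> k"
      then have "0 < (t * \<bar>b\<bar> - k) * (1 - k * (t * \<bar>a\<bar>))" using lt by (intro mult_pos_pos) auto
      then show False using s kk by (simp add: algebra_simps)
    qed
  qed
  \<comment> \<open>R is known only for pairs of nonzero values. Nontriviality of B1 and B2 supplies
    a nonzero partner, and \<open>R_le\<close> then bounds the other coordinate, which settles the
    pairs containing a zero.\<close>
  have nn1: "\<not> (AE a in B1. a = 0)" and nn2: "\<not> (AE b in B2. b = 0)"
    using nt excess_eq_0_iff[OF B(1), of 0] excess_eq_0_iff[OF B(2), of 0] by auto
  have b_le: "AE b in B2. t * \<bar>b\<bar> \<le> k"
  proof -
    have "\<exists>a. a \<noteq> 0 \<and> \<bar>a\<bar> \<le> 1 \<and> (AE b in B2. a \<noteq> 0 \<longrightarrow> b \<noteq> 0 \<longrightarrow> R a b)"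
    proof (rule ccontr)
      assume no: "\<not> ?thesis"
      have "AE a in B1. a = 0" using R posterior_lawD(4)[OF pB(1)]
          by eventually_elim (use no in auto)
      with nn1 show False by simp
    qed
    then obtain a where a: "a \<noteq> 0" "\<bar>a\<bar> \<le> 1" "AE b in B2. a \<noteq> 0 \<longrightarrow> b \<noteq> 0 \<longrightarrow> R a b" by blast
    from a(3) posterior_lawD(4)[OF pB(2)] show ?thesis
    proof eventually_elim
      case (elim b)
      then show ?case using R_le(2)[of a b] a k(1) by (cases "b = 0") auto
    qed
  qed
  have a_le: "AE a in B1. t * \<bar>a\<bar> \<le> k"
    using R posterior_lawD(4)[OF pB(1)]
  proof eventually_elim
    case (elim a)
    have "\<exists>b. b \<noteq> 0 \<and> \<bar>b\<bar> \<le> 1 \<and> (a \<noteq> 0 \<longrightarrow> R a b)"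
    proof (rule ccontr)
      assume no: "\<not> ?thesis"
      have "AE b in B2. b = 0" using elim(1) posterior_lawD(4)[OF pB(2)]
          by eventually_elim (use no in auto)
      with nn2 show False by simp
    qed
    then show ?case using R_le(1) elim(2) k(1) by (cases "a = 0") auto
  qed
  have "AE a in B1. AE b in B2. ?g (t\<^sup>2) (a, b) = 2 * k"
    using R a_le
  proof eventually_elim
    case (elim a)
    show ?case using elim(1) b_le
    proof eventually_elim
      case (elim b)
      show ?case
      proof (cases "a = 0 \<or> b = 0")
        case True
        then show ?thesis using elim \<open>t * \<bar>a\<bar> \<le> k\<close> t by (auto simp: noise_gain_def max_def)
      next
        case False
        then have "R a b" using elim by auto
        then have "noise_gain k t \<bar>a\<bar> \<bar>b\<bar> (t\<^sup>2) = 2 * k"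
          by (auto simp: R_def noise_gain_def max_def algebra_simps)
        then show ?thesis by (simp add: noise_gain_abs)
      qed
    qed
  qed
  then have "(LINT a|B1. LINT b|B2. ?g (t\<^sup>2) (a, b)) = (LINT a|B1. 2 * k)"
  proof (intro integral_cong_AE)
    have [measurable_cong]: "sets B1 = sets borel" "sets B2 = sets borel" using pB posterior_lawD(2)
        by auto
    show "(\<lambda>a. LINT b|B2. ?g (t\<^sup>2) (a, b)) \<in> borel_measurable B1"
      unfolding noise_gain_def by measurable
    assume "AE a in B1. AE b in B2. ?g (t\<^sup>2) (a, b) = 2 * k"
    then show "AE a in B1. (LINT b|B2. ?g (t\<^sup>2) (a, b)) = 2 * k"
    proof eventually_elim
      case (elim a)
      have "(\<lambda>b. ?g (t\<^sup>2) (a, b)) \<in> borel_measurable B2"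
        unfolding noise_gain_def fst_conv snd_conv by measurable
      then have "(LINT b|B2. ?g (t\<^sup>2) (a, b)) = (LINT b|B2. 2 * k)"
        using elim by (intro integral_cong_AE) auto
      then show ?case by (simp add: B2.prob_space)
    qed
  qed simp
  also have "\<dots> = 2 * k" by (simp add: B1.prob_space)
  finally have "(LINT z|(B1 \<Otimes>\<^sub>M B2). ?g (t\<^sup>2) z) = 2 * k"
    using integral_fst'[OF int(1)] by simp
  then have "absdev (combine C1 C2) k 1 = k"
    using absdev_combine_noise_gain(2)[OF B t'(1), of k 1] k(1) t' by (simp add: C1_def C2_def)
  then show False using eqs(3) k(2,3) by (simp add: excess_def)
qed

section \<open>Radius of the support\<close>

definition is_radius :: "real measure \<Rightarrow> real \<Rightarrow> bool" where
  "is_radius m y \<longleftrightarrow> 0 < y \<and> y \<le> 1 \<and> excess m y = 0 \<and> (\<forall>k. 0 \<le> k \<longrightarrow> k < y \<longrightarrow> 0 < excess m k)"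

text \<open>The least zero of the potential is attained by continuity, and it is not 0 because the
  law is nontrivial.\<close>

lemma radius_exists:
  assumes "sym_law m" "0 < excess m 0"
  obtains y where "is_radius m y"
proof -
  define S where "S = {k. 0 \<le> k \<and> k \<le> 1 \<and> excess m k = 0}"
  have S1: "1 \<in> S" using excess_eq_0_ge_1[OF assms(1), of 1] by (simp add: S_def)
  have bd: "bdd_below S" by (auto simp: S_def intro: bdd_belowI[of _ 0])
  have "closed S"
  proof -
    have "continuous_on {0..1} (excess m)"
      unfolding excess_def by (intro continuous_intros continuous_on_absdev sym_lawD[OF assms(1)])
    then have "closed {k \<in> {0..1}. excess m k = 0}"
      by (intro continuous_closed_preimage_constant) auto
    moreover have "{k \<in> {0..1}. excess m k = 0} = S" by (auto simp: S_def)
    ultimately show ?thesis by simp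
  qed
  then have I: "Inf S \<in> S" using closed_contains_Inf[OF _ bd] S1 by auto
  have "Inf S \<noteq> 0" using I assms(2) by (auto simp: S_def)
  moreover have "0 < excess m k" if "0 \<le> k" "k < Inf S" for k
  proof (rule ccontr)
    assume "\<not> 0 < excess m k"
    then have "k \<in> S" using excess_nonneg[OF assms(1) that(1)] that cInf_lower[OF S1 bd] by (auto
        simp: S_def)
    then show False using cInf_lower[OF _ bd] that(2) by force
  qed
  ultimately have "is_radius m (Inf S)" using I by (auto simp: is_radius_def S_def)
  then show thesis by (rule that)
qed

lemma radius_le:
  assumes "is_radius m y" "0 \<le> k" "excess m k = 0"
  shows "y \<le> k"
  using assms by (force simp: is_radius_def)

text \<open>These are the ways in which \<open>noise_gain\<close> can exceed 2 k at the threshold k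
  = (y1 + y2) / (1 + y1 y2), multiplied by 1 + y1 y2: only the first maximum overshoots, only the
  second, or (half of the total) both. The bounds are linear in the overshoots of a and b, with
  coefficients 1 - y2 and 1 - y1; these coefficients later produce a strict loss under
  combination.\<close>

lemma boost_excess_le:
  fixes a b y1 y2 :: real
  assumes y: "0 \<le> y1" "y1 \<le> 1" "0 \<le> y2" "y2 \<le> 1" and ab: "0 \<le> a" "a \<le> 1" "0 \<le> b" "b \<le> 1"
  shows "(a + b) * (1 + y1 * y2) - (y1 + y2) * (1 + a * b)
      \<le> 2 * ((1 - y2) * max 0 (a - y1) + (1 - y1) * max 0 (b - y2))" (is "?T1 \<le> 2 * ?R")
    and "b \<le> a \<Longrightarrow> (a - b) * (1 + y1 * y2) - (y1 + y2) * (1 - a * b) \<le> (1 - y2) * max 0 (a - y1)"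
    and "a * (1 + y1 * y2) - (y1 + y2) \<le> (1 - y2) * max 0 (a - y1)"
proof -
  define u v where "u = a - y1" and "v = b - y2"
  \<comment> \<open>In the shifted variables the only term quadratic in (u, v) is - u v (y1 + y2).
    It helps unless u and v have opposite signs; then it is absorbed by \<open>br1\<close> or
    \<open>br2\<close>.\<close>
  have T1: "?T1 = u * (1 - y2\<^sup>2) + v * (1 - y1\<^sup>2) - u * v * (y1 + y2)"
    by (simp add: u_def v_def power2_eq_square algebra_simps)
  have sq: "0 \<le> 1 - y1\<^sup>2" "0 \<le> 1 - y2\<^sup>2" using y by (auto simp: power_le_one)
  have d: "1 - y1\<^sup>2 \<le> 2 * (1 - y1)" "1 - y2\<^sup>2 \<le> 2 * (1 - y2)"
    using zero_le_power2[of "1 - y1"] zero_le_power2[of "1 - y2"] by (auto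
        simp: power2_eq_square algebra_simps)
  have br1: "0 \<le> 1 - y2\<^sup>2 - v * (y1 + y2)"
  proof -
    have "v * (y1 + y2) \<le> (1 - y2) * (y1 + y2)" using y ab by (intro mult_right_mono) (auto
        simp: v_def)
    moreover have "0 \<le> (1 - y1) * (1 - y2)" using y by simp
    moreover have "(1 - y1) * (1 - y2) = 1 - y2\<^sup>2 - (1 - y2) * (y1 + y2)"
      by (simp add: power2_eq_square algebra_simps)
    ultimately show ?thesis by linarith
  qed
  have br2: "0 \<le> 1 - y1\<^sup>2 - u * (y1 + y2)"
  proof -
    have "u * (y1 + y2) \<le> (1 - y1) * (y1 + y2)" using y ab by (intro mult_right_mono) (auto
        simp: u_def)
    moreover have "0 \<le> (1 - y1) * (1 - y2)" using y by simp
    moreover have "(1 - y1) * (1 - y2) = 1 - y1\<^sup>2 - (1 - y1) * (y1 + y2)"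
      by (simp add: power2_eq_square algebra_simps)
    ultimately show ?thesis by linarith
  qed
  show "?T1 \<le> 2 * ?R"
  proof (cases "0 \<le> u"; cases "0 \<le> v")
    assume uv: "0 \<le> u" "0 \<le> v"
    have "0 \<le> u * v * (y1 + y2)" using uv y by simp
    moreover have "u * (1 - y2\<^sup>2) \<le> u * (2 * (1 - y2))" "v * (1 - y1\<^sup>2) \<le> v * (2 * (1 - y1))"
      using uv d by (auto intro: mult_left_mono)
    moreover have "2 * ?R = u * (2 * (1 - y2)) + v * (2 * (1 - y1))"
      using uv by (simp add: u_def v_def algebra_simps)
    ultimately show ?thesis unfolding T1 by linarith
  next
    assume uv: "0 \<le> u" "\<not> 0 \<le> v"
    have "v * (1 - y1\<^sup>2 - u * (y1 + y2)) \<le> 0" using uv br2 by (intro mult_nonpos_nonneg) auto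
    moreover have "u * (1 - y2\<^sup>2) \<le> u * (2 * (1 - y2))" using uv d by (auto intro: mult_left_mono)
    moreover have "2 * ?R = u * (2 * (1 - y2))"
      using uv by (simp add: u_def v_def max_def algebra_simps)
    ultimately show ?thesis unfolding T1 by (simp add: algebra_simps)
  next
    assume uv: "\<not> 0 \<le> u" "0 \<le> v"
    have "u * (1 - y2\<^sup>2 - v * (y1 + y2)) \<le> 0" using uv br1 by (intro mult_nonpos_nonneg) auto
    moreover have "v * (1 - y1\<^sup>2) \<le> v * (2 * (1 - y1))" using uv d by (auto intro: mult_left_mono)
    moreover have "2 * ?R = v * (2 * (1 - y1))"
      using uv by (simp add: u_def v_def max_def algebra_simps)
    ultimately show ?thesis unfolding T1 by (simp add: algebra_simps)
  next
    assume uv: "\<not> 0 \<le> u" "\<not> 0 \<le> v"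
    have "0 \<le> u * v * (y1 + y2)" using uv y by (simp add: mult_nonpos_nonpos)
    moreover have "u * (1 - y2\<^sup>2) \<le> 0" "v * (1 - y1\<^sup>2) \<le> 0" using uv sq by (auto
        intro: mult_nonpos_nonneg)
    ultimately have "?T1 \<le> 0" unfolding T1 by linarith
    moreover have "?R = 0" using uv by (simp add: u_def v_def max_def)
    ultimately show ?thesis by (simp only: mult_zero_right)
  qed
  have "(1 - y2) * (a - y1) - (a * (1 + y1 * y2) - (y1 + y2)) = y2 * (1 - a) * (1 + y1)"
    by (simp add: algebra_simps)
  moreover have "0 \<le> y2 * (1 - a) * (1 + y1)" using y ab by simp
  moreover have "(1 - y2) * (a - y1) \<le> (1 - y2) * max 0 (a - y1)" using y
      by (intro mult_left_mono) auto
  ultimately show T3: "a * (1 + y1 * y2) - (y1 + y2) \<le> (1 - y2) * max 0 (a - y1)" by linarith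
  assume ba: "b \<le> a"
  show "(a - b) * (1 + y1 * y2) - (y1 + y2) * (1 - a * b) \<le> (1 - y2) * max 0 (a - y1)" (is "?T2
      \<le> ?S")
  proof (cases "a = 0")
    case True
    then show ?thesis using ba ab y by simp
  next
    case False
    have S: "0 \<le> ?S" using y by simp
    \<comment> \<open>Multiplied by a, the expression becomes a - b times the one bounded in
      \<open>T3\<close>, plus a nonpositive term.\<close>
    have "a * ?T2 = (a - b) * (a * (1 + y1 * y2) - (y1 + y2)) + b * (- ((y1 + y2) * (1 - a\<^sup>2)))"
      by (simp add: algebra_simps power2_eq_square)
    also have "\<dots> \<le> (a - b) * ?S + b * 0"
      using ba ab y T3 by (intro add_mono mult_left_mono) (auto simp: power_le_one)
    also have "\<dots> \<le> a * ?S" using S ab by (simp add: mult_right_mono)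
    finally show ?thesis using False ab by simp
  qed
qed

lemma noise_gain_excess_le:
  assumes y: "0 \<le> y1" "y1 \<le> 1" "0 \<le> y2" "y2 \<le> 1" and ab: "\<bar>a\<bar> \<le> 1" "\<bar>b\<bar> \<le> 1"
  defines "D \<equiv> 1 + y1 * y2"
  shows "noise_gain ((y1 + y2) / D) 1 a b 1
    \<le> 2 * ((y1 + y2) / D) + 2 * ((1 - y2) / D * max 0 (\<bar>a\<bar> - y1) + (1 - y1) / D * max 0 (\<bar>b\<bar> - y2))"
proof -
  have D: "0 < D" unfolding D_def using y by (simp add: add_pos_nonneg)
  define k where "k = (y1 + y2) / D"
  have kD: "k * D = y1 + y2" using D by (simp add: k_def)
  have k0: "0 \<le> k" using D y by (simp add: k_def)
  have *: "noise_gain k 1 a b 1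
      \<le> 2 * k + 2 * ((1 - y2) / D * max 0 (a - y1) + (1 - y1) / D * max 0 (b - y2))"
    if ab: "0 \<le> a" "a \<le> 1" "0 \<le> b" "b \<le> 1" and y: "0 \<le> y1" "y1 \<le> 1" "0 \<le> y2" "y2 \<le> 1" "b \<le> a"
      and D_def: "D = 1 + y1 * y2" and kD: "k * D = y1 + y2"
    for a b y1 y2
  proof -
    let ?R = "(1 - y2) * max 0 (a - y1) + (1 - y1) * max 0 (b - y2)"
    have R: "0 \<le> ?R" "(1 - y2) * max 0 (a - y1) \<le> ?R" using y by auto
    note e = boost_excess_le[OF y(1-4) ab, folded D_def kD]
    have n: "D * noise_gain k 1 a b 1
        = max (k * D * (1 + a * b)) ((a + b) * D) + max (k * D * (1 - a * b)) ((a - b) * D)"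
      using y(5) ab D by (simp add: noise_gain_def max_mult_distrib_left distrib_left ac_simps)
    have "D * noise_gain k 1 a b 1 \<le> D * (2 * k) + 2 * ?R"
    proof -
      have "(a + b) * D + (a - b) * D = 2 * (a * D)" by (simp add: algebra_simps)
      then show ?thesis unfolding n using e(1) e(2)[OF y(5)] e(3) R
        by (auto simp: max_def algebra_simps)
    qed
    also have "\<dots> = D * (2 * k + 2 * ((1 - y2) / D * max 0 (a - y1) + (1 - y1) / D * max 0 (b - y2)))"
      using D by (simp add: field_simps)
    finally show ?thesis using D by simp
  qed
  have "noise_gain k 1 \<bar>a\<bar> \<bar>b\<bar> 1
    \<le> 2 * k + 2 * ((1 - y2) / D * max 0 (\<bar>a\<bar> - y1) + (1 - y1) / D * max 0 (\<bar>b\<bar> - y2))"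
  proof (cases "\<bar>b\<bar> \<le> \<bar>a\<bar>")
    case True
    then show ?thesis using *[of "\<bar>a\<bar>" "\<bar>b\<bar>" y1 y2] ab y kD by (simp add: D_def)
  next
    case False
    then show ?thesis using *[of "\<bar>b\<bar>" "\<bar>a\<bar>" y2 y1] ab y kD
      by (simp add: D_def noise_gain_commute[of _ _ "\<bar>b\<bar>"] mult.commute add.commute)
  qed
  then show ?thesis by (simp add: noise_gain_abs k_def)
qed

text \<open>Integrates \<open>noise_gain_excess_le\<close>. With y1 and y2 the radii it bounds the
  radius of the combination; at other thresholds it yields the quantitative loss in
  \<open>status_invariant_radius\<close>.\<close>

lemma excess_combine_le:
  assumes "sym_law m1" "sym_law m2" and y: "0 \<le> y1" "y1 \<le> 1" "0 \<le> y2" "y2 \<le> 1"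
  shows "excess (combine m1 m2) ((y1 + y2) / (1 + y1 * y2))
    \<le> ((1 - y2) * excess m1 y1 + (1 - y1) * excess m2 y2) / (1 + y1 * y2)"
proof -
  have P: "posterior_law m1" "posterior_law m2" using assms sym_lawD by auto
  interpret m2: prob_space m2 using posterior_lawD(1)[OF P(2)] .
  interpret m1: prob_space m1 using posterior_lawD(1)[OF P(1)] .
  have [measurable_cong]: "sets m1 = sets borel" "sets m2 = sets borel" using P posterior_lawD(2)
      by auto
  define D k where "D = 1 + y1 * y2" and "k = (y1 + y2) / D"
  have D: "0 < D" unfolding D_def using y by (simp add: add_pos_nonneg)
  have k0: "0 \<le> k" using D y by (simp add: k_def)
  define f where "f a b = 2 * k + 2 * ((1 - y2) / D * max 0 (\<bar>a\<bar> - y1) + (1 - y1) / D * max 0 (\<bar>b\<bar> - y2))" for a b :: real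
  have fm: "case_prod f \<in> borel_measurable (borel \<Otimes>\<^sub>M borel)" unfolding f_def by measurable
  have fb: "\<bar>f a b\<bar> \<le> 2 * k + 2 * ((1 - y2) / D + (1 - y1) / D)" if "\<bar>a\<bar> \<le> 1" "\<bar>b\<bar> \<le> 1" for a b
  proof -
    have q: "0 \<le> (1 - y2) / D" "0 \<le> (1 - y1) / D" using D y by auto
    have "(1 - y2) / D * max 0 (\<bar>a\<bar> - y1) \<le> (1 - y2) / D" "(1 - y1) / D * max 0 (\<bar>b\<bar> - y2)
        \<le> (1 - y1) / D"
      using that y by (intro mult_left_le q; simp)+
    moreover have "0 \<le> (1 - y2) / D * max 0 (\<bar>a\<bar> - y1)" "0 \<le> (1 - y1) / D * max 0 (\<bar>b\<bar> - y2)"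
      by (intro mult_nonneg_nonneg q max.cobounded1)+
    moreover have "\<bar>2 * k + 2 * (p + q)\<bar> \<le> 2 * k + 2 * (p' + q')"
      if "p \<le> p'" "q \<le> q'" "0 \<le> p" "0 \<le> q" for p q p' q' :: real
      using that k0 by (intro abs_leI) simp_all
    ultimately show ?thesis unfolding f_def by blast
  qed
  note PI = pair_posterior_integral[OF P fm fb]
  note i1 = excess_eq[OF assms(1) y(1)] and i2 = excess_eq[OF assms(2) y(3)]
  have "2 * absdev (combine m1 m2) k 1 = (LINT z|(m1 \<Otimes>\<^sub>M m2). noise_gain k 1 (fst z) (snd z) 1)"
    using absdev_combine_noise_gain(1)[OF assms(1,2), of 1 k 1] k0 by simp
  also have "\<dots> \<le> (LINT z|(m1 \<Otimes>\<^sub>M m2). case_prod f z)"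
  proof (rule integral_mono_AE[OF integrable_noise_gain[OF P k0] PI(1)])
    show "AE z in m1 \<Otimes>\<^sub>M m2. noise_gain k 1 (fst z) (snd z) 1 \<le> case_prod f z"
      using pair_posterior_AE[OF P]
      by eventually_elim
        (use noise_gain_excess_le[OF y] in \<open>auto simp: f_def k_def D_def case_prod_unfold\<close>)
  qed auto
  also have "\<dots> = (LINT a|m1. LINT b|m2. f a b)" by (rule PI(2))
  also have "\<dots> = (LINT a|m1. 2 * k + 2 * ((1 - y2) / D * max 0 (\<bar>a\<bar> - y1) + (1 - y1) / D * excess m2 y2))"
    unfolding f_def using i2 by (simp add: m2.prob_space)
  also have "\<dots> = 2 * k + 2 * ((1 - y2) / D * excess m1 y1 + (1 - y1) / D * excess m2 y2)"
    using i1 by (simp add: m1.prob_space)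
  finally have "excess (combine m1 m2) k
      \<le> (1 - y2) / D * excess m1 y1 + (1 - y1) / D * excess m2 y2"
    by (simp add: excess_def)
  then show ?thesis by (simp add: k_def D_def add_divide_distrib)
qed

text \<open>Largest posterior means add like velocities. If the potential of the combination
  vanished at a smaller k, almost every threshold (k + b) / (1 + k b) would be at least y1. By
  symmetry of m2 this holds for -|b| as well and gives |b| (1 - k y1) \<le> k - y1, a bound below
  y2.\<close>

lemma radius_combine:
  assumes m: "sym_law m1" "sym_law m2" and r: "is_radius m1 y1" "is_radius m2 y2"
  shows "is_radius (combine m1 m2) ((y1 + y2) / (1 + y1 * y2))"
proof -
  have P: "posterior_law m1" "posterior_law m2" using assms sym_lawD by auto
  interpret m2: prob_space m2 using posterior_lawD(1)[OF P(2)] .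
  have [measurable_cong]: "sets m1 = sets borel" "sets m2 = sets borel" using P posterior_lawD(2)
      by auto
  have C: "sym_law (combine m1 m2)" by (rule sym_law_combine[OF m])
  have y: "0 < y1" "y1 \<le> 1" "0 < y2" "y2 \<le> 1" using r by (auto simp: is_radius_def)
  have D: "0 < 1 + y1 * y2" using y by (simp add: add_pos_pos)
  let ?y = "(y1 + y2) / (1 + y1 * y2)"
  have y1: "?y \<le> 1" using D mult_nonneg_nonneg[of "1 - y1" "1 - y2"] y by (simp add: algebra_simps)
  have "excess (combine m1 m2) ?y \<le> 0"
    using excess_combine_le[OF m, of y1 y2] y r by (simp add: is_radius_def)
  then have 0: "excess (combine m1 m2) ?y = 0" using excess_nonneg[OF C, of ?y] D y by simp
  have pos: "0 < excess (combine m1 m2) k" if k: "0 \<le> k" "k < ?y" for k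
  proof (rule ccontr)
    assume "\<not> 0 < excess (combine m1 m2) k"
    then have eq: "absdev (combine m1 m2) k 1 = k" using excess_nonneg[OF C k(1)]
        by (simp add: excess_def)
    have k1: "k < 1" using k y1 by linarith
    have int: "integrable m2 (\<lambda>b. absdev m1 (k + 1 * b) (1 + k * b) - (k + 1 * b))"
      by (intro Bochner_Integration.integrable_diff integrable_absdev_boost[OF P] posterior_law_affine(2)[OF P(2)])
    have "(LINT b|m2. absdev m1 (k + 1 * b) (1 + k * b) - (k + 1 * b)) = 0"
      using eq absdev_combine[OF P, of k 1] posterior_law_affine[OF P(2), of k 1] integrable_absdev_boost[OF P, of k 1] by simp
    moreover have "AE b in m2. 0 \<le> absdev m1 (k + 1 * b) (1 + k * b) - (k + 1 * b)"
      using absdev_ge_abs[OF P(1)] by (intro AE_I2) (smt (verit))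
    ultimately have "AE b in m2. absdev m1 (k + 1 * b) (1 + k * b) - (k + 1 * b) = 0"
      using integral_nonneg_eq_0_iff_AE[OF int] by simp
    from this posterior_lawD(4)[OF P(2)] have "AE b in m2. - b * (1 - k * y1) \<le> k - y1"
    proof eventually_elim
      case (elim b)
      have "k * \<bar>b\<bar> \<le> k" using elim k by (simp add: mult_left_le)
      then have kb: "0 < 1 + k * b" using k k1 by (cases "0 \<le> b") (auto simp: add_pos_nonneg)
      have z: "excess m1 ((k + b) / (1 + k * b)) = 0"
        using elim absdev_eq_excess[OF P(1) kb, of "k + b"] kb by simp
      have z0: "0 \<le> (k + b) / (1 + k * b)"
        using absdev_ge_abs[OF P(1), of "k + 1 * b" "1 + k * b"] elim kb by simp
      from radius_le[OF r(1) z0 z] show ?case using kb by (simp add: pos_le_divide_eq algebra_simps)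
    qed
    then have ae: "AE b in m2. \<bar>b\<bar> * (1 - k * y1) \<le> k - y1"
    proof -
      have "scale (- 1) m2 = m2" using m(2) by (simp add: sym_law_def)
      moreover assume ae: "AE b in m2. - b * (1 - k * y1) \<le> k - y1"
      ultimately have "AE b in scale (- 1) m2. - b * (1 - k * y1) \<le> k - y1" by (simp only:)
      then have "AE b in m2. - (- 1 * b) * (1 - k * y1) \<le> k - y1"
        by (rule AE_scale[OF P(2)])
      with \<open>AE b in m2. - b * (1 - k * y1) \<le> k - y1\<close> show ?thesis
        by eventually_elim (auto simp: abs_if)
    qed
    have ky: "0 < 1 - k * y1" using k k1 y mult_left_mono[of y1 1 k] by auto
    define z where "z = max 0 ((k - y1) / (1 - k * y1))"
    have "(k - y1) / (1 - k * y1) < y2"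
    proof -
      have "k * (1 + y1 * y2) < y1 + y2" using k(2) D by (simp add: less_divide_eq)
      then show ?thesis using ky by (simp add: divide_less_eq algebra_simps)
    qed
    then have "z < y2" "0 \<le> z" using y by (auto simp: z_def)
    then have "0 < excess m2 z" using r(2) by (simp add: is_radius_def)
    moreover have "AE b in m2. \<bar>b\<bar> \<le> z"
      using ae by eventually_elim (use ky in \<open>simp add: z_def pos_le_divide_eq le_max_iff_disj\<close>)
    ultimately show False using excess_eq_0_iff[OF m(2) \<open>0 \<le> z\<close>] by simp
  qed
  show ?thesis using y y1 0 pos D by (auto simp: is_radius_def)
qed

lemma radius_scale:
  assumes "sym_law m" "is_radius m y" "0 < s" "s \<le> 1"
  shows "is_radius (scale s m) (s * y)"
  using assms by (auto simp: is_radius_def excess_scale sym_lawD mult_le_one divide_less_eq ac_simps)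

section \<open>LLR distributions as posterior laws\<close>

text \<open>ln ((1 + a) / (1 - a)) is 2 artanh a, the inverse of \<open>bias\<close>, which is tanh
  (r / 2). The constant extension outside [-1, 1] makes the function monotone and onto, hence
  continuous on the whole line.\<close>

definition bias_llr :: "real \<Rightarrow> ereal" where
  "bias_llr a = (if 1 \<le> a then \<infinity> else if a \<le> - 1 then - \<infinity> else ereal (ln ((1 + a) / (1 - a))))"

definition bias :: "ereal \<Rightarrow> real" where
  "bias r = (if r = \<infinity> then 1 else if r = - \<infinity> then - 1
     else (1 - exp (- real_of_ereal r)) / (1 + exp (- real_of_ereal r)))"

lemma bias_simps [simp]: "bias \<infinity> = 1" "bias (- \<infinity>) = - 1" "bias (ereal x)
    = (1 - exp (- x)) / (1 + exp (- x))"
  by (auto simp: bias_def)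

lemma bias_bound: "\<bar>bias r\<bar> \<le> 1"
proof (cases r)
  case (real x)
  have "\<bar>1 - exp (- x)\<bar> \<le> 1 + exp (- x)" using exp_gt_zero[of "- x"] by linarith
  then show ?thesis using real exp_gt_zero[of "- x"] by (simp add: abs_divide)
qed auto

lemma bias_gt: "r \<noteq> - \<infinity> \<Longrightarrow> - 1 < bias r"
proof (cases r)
  case (real x)
  have "0 < 1 + exp (- x)" by (simp add: add_pos_pos)
  then show ?thesis using real by (simp add: less_divide_eq)
qed auto

lemma bias_measurable [measurable]: "bias \<in> borel_measurable borel"
  unfolding bias_def by measurable

lemma bias_llr_bias: "bias_llr (bias r) = r"
proof (cases r)
  case (real x)
  define e where "e = exp (- x)"
  have e: "0 < e" by (simp add: e_def)
  have 1: "\<not> 1 \<le> (1 - e) / (1 + e)" "\<not> (1 - e) / (1 + e) \<le> - 1" using e by (auto simp: field_simps)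
  have q: "1 + (1 - e) / (1 + e) = 2 / (1 + e)" "1 - (1 - e) / (1 + e) = 2 * e / (1 + e)"
    using e by (simp_all add: field_simps)
  have "(2 / d) / (2 * e / d) = 1 / e" if "d \<noteq> 0" for d using e that by (simp add: field_simps)
  from this[of "1 + e"] have "(1 + (1 - e) / (1 + e)) / (1 - (1 - e) / (1 + e)) = 1 / e"
    unfolding q using e by simp
  then have "ln ((1 + (1 - e) / (1 + e)) / (1 - (1 - e) / (1 + e))) = x"
    using e by (simp add: ln_div e_def)
  then show ?thesis using real 1 by (simp add: bias_llr_def e_def[symmetric])
qed (auto simp: bias_llr_def)

lemma bias_bias_llr:
  assumes "\<bar>a\<bar> \<le> 1" shows "bias (bias_llr a) = a"
proof (cases "a = 1 \<or> a = - 1")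
  case False
  then have a: "- 1 < a" "a < 1" using assms by auto
  have "exp (- ln ((1 + a) / (1 - a))) = (1 - a) / (1 + a)"
    using a by (simp add: exp_minus exp_ln)
  then have "bias (ereal (ln ((1 + a) / (1 - a))))
      = (1 - (1 - a) / (1 + a)) / (1 + (1 - a) / (1 + a))"
    by (simp only: bias_simps)
  also have "\<dots> = (2 * a / (1 + a)) / (2 / (1 + a))"
    using a by (intro arg_cong2[where f="(/)"]) (simp_all add: field_simps)
  also have "\<dots> = a" using a by simp
  finally show ?thesis using a by (simp add: bias_llr_def)
qed (auto simp: bias_llr_def)

lemma bias_llr_mono: "a \<le> b \<Longrightarrow> bias_llr a \<le> bias_llr b"
  by (auto simp: bias_llr_def frac_le)

lemma continuous_on_bias_llr: "continuous_on UNIV bias_llr"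
proof (rule continuous_onI_mono)
  have "surj bias_llr" using bias_llr_bias by (metis surjI)
  then show "open (bias_llr ` UNIV)" by simp
qed (rule bias_llr_mono)

lemma bias_llr_measurable [measurable]: "bias_llr \<in> borel_measurable borel"
  by (rule borel_measurable_continuous_onI[OF continuous_on_bias_llr])

text \<open>As e^(-r) = (1 - a) / (1 + a), the factor e^(-r) turns the density 1 + a for one input
  into the density 1 - a for the other; complements and reflections are computed with this.\<close>

lemma exp_neg_bias_llr:
  assumes "- 1 < a" "a \<le> 1"
  shows "ennreal (1 + a) * exp_neg (bias_llr a) = ennreal (1 - a)"
proof (cases "a = 1")
  case False
  then have "exp (- ln ((1 + a) / (1 - a))) = (1 - a) / (1 + a)"
    using assms by (simp add: exp_minus exp_ln)
  then show ?thesis using False assms by (simp add: bias_llr_def ennreal_mult[symmetric])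
qed (simp add: bias_llr_def)

lemma F_edge_bias_llr:
  assumes "0 \<le> \<delta>" "\<delta> \<le> 1" "\<bar>a\<bar> \<le> 1"
  shows "F_edge \<delta> (bias_llr a) = bias_llr ((1 - 2 * \<delta>) * a)"
proof (cases "\<bar>a\<bar> = 1")
  case True
  then consider "a = 1" | "a = - 1" by linarith
  then show ?thesis
  proof cases
    case 1
    have "(1 + (1 - 2 * \<delta>)) / (1 - (1 - 2 * \<delta>)) = (1 - \<delta>) / \<delta>" if "\<delta> \<noteq> 0" using that
        by (simp add: field_simps)
    then show ?thesis using assms 1 by (auto simp: bias_llr_def F_edge_infinity)
  next
    case 2
    have "(1 + - (1 - 2 * \<delta>)) / (1 - - (1 - 2 * \<delta>)) = \<delta> / (1 - \<delta>)" if "\<delta> \<noteq> 1"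
      using that by (simp add: divide_simps)
    then show ?thesis using assms 2 by (auto simp: bias_llr_def F_edge_infinity)
  qed
next
  case False
  then have a: "- 1 < a" "a < 1" using assms by auto
  have "\<bar>(1 - 2 * \<delta>) * a\<bar> \<le> \<bar>a\<bar>" using assms by (simp add: abs_mult mult_left_le_one_le)
  then have s: "- 1 < (1 - 2 * \<delta>) * a" "(1 - 2 * \<delta>) * a < 1" using a by auto
  have e: "exp (ln ((1 + a) / (1 - a))) = (1 + a) / (1 - a)" using a by (simp add: exp_ln)
  have n: "0 < 1 - a" "0 < 1 + a" using a by auto
  have "((1 - \<delta>) * ((1 + a) / (1 - a)) + \<delta>) = (1 + (1 - 2 * \<delta>) * a) / (1 - a)"
    "\<delta> * ((1 + a) / (1 - a)) + 1 - \<delta> = (1 - (1 - 2 * \<delta>) * a) / (1 - a)"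
    using n by (simp_all add: field_simps)
  then show ?thesis using a s n by (simp add: bias_llr_def e)
qed

lemma bias_llr_add:
  assumes "- 1 < a" "a \<le> 1" "- 1 < b" "b \<le> 1"
  shows "bias_llr a + bias_llr b = bias_llr ((a + b) / (1 + a * b))"
proof -
  consider "a = 1" | "b = 1" | "a < 1" "b < 1" using assms by linarith
  then show ?thesis
  proof cases
    case 3
    have "\<bar>a\<bar> * \<bar>b\<bar> < 1 * 1" using assms 3 by (intro mult_strict_mono) auto
    then have D: "0 < 1 + a * b" by (simp add: abs_mult[symmetric] abs_less_iff)
    have p: "0 < (1 - a) * (1 - b)" "0 < (1 + a) * (1 + b)" using assms 3 by auto
    then have "- 1 < (a + b) / (1 + a * b)" "(a + b) / (1 + a * b) < 1"
      using D by (auto simp: field_simps)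
    moreover have "(1 + (a + b) / (1 + a * b)) = ((1 + a) * (1 + b)) / (1 + a * b)"
      "(1 - (a + b) / (1 + a * b)) = ((1 - a) * (1 - b)) / (1 + a * b)"
      using D by (simp_all add: field_simps)
    then have "(1 + (a + b) / (1 + a * b)) / (1 - (a + b) / (1 + a * b))
        = ((1 + a) / (1 - a)) * ((1 + b) / (1 - b))"
      using D by simp
    moreover have "ln ((1 + a) / (1 - a) * ((1 + b) / (1 - b)))
        = ln ((1 + a) / (1 - a)) + ln ((1 + b) / (1 - b))"
      using assms 3 by (intro ln_mult_pos) auto
    ultimately show ?thesis using assms 3 by (simp add: bias_llr_def)
  next
    case 1
    then have "(a + b) / (1 + a * b) = 1" using assms by simp
    then show ?thesis using 1 by (simp add: bias_llr_def)
  next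
    case 2
    then have "(a + b) / (1 + a * b) = 1" using assms by (simp add: add.commute)
    then have "bias_llr ((a + b) / (1 + a * b)) = \<infinity>" by (simp only: bias_llr_def) simp
    then show ?thesis using 2 by (simp add: bias_llr_def[of 1])
  qed
qed

text \<open>If the posterior mean a has law m under a uniform prior, then given one input its law
  has density 1 + a, and given the other 1 - a. The weight vanishes at a = -1, so no mass reaches
  -\<infinity>.\<close>

definition llr :: "real measure \<Rightarrow> ereal measure" where
  "llr m = distr (density m (\<lambda>a. ennreal (1 + a))) borel bias_llr"

lemma sets_llr [simp, measurable_cong]: "sets (llr m) = sets borel"
  by (simp add: llr_def)

lemma space_llr [simp]: "space (llr m) = UNIV"
  by (simp add: llr_def)

lemma nn_integral_llr:
  assumes "posterior_law m" and [measurable]: "f \<in> borel_measurable borel"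
  shows "(\<integral>\<^sup>+ r. f r \<partial>llr m) = (\<integral>\<^sup>+ a. ennreal (1 + a) * f (bias_llr a) \<partial>m)"
proof -
  have [measurable_cong]: "sets m = sets borel" using posterior_lawD(2)[OF assms(1)] .
  show ?thesis unfolding llr_def
    by (subst nn_integral_distr, simp, simp, subst nn_integral_density) auto
qed

lemma emeasure_llr:
  assumes "posterior_law m" "E \<in> sets borel"
  shows "emeasure (llr m) E = (\<integral>\<^sup>+ a. ennreal (1 + a) * indicator E (bias_llr a) \<partial>m)"
  using nn_integral_llr[OF assms(1), of "indicator E"] assms(2) by simp

lemma integral_llr:
  fixes f :: "ereal \<Rightarrow> real"
  assumes "posterior_law m" and [measurable]: "f \<in> borel_measurable borel"
  shows "(LINT r|llr m. f r) = (LINT a|m. (1 + a) * f (bias_llr a))"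
proof -
  have [measurable_cong]: "sets m = sets borel" using posterior_lawD(2)[OF assms(1)] .
  have ae: "AE a in m. 0 \<le> 1 + a" using posterior_lawD(4)[OF assms(1)] by eventually_elim auto
  have m: "bias_llr \<in> borel_measurable (density m (\<lambda>a. ennreal (1 + a)))" by measurable
  show ?thesis unfolding llr_def integral_distr[OF m assms(2)]
    using ae by (subst integral_density) auto
qed

lemma emeasure_posterior_affine:
  assumes "posterior_law m" "\<bar>s\<bar> \<le> 1"
  shows "(\<integral>\<^sup>+ a. ennreal (1 + s * a) \<partial>m) = 1"
proof -
  have "AE a in m. 0 \<le> 1 + s * a"
    using posterior_lawD(4)[OF assms(1)]
  proof eventually_elim
    case (elim a)
    then have "\<bar>s * a\<bar> \<le> 1" using assms(2) by (simp add: abs_mult mult_le_one)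
    then show ?case by auto
  qed
  then show ?thesis
    using posterior_law_affine[OF assms(1), of 1 s] by (subst nn_integral_eq_integral) auto
qed

lemma LLR_dist_llr:
  assumes "posterior_law m"
  shows "LLR_dist (llr m)"
  unfolding LLR_dist_def distribution_gt_MInf_def
proof (intro conjI)
  have [measurable_cong]: "sets m = sets borel" using posterior_lawD(2)[OF assms(1)] .
  show "prob_space (llr m)"
    using emeasure_posterior_affine[OF assms, of 1]
        by (intro prob_spaceI) (simp add: emeasure_llr[OF assms])
  have "(\<integral>\<^sup>+ a. ennreal (1 + a) * indicator {- \<infinity>} (bias_llr a) \<partial>m) = (\<integral>\<^sup>+ a. 0 \<partial>m)"
    by (intro nn_integral_cong) (auto simp: bias_llr_def indicator_def ennreal_neg split: if_splits)
  then show "emeasure (llr m) {- \<infinity>} = 0" by (simp add: emeasure_llr[OF assms])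
  have "(\<integral>\<^sup>+ r. exp_neg r \<partial>llr m) = (\<integral>\<^sup>+ a. ennreal (1 + a) * exp_neg (bias_llr a) \<partial>m)"
    by (rule nn_integral_llr[OF assms]) measurable
  \<comment> \<open>Strict if m charges -1: at this point the left integrand is 0 and the right one
    2.\<close>
  also have "\<dots> \<le> (\<integral>\<^sup>+ a. ennreal (1 + (- 1) * a) \<partial>m)"
  proof (rule nn_integral_mono_AE)
    show "AE a in m. ennreal (1 + a) * exp_neg (bias_llr a) \<le> ennreal (1 + (- 1) * a)"
      using posterior_lawD(4)[OF assms(1)]
    proof eventually_elim
      case (elim a)
      then show ?case using exp_neg_bias_llr[of a] by (cases "a = - 1") auto
    qed
  qed
  also have "\<dots> = 1" by (rule emeasure_posterior_affine[OF assms]) simp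
  finally show "(\<integral>\<^sup>+ r. exp_neg r \<partial>llr m) \<le> 1" .
qed simp

lemma complement_llr:
  assumes "posterior_law m"
  shows "complement (llr m) = distr (density m (\<lambda>a. ennreal (1 - a))) borel bias_llr"
  unfolding complement_def
proof (rule the1_equality[OF ex1_complement[OF LLR_dist_llr[OF assms]]])
  have [measurable_cong]: "sets m = sets borel" using posterior_lawD(2)[OF assms(1)] .
  have em: "emeasure (distr (density m (\<lambda>a. ennreal (1 - a))) borel bias_llr) E
    = (\<integral>\<^sup>+ a. ennreal (1 - a) * indicator E (bias_llr a) \<partial>m)" if "E \<in> sets borel" for E
    using that nn_integral_distr[of bias_llr "density m (\<lambda>a. ennreal (1 - a))" borel "indicator E"]
    by (simp add: nn_integral_density)
  show "is_complement (llr m) (distr (density m (\<lambda>a. ennreal (1 - a))) borel bias_llr)"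
    unfolding is_complement_def distribution_lt_PInf_def
  proof (intro conjI ballI impI)
    show "prob_space (distr (density m (\<lambda>a. ennreal (1 - a))) borel bias_llr)"
      using emeasure_posterior_affine[OF assms, of "- 1"] by (intro prob_spaceI) (simp add: em)
    have "(\<integral>\<^sup>+ a. ennreal (1 - a) * indicator {\<infinity>} (bias_llr a) \<partial>m) = (\<integral>\<^sup>+ a. 0 \<partial>m)"
      by (intro nn_integral_cong) (auto
          simp: bias_llr_def indicator_def ennreal_neg split: if_splits)
    then show "emeasure (distr (density m (\<lambda>a. ennreal (1 - a))) borel bias_llr) {\<infinity>} = 0"
        by (simp add: em)
    fix E :: "ereal set" assume E[measurable]: "E \<in> sets borel" and sub: "E \<subseteq> {- \<infinity><..<\<infinity>}"
    have "(\<integral>\<^sup>+ r. exp_neg r * indicator E r \<partial>llr m)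
        = (\<integral>\<^sup>+ a. ennreal (1 + a) * (exp_neg (bias_llr a) * indicator E (bias_llr a)) \<partial>m)"
      by (rule nn_integral_llr[OF assms]) measurable
    also have "\<dots> = (\<integral>\<^sup>+ a. ennreal (1 - a) * indicator E (bias_llr a) \<partial>m)"
    proof (rule nn_integral_cong)
      fix a
      show "ennreal (1 + a) * (exp_neg (bias_llr a) * indicator E (bias_llr a))
          = ennreal (1 - a) * indicator E (bias_llr a)"
      proof (cases "bias_llr a \<in> E")
        case True
        then have "- 1 < a" "a \<le> 1" using sub by (auto simp: bias_llr_def split: if_splits)
        from exp_neg_bias_llr[OF this] show ?thesis by (simp add: indicator_def)
      qed simp
    qed
    finally show "emeasure (distr (density m (\<lambda>a. ennreal (1 - a))) borel bias_llr) E
      = (\<integral>\<^sup>+ r. exp_neg r * indicator E r \<partial>llr m)" by (simp add: em)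
  qed simp
qed

lemma
  assumes "sets \<mu> = sets borel" "sets \<nu> = sets borel"
  shows sets_mixture: "sets (mixture \<delta> \<mu> \<nu>) = sets borel"
    and space_mixture: "space (mixture \<delta> \<mu> \<nu>) = UNIV"
    and emeasure_mixture: "E \<in> sets borel \<Longrightarrow>
      emeasure (mixture \<delta> \<mu> \<nu>) E = ennreal (1 - \<delta>) * emeasure \<mu> E + ennreal \<delta> * emeasure \<nu> E"
proof -
  have sa: "sigma_sets UNIV (sets (borel :: ereal measure)) = sets borel"
    by (metis sets.sigma_sets_eq space_borel)
  show "sets (mixture \<delta> \<mu> \<nu>) = sets borel" "space (mixture \<delta> \<mu> \<nu>) = UNIV"
    by (simp_all add: mixture_def sa)
  let ?f = "\<lambda>E. ennreal (1 - \<delta>) * emeasure \<mu> E + ennreal \<delta> * emeasure \<nu> E"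
  have "countably_additive (sets borel) ?f"
  proof (rule countably_additiveI)
    fix A :: "nat \<Rightarrow> ereal set"
    assume A: "range A \<subseteq> sets borel" "disjoint_family A"
    have "(\<Sum>i. emeasure \<mu> (A i)) = emeasure \<mu> (\<Union>i. A i)" "(\<Sum>i. emeasure \<nu> (A i))
        = emeasure \<nu> (\<Union>i. A i)"
      using A assms by (auto intro!: suminf_emeasure)
    then show "(\<Sum>i. ?f (A i)) = ?f (\<Union>i. A i)"
      by (subst suminf_add[symmetric]) auto
  qed
  then show "emeasure (mixture \<delta> \<mu> \<nu>) E = ?f E" if "E \<in> sets borel"
    unfolding mixture_def using that
    by (intro emeasure_measure_of_sigma)
      (auto simp: positive_def sets.sigma_algebra_axioms[of borel, simplified])
qed

lemma nn_integral_mixture: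
  assumes s: "sets \<mu> = sets borel" "sets \<nu> = sets borel" and f: "f \<in> borel_measurable borel"
  shows "(\<integral>\<^sup>+ r. f r \<partial>mixture \<delta> \<mu> \<nu>) = ennreal (1 - \<delta>) * (\<integral>\<^sup>+ r. f r \<partial>\<mu>) + ennreal \<delta> * (\<integral>\<^sup>+ r. f r
      \<partial>\<nu>)"
proof -
  have [measurable_cong]: "sets (mixture \<delta> \<mu> \<nu>) = sets borel" by (rule sets_mixture[OF s])
  note s[measurable_cong]
  from f show ?thesis
  proof (induction rule: borel_measurable_induct)
    case (cong f g)
    then show ?case by (simp cong: nn_integral_cong)
  next
    case (set A)
    then show ?case using s emeasure_mixture[OF s, of A \<delta>] sets_mixture[OF s] by simp
  next
    case (mult u c)
    then show ?case by (simp add: nn_integral_cmult distrib_left ac_simps)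
  next
    case (add u v)
    then show ?case by (simp add: nn_integral_add distrib_left ac_simps)
  next
    case (seq F)
    have inc: "incseq (\<lambda>i. \<integral>\<^sup>+ r. F i r \<partial>M)" for M
      using seq by (intro incseq_SucI nn_integral_mono) (auto simp: incseq_Suc_iff le_fun_def)
    have "(SUP i. ennreal (1 - \<delta>) * (\<integral>\<^sup>+ r. F i r \<partial>\<mu>) + ennreal \<delta> * (\<integral>\<^sup>+ r. F i r \<partial>\<nu>))
      = (SUP i. ennreal (1 - \<delta>) * (\<integral>\<^sup>+ r. F i r \<partial>\<mu>)) + (SUP i. ennreal \<delta> * (\<integral>\<^sup>+ r. F i r \<partial>\<nu>))"
      using inc by (intro ennreal_SUP_add) (auto simp: incseq_def mult_left_mono)
    with seq show ?case
      by (simp add: SUP_apply image_comp nn_integral_monotone_convergence_SUP SUP_mult_left_ennreal)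
  qed
qed

text \<open>The mixed weight is (1 - \<delta>)(1 + a) + \<delta> (1 - a) = 1 + (1 - 2 \<delta>) a,
  and \<open>F_edge\<close> sends the LLR of a to that of (1 - 2 \<delta>) a. So weight and value
  are both those of the scaled posterior mean.\<close>

lemma edge_law:
  assumes "posterior_law m" "0 \<le> \<delta>" "\<delta> \<le> 1"
  shows "distr (mixture \<delta> (llr m) (complement (llr m))) borel (F_edge \<delta>)
      = llr (scale (1 - 2 * \<delta>) m)"
    and "prob_space (mixture \<delta> (llr m) (complement (llr m)))"
    and "sets (mixture \<delta> (llr m) (complement (llr m))) = sets borel"
    and "F_edge \<delta> \<in> borel_measurable borel"
proof -
  have [measurable_cong]: "sets m = sets borel" using posterior_lawD(2)[OF assms(1)] .
  have s: "\<bar>1 - 2 * \<delta>\<bar> \<le> 1" using assms by auto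
  have sc: "sets (complement (llr m)) = sets borel" by (simp add: complement_llr[OF assms(1)])
  show sm: "sets (mixture \<delta> (llr m) (complement (llr m))) = sets borel"
    by (rule sets_mixture) (simp_all add: sc)
  show F[measurable]: "F_edge \<delta> \<in> borel_measurable borel"
  proof -
    have "F_edge \<delta> = (\<lambda>r. bias_llr ((1 - 2 * \<delta>) * bias r))"
    proof
      fix r show "F_edge \<delta> r = bias_llr ((1 - 2 * \<delta>) * bias r)"
        using F_edge_bias_llr[OF assms(2,3) bias_bound, of r] by (simp add: bias_llr_bias)
    qed
    then show ?thesis by simp
  qed
  have nn: "(\<integral>\<^sup>+ r. g r \<partial>mixture \<delta> (llr m) (complement (llr m)))
    = (\<integral>\<^sup>+ a. ennreal (1 + (1 - 2 * \<delta>) * a) * g (bias_llr a) \<partial>m)"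
        if [measurable]: "g \<in> borel_measurable borel" for g
  proof -
    have "(\<integral>\<^sup>+ r. g r \<partial>complement (llr m)) = (\<integral>\<^sup>+ a. ennreal (1 - a) * g (bias_llr a) \<partial>m)"
      unfolding complement_llr[OF assms(1)]
      by (subst nn_integral_distr, simp, simp, subst nn_integral_density) auto
    then have "(\<integral>\<^sup>+ r. g r \<partial>mixture \<delta> (llr m) (complement (llr m)))
      = ennreal (1 - \<delta>) * (\<integral>\<^sup>+ a. ennreal (1 + a) * g (bias_llr a)
          \<partial>m) + ennreal \<delta> * (\<integral>\<^sup>+ a. ennreal (1 - a) * g (bias_llr a) \<partial>m)"
      by (simp add: nn_integral_mixture[OF sets_llr sc that] nn_integral_llr[OF assms(1) that])
    also have "\<dots> = (\<integral>\<^sup>+ a. ennreal (1 - \<delta>) * (ennreal (1 + a) * g (bias_llr a)) + ennreal \<delta> *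
        (ennreal (1 - a) * g (bias_llr a)) \<partial>m)"
      by (simp add: nn_integral_add nn_integral_cmult)
    also have "\<dots> = (\<integral>\<^sup>+ a. ennreal (1 + (1 - 2 * \<delta>) * a) * g (bias_llr a) \<partial>m)"
    proof (rule nn_integral_cong_AE)
      show "AE a in m. ennreal (1 - \<delta>) * (ennreal (1 + a) * g (bias_llr a)) + ennreal \<delta> * (ennreal (1 - a) * g (bias_llr a))
        = ennreal (1 + (1 - 2 * \<delta>) * a) * g (bias_llr a)"
        using posterior_lawD(4)[OF assms(1)]
      proof eventually_elim
        case (elim a)
        have "ennreal (1 - \<delta>) * ennreal (1 + a) + ennreal \<delta> * ennreal (1 - a)
            = ennreal (1 + (1 - 2 * \<delta>) * a)"
        proof -
          have "ennreal (1 - \<delta>) * ennreal (1 + a) + ennreal \<delta> * ennreal (1 - a)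
            = ennreal ((1 - \<delta>) * (1 + a)) + ennreal (\<delta> * (1 - a))"
            using assms elim by (simp add: ennreal_mult abs_le_iff)
          also have "\<dots> = ennreal ((1 - \<delta>) * (1 + a) + \<delta> * (1 - a))"
            using assms elim by (intro ennreal_plus[symmetric] mult_nonneg_nonneg) auto
          also have "(1 - \<delta>) * (1 + a) + \<delta> * (1 - a) = 1 + (1 - 2 * \<delta>) * a"
              by (simp add: algebra_simps)
          finally show ?thesis .
        qed
        then show ?case by (simp add: mult.assoc[symmetric] distrib_right[symmetric])
      qed
    qed
    finally show ?thesis .
  qed
  show "prob_space (mixture \<delta> (llr m) (complement (llr m)))"
    using nn[of "\<lambda>_. 1"] emeasure_posterior_affine[OF assms(1) s] by (intro prob_spaceI) simp
  show "distr (mixture \<delta> (llr m) (complement (llr m))) borel (F_edge \<delta>) = llr (scale (1 - 2 * \<delta>) m)"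
  proof (rule measure_eqI)
    fix E assume "E \<in> sets (distr (mixture \<delta> (llr m) (complement (llr m))) borel (F_edge \<delta>))"
    then have E[measurable]: "E \<in> sets borel" by simp
    note sm[measurable_cong]
    have "emeasure (distr (mixture \<delta> (llr m) (complement (llr m))) borel (F_edge \<delta>)) E
      = (\<integral>\<^sup>+ r. indicator E (F_edge \<delta> r) \<partial>mixture \<delta> (llr m) (complement (llr m)))"
      using nn_integral_distr[of "F_edge \<delta>"
          "mixture \<delta> (llr m) (complement (llr m))" borel "indicator E"] by simp
    also have "\<dots> = (\<integral>\<^sup>+ a. ennreal (1 + (1 - 2 * \<delta>) * a) * indicator E (F_edge \<delta> (bias_llr a)) \<partial>m)"
      by (rule nn) measurable
    also have "\<dots> = (\<integral>\<^sup>+ a. ennreal (1 + (1 - 2 * \<delta>) * a) * indicator E (bias_llr ((1 - 2 * \<delta>) * a))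
        \<partial>m)"
      using posterior_lawD(4)[OF assms(1)] F_edge_bias_llr[OF assms(2,3)]
      by (intro nn_integral_cong_AE) (auto elim!: eventually_mono)
    also have "\<dots> = emeasure (llr (scale (1 - 2 * \<delta>) m)) E"
      unfolding emeasure_llr[OF posterior_law_scale[OF assms(1) s] E] unfolding scale_def
      by (subst nn_integral_distr) auto
    finally show "emeasure (distr (mixture \<delta> (llr m) (complement (llr m))) borel (F_edge \<delta>)) E
      = emeasure (llr (scale (1 - 2 * \<delta>) m)) E" .
  qed simp
qed

text \<open>The product of the densities factors as (1 + a)(1 + b) = (1 + a b)(1 + c) with c = (a +
  b) / (1 + a b), and the LLRs of a and b add up to that of c.\<close>

lemma llr_convolution:
  assumes m: "posterior_law m1" "posterior_law m2"
  shows "distr (llr m1 \<Otimes>\<^sub>M llr m2) borel (\<lambda>(r, s). r + s) = llr (combine m1 m2)"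
proof (rule measure_eqI)
  have [measurable_cong]: "sets m1 = sets borel" "sets m2 = sets borel" using m posterior_lawD(2)
      by auto
  interpret m2: prob_space m2 using posterior_lawD(1)[OF m(2)] .
  interpret l2: prob_space "llr m2" using LLR_dist_llr[OF m(2)]
      by (simp add: LLR_dist_def distribution_gt_MInf_def)
  fix E assume "E \<in> sets (distr (llr m1 \<Otimes>\<^sub>M llr m2) borel (\<lambda>(r, s). r + s))"
  then have E[measurable]: "E \<in> sets borel" by simp
  have "emeasure (distr (llr m1 \<Otimes>\<^sub>M llr m2) borel (\<lambda>(r, s). r + s)) E
    = (\<integral>\<^sup>+ z. indicator E (fst z + snd z) \<partial>(llr m1 \<Otimes>\<^sub>M llr m2))"
    using nn_integral_distr[of "\<lambda>(r, s). r + s" "llr m1 \<Otimes>\<^sub>M llr m2" borel "indicator E"]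
    by (simp add: case_prod_unfold)
  also have "\<dots> = (\<integral>\<^sup>+ r. \<integral>\<^sup>+ s. indicator E (r + s) \<partial>llr m2 \<partial>llr m1)"
    by (subst l2.nn_integral_fst[symmetric]) auto
  also have "\<dots> = (\<integral>\<^sup>+ a. ennreal (1 + a) * (\<integral>\<^sup>+ s. indicator E (bias_llr a + s) \<partial>llr m2) \<partial>m1)"
    by (rule nn_integral_llr[OF m(1)]) measurable
  also have "\<dots> = (\<integral>\<^sup>+ a. \<integral>\<^sup>+ b. ennreal (1 + a) * (ennreal (1 + b) * indicator E (bias_llr a + bias_llr b)) \<partial>m2 \<partial>m1)"
    by (intro nn_integral_cong) (simp add: nn_integral_llr[OF m(2)] nn_integral_cmult)
  also have "\<dots> = (\<integral>\<^sup>+ z. ennreal (1 + fst z) * (ennreal (1 + snd z) * indicator E (bias_llr (fst z)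
      + bias_llr (snd z))) \<partial>(m1 \<Otimes>\<^sub>M m2))"
    by (subst m2.nn_integral_fst[symmetric]) auto
  also have "\<dots> = (\<integral>\<^sup>+ z. ennreal (1 + fst z * snd z) * (ennreal (1 + (fst z + snd z) / (1 + fst z * snd z))
      * indicator E (bias_llr ((fst z + snd z) / (1 + fst z * snd z)))) \<partial>(m1 \<Otimes>\<^sub>M m2))"
  proof (rule nn_integral_cong_AE)
    show "AE z in m1 \<Otimes>\<^sub>M m2. ennreal (1 + fst z) * (ennreal (1 + snd z) * indicator E (bias_llr (fst z) + bias_llr (snd z)))
      = ennreal (1 + fst z * snd z) * (ennreal (1 + (fst z + snd z) / (1 + fst z * snd z))
      * indicator E (bias_llr ((fst z + snd z) / (1 + fst z * snd z))))"
      using pair_posterior_AE[OF m]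
    proof eventually_elim
      case (elim z)
      obtain a b where z: "z = (a, b)" by (cases z)
      have ab: "\<bar>a\<bar> \<le> 1" "\<bar>b\<bar> \<le> 1" using elim by (auto simp: z)
      have D: "0 \<le> 1 + a * b" "\<bar>a + b\<bar> \<le> 1 + a * b"
        using abs_one_plus_mult[OF ab] abs_add_le_one_plus_mult[OF ab] by auto
      have w: "ennreal (1 + a) * ennreal (1 + b)
          = ennreal (1 + a * b) * ennreal (1 + (a + b) / (1 + a * b))"
      proof (cases "1 + a * b = 0")
        case True
        then have "a + b = 0" using D by simp
        then have "(1 + a) * (1 + b) = 0" using True by (simp add: algebra_simps)
        then show ?thesis using True by auto
      next
        case False
        then have "0 < 1 + a * b" using D by simp
        moreover have "0 \<le> 1 + (a + b) / (1 + a * b)" using D \<open>0 < 1 + a * b\<close>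
            by (simp add: field_simps)
        moreover have "(1 + a * b) * (1 + (a + b) / (1 + a * b)) = (1 + a) * (1 + b)"
          using False by (simp add: field_simps)
        ultimately show ?thesis using ab by (simp add: ennreal_mult[symmetric])
      qed
      show ?case
      \<comment> \<open>The addition formula excludes the value -1, where both sides carry weight
        0.\<close>
      proof (cases "a = - 1 \<or> b = - 1")
        case True
        then have "ennreal (1 + a) * ennreal (1 + b) = 0" by auto
        then have "ennreal (1 + a * b) = 0 \<or> ennreal (1 + (a + b) / (1 + a * b)) = 0"
          unfolding w by simp
        then show ?thesis using True by (auto simp: z)
      next
        case False
        then have "bias_llr a + bias_llr b = bias_llr ((a + b) / (1 + a * b))" using ab
            by (intro bias_llr_add) auto
        then show ?thesis using w by (simp add: z mult.assoc[symmetric])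
      qed
    qed
  qed
  also have "\<dots> = emeasure (llr (combine m1 m2)) E"
    by (simp add: emeasure_llr[OF posterior_law_combine[OF m]] nn_integral_combine[OF m])
  finally show "emeasure (distr (llr m1 \<Otimes>\<^sub>M llr m2) borel (\<lambda>(r, s). r + s)) E
      = emeasure (llr (combine m1 m2)) E" .
qed simp

section \<open>Posterior law of an LLR distribution\<close>

lemma nn_integral_complement:
  assumes \<mu>: "LLR_dist \<mu>" and g[measurable]: "g \<in> borel_measurable borel" and g0: "g (- \<infinity>) = 0"
  shows "(\<integral>\<^sup>+ r. g r \<partial>complement \<mu>) = (\<integral>\<^sup>+ r. exp_neg r * g r \<partial>\<mu>)"
    and "prob_space (complement \<mu>)" "sets (complement \<mu>) = sets borel" "AE r in complement \<mu>. r \<noteq> \<infinity>"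
proof -
  let ?\<nu> = "complement \<mu>"
  have c: "is_complement \<mu> ?\<nu>"
    unfolding complement_def by (rule theI'[OF ex1_complement[OF \<mu>]])
  show "prob_space ?\<nu>" and s[measurable_cong]: "sets ?\<nu> = sets borel"
    using c by (auto simp: is_complement_def distribution_lt_PInf_def)
  have s\<mu>[measurable_cong]: "sets \<mu> = sets borel" and 0: "emeasure \<mu> {- \<infinity>} = 0"
    using \<mu> by (auto simp: LLR_dist_def distribution_gt_MInf_def)
  have ae\<mu>: "AE r in \<mu>. r \<noteq> - \<infinity>" using 0 s\<mu> by (intro AE_I[where N="{- \<infinity>}"]) auto
  show ae: "AE r in ?\<nu>. r \<noteq> \<infinity>"
    using c s by (intro AE_I[where N="{\<infinity>}"]) (auto simp: is_complement_def distribution_lt_PInf_def)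
  let ?R = "{- \<infinity><..<\<infinity>} :: ereal set"
  \<comment> \<open>\<open>is_complement\<close> prescribes the measure of sets of finite values, so
    the measures are compared after restriction to these; the condition on g at -\<infinity> takes
    care of the remaining mass.\<close>
  have eq: "density ?\<nu> (indicator ?R) = density \<mu> (\<lambda>r. exp_neg r * indicator ?R r)"
  proof (rule measure_eqI)
    fix E assume "E \<in> sets (density ?\<nu> (indicator ?R))"
    then have E[measurable]: "E \<in> sets borel" by (simp add: s)
    have "emeasure (density ?\<nu> (indicator ?R)) E = (\<integral>\<^sup>+ r. indicator ?R r * indicator E r \<partial>?\<nu>)"
      by (rule emeasure_density) measurable
    also have "\<dots> = (\<integral>\<^sup>+ r. indicator (E \<inter> ?R) r \<partial>?\<nu>)"
      by (intro nn_integral_cong) (auto simp: indicator_def)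
    also have "\<dots> = emeasure ?\<nu> (E \<inter> ?R)" by simp
    also have "\<dots> = (\<integral>\<^sup>+ r. exp_neg r * indicator (E \<inter> ?R) r \<partial>\<mu>)"
    proof -
      have "E \<inter> ?R \<in> sets borel" "E \<inter> ?R \<subseteq> ?R" by auto
      then show ?thesis using c by (auto simp: is_complement_def)
    qed
    also have "\<dots> = (\<integral>\<^sup>+ r. (exp_neg r * indicator ?R r) * indicator E r \<partial>\<mu>)"
      by (intro nn_integral_cong) (auto simp: indicator_def)
    also have "\<dots> = emeasure (density \<mu> (\<lambda>r. exp_neg r * indicator ?R r)) E"
      by (rule emeasure_density[symmetric]) measurable
    finally show "emeasure (density ?\<nu> (indicator ?R)) E
        = emeasure (density \<mu> (\<lambda>r. exp_neg r * indicator ?R r)) E" .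
  qed (simp add: s s\<mu>)
  have "(\<integral>\<^sup>+ r. g r \<partial>?\<nu>) = (\<integral>\<^sup>+ r. indicator ?R r * g r \<partial>?\<nu>)"
  proof (rule nn_integral_cong_AE)
    show "AE r in ?\<nu>. g r = indicator ?R r * g r"
      using ae
    proof eventually_elim
      case (elim r)
      then show ?case using g0 by (cases r) auto
    qed
  qed
  also have "\<dots> = (\<integral>\<^sup>+ r. g r \<partial>density ?\<nu> (indicator ?R))"
    by (rule nn_integral_density[symmetric]) measurable
  also have "\<dots> = (\<integral>\<^sup>+ r. exp_neg r * indicator ?R r * g r \<partial>\<mu>)"
    unfolding eq by (rule nn_integral_density) measurable
  also have "\<dots> = (\<integral>\<^sup>+ r. exp_neg r * g r \<partial>\<mu>)"
  proof (rule nn_integral_cong_AE)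
    show "AE r in \<mu>. exp_neg r * indicator ?R r * g r = exp_neg r * g r"
      using ae\<mu>
    proof eventually_elim
      case (elim r)
      then show ?case by (cases r) auto
    qed
  qed
  finally show "(\<integral>\<^sup>+ r. g r \<partial>?\<nu>) = (\<integral>\<^sup>+ r. exp_neg r * g r \<partial>\<mu>)" .
qed

text \<open>Under a uniform prior the observation has the equal mixture of the laws for the two
  inputs, \<mu> and its complement; \<open>bias\<close> turns LLRs into posterior means.\<close>

definition posterior :: "ereal measure \<Rightarrow> real measure" where
  "posterior \<mu> = distr (mixture (1/2) \<mu> (complement \<mu>)) borel bias"

lemma posterior_law_posterior:
  assumes \<mu>: "LLR_dist \<mu>"
  shows "posterior_law (posterior \<mu>)" "llr (posterior \<mu>) = \<mu>"
proof -
  have s[measurable_cong]: "sets \<mu> = sets borel" and 0: "emeasure \<mu> {- \<infinity>} = 0" and p: "prob_space \<mu>"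
    using \<mu> by (auto simp: LLR_dist_def distribution_gt_MInf_def)
  have ae\<mu>: "AE r in \<mu>. r \<noteq> - \<infinity>" using 0 s by (intro AE_I[where N="{- \<infinity>}"]) auto
  have sp: "space \<mu> = UNIV" using sets_eq_imp_space_eq[OF s] by simp
  note C = nn_integral_complement[OF \<mu>]
  have cs[measurable_cong]: "sets (complement \<mu>) = sets borel" and cp: "prob_space (complement \<mu>)"
    using C(2,3)[of "\<lambda>_. 0"] by auto
  have csp: "space (complement \<mu>) = UNIV" using sets_eq_imp_space_eq[OF cs] by simp
  note sm[measurable_cong] = sets_mixture[OF s cs, of "1/2"]
  have "ennreal (1 / 2) + ennreal (1 / 2) = 1" by (subst ennreal_plus[symmetric]) auto
  then interpret M: prob_space "mixture (1/2) \<mu> (complement \<mu>)"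
    using prob_space.emeasure_space_1[OF p] prob_space.emeasure_space_1[OF cp]
    by (intro prob_spaceI) (simp add: space_mixture[OF s cs] emeasure_mixture[OF s cs] sp csp)
  have rd: "real_distribution (posterior \<mu>)" unfolding posterior_def
      by (rule M.real_distribution_distr) measurable
  \<comment> \<open>The weights cancel: for a = \<open>bias r\<close>, half of (1 + a)(1 + e^(-r))
    is half of (1 + a) + (1 - a), that is 1.\<close>
  have nn: "(\<integral>\<^sup>+ a. ennreal (1 + a) * g (bias_llr a) \<partial>posterior \<mu>) = (\<integral>\<^sup>+ r. g r \<partial>\<mu>)"
    if [measurable]: "g \<in> borel_measurable borel" for g
  proof -
    have "(\<integral>\<^sup>+ a. ennreal (1 + a) * g (bias_llr a) \<partial>posterior \<mu>)
      = (\<integral>\<^sup>+ r. ennreal (1 + bias r) * g r \<partial>mixture (1/2) \<mu> (complement \<mu>))"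
      unfolding posterior_def by (subst nn_integral_distr) (auto simp: bias_llr_bias)
    also have "\<dots> = ennreal (1/2) * (\<integral>\<^sup>+ r. ennreal (1 + bias r) * g r \<partial>\<mu>)
      + ennreal (1/2) * (\<integral>\<^sup>+ r. ennreal (1 + bias r) * g r \<partial>complement \<mu>)"
      by (subst nn_integral_mixture[OF s cs]) auto
    also have "(\<integral>\<^sup>+ r. ennreal (1 + bias r) * g r \<partial>complement \<mu>)
        = (\<integral>\<^sup>+ r. exp_neg r * (ennreal (1 + bias r) * g r) \<partial>\<mu>)"
      by (rule C(1)) auto
    also have "ennreal (1/2) * (\<integral>\<^sup>+ r. ennreal (1 + bias r) * g r \<partial>\<mu>) + ennreal (1/2) * \<dots>
      = (\<integral>\<^sup>+ r. ennreal (1/2) * (ennreal (1 + bias r) * g r) + ennreal (1/2) * (exp_neg r * (ennreal (1 + bias r) * g r)) \<partial>\<mu>)"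
      by (simp add: nn_integral_add nn_integral_cmult)
    also have "\<dots> = (\<integral>\<^sup>+ r. g r \<partial>\<mu>)"
    proof (rule nn_integral_cong_AE)
      show "AE r in \<mu>. ennreal (1/2) * (ennreal (1 + bias r) * g r) + ennreal (1/2) * (exp_neg r *
          (ennreal (1 + bias r) * g r)) = g r"
        using ae\<mu>
      proof eventually_elim
        case (elim r)
        have t: "- 1 < bias r" "bias r \<le> 1" using bias_gt[OF elim] bias_bound[of r] by auto
        have "ennreal (1 + bias r) * exp_neg r = ennreal (1 - bias r)"
          using exp_neg_bias_llr[OF t] by (simp add: bias_llr_bias)
        then have "ennreal (1/2) * ennreal (1 + bias r) + ennreal (1/2) * (exp_neg r * ennreal (1 + bias r))
          = ennreal (1/2) * ennreal (1 + bias r) + ennreal (1/2) * ennreal (1 - bias r)"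
          by (simp add: mult.commute)
        also have "\<dots> = ennreal (1/2 * (1 + bias r)) + ennreal (1/2 * (1 - bias r))"
          using t by (intro arg_cong2[where f="(+)"] ennreal_mult[symmetric]) auto
        also have "\<dots> = ennreal (1/2 * (1 + bias r) + 1/2 * (1 - bias r))"
          using t by (intro ennreal_plus[symmetric]) auto
        also have "1/2 * (1 + bias r) + 1/2 * (1 - bias r) = 1" by (simp add: field_simps)
        finally show ?case by (simp add: mult.assoc[symmetric] distrib_right[symmetric])
      qed
    qed
    finally show ?thesis .
  qed
  have ae: "AE a in posterior \<mu>. \<bar>a\<bar> \<le> 1"
    unfolding posterior_def by (subst AE_distr_iff) (auto simp: bias_bound)
  show posterior: "posterior_law (posterior \<mu>)"
    unfolding posterior_law_def
  proof (intro conjI rd ae)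
    interpret R: real_distribution "posterior \<mu>" by (rule rd)
    have int: "integrable (posterior \<mu>) (\<lambda>a. a)"
      by (rule R.integrable_const_bound[where B=1]) (use ae in auto)
    \<comment> \<open>The total mass 1 of \<mu> reads E(1 + a) = 1, which is the mean-zero
      condition.\<close>
    have "(\<integral>\<^sup>+ a. ennreal (1 + a) \<partial>posterior \<mu>) = 1"
      using nn[of "\<lambda>_. 1"] prob_space.emeasure_space_1[OF p] by simp
    moreover have "(\<integral>\<^sup>+ a. ennreal (1 + a) \<partial>posterior \<mu>) = ennreal (LINT a|posterior \<mu>. 1 + a)"
      using ae int by (intro nn_integral_eq_integral) (auto elim!: eventually_mono)
    moreover have "(LINT a|posterior \<mu>. 1 + a) = 1 + (LINT a|posterior \<mu>. a)"
      using int R.prob_space by simp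
    ultimately show "(LINT a|posterior \<mu>. a) = 0" by (simp add: ennreal_eq_1)
  qed
  show "llr (posterior \<mu>) = \<mu>"
  proof (rule measure_eqI)
    fix E assume "E \<in> sets (llr (posterior \<mu>))"
    then have [measurable]: "E \<in> sets borel" by simp
    then show "emeasure (llr (posterior \<mu>)) E = emeasure \<mu> E"
      using nn[of "indicator E"] s by (simp add: emeasure_llr[OF posterior])
  qed (simp add: s)
qed

text \<open>
  This turns \<^term>\<open>absdev m x y\<close> into an integral against the LLR distribution, which is linear
  under mixtures. At \<open>- \<infinity>\<close> the value is \<open>0 / 0 = 0\<close>.
\<close>

definition slope :: "real \<Rightarrow> real \<Rightarrow> ereal \<Rightarrow> real" where
  "slope x y r = (\<bar>x + y * bias r\<bar> - \<bar>x - y\<bar>) / (1 + bias r)"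

lemma slope_measurable [measurable]: "slope x y \<in> borel_measurable borel"
  unfolding slope_def by measurable

lemma slope_bound: "\<bar>slope x y r\<bar> \<le> \<bar>y\<bar>"
proof (cases "r = - \<infinity>")
  case False
  then have t: "0 < 1 + bias r" using bias_gt[of r] by simp
  have "\<bar>\<bar>x + y * bias r\<bar> - \<bar>x - y\<bar>\<bar> \<le> \<bar>(x + y * bias r) - (x - y)\<bar>" by (rule abs_triangle_ineq3)
  also have "(x + y * bias r) - (x - y) = y * (1 + bias r)" by (simp add: algebra_simps)
  finally show ?thesis using t by (simp add: slope_def abs_mult abs_divide pos_divide_le_eq)
qed (simp add: slope_def)

lemma absdev_eq_integral_llr:
  assumes "posterior_law m"
  shows "absdev m x y = \<bar>x - y\<bar> + (LINT r|llr m. slope x y r)"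
proof -
  interpret prob_space m using posterior_lawD(1)[OF assms(1)] .
  have [measurable_cong]: "sets m = sets borel" using posterior_lawD(2)[OF assms(1)] .
  have "(LINT r|llr m. slope x y r) = (LINT a|m. (1 + a) * slope x y (bias_llr a))"
    by (rule integral_llr[OF assms]) measurable
  also have "\<dots> = (LINT a|m. \<bar>x + y * a\<bar> - \<bar>x - y\<bar>)"
  proof (rule integral_cong_AE)
    show "AE a in m. (1 + a) * slope x y (bias_llr a) = \<bar>x + y * a\<bar> - \<bar>x - y\<bar>"
      using posterior_lawD(4)[OF assms(1)]
    proof eventually_elim
      case (elim a)
      then show ?case by (cases "a = - 1") (simp_all add: slope_def bias_bias_llr)
    qed
  qed measurable
  also have "\<dots> = absdev m x y - \<bar>x - y\<bar>"
    unfolding absdev_def using absdev_integrable[OF assms, of x y] by (simp add: prob_space)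
  finally show ?thesis by simp
qed

lemma llr_inject:
  assumes "posterior_law m" "posterior_law m'" "llr m = llr m'"
  shows "m = m'"
  using assms by (intro absdev_unique) (simp_all add: absdev_eq_integral_llr)

lemma posterior_llr: "posterior_law m \<Longrightarrow> posterior (llr m) = m"
  using posterior_law_posterior[OF LLR_dist_llr] llr_inject by blast

lemma bias_llr_uminus: "bias_llr (- a) = - bias_llr a"
proof -
  have "ln ((1 - a) / (1 + a)) = - ln ((1 + a) / (1 - a))" if "- 1 < a" "a < 1"
    using that by (simp add: ln_div)
  then show ?thesis by (auto simp: bias_llr_def)
qed

text \<open>The integral in the definition of symmetry is the LLR distribution of the reflected
  posterior law: e^(-r) exchanges the weights 1 + a and 1 - a, and r changes sign with a.\<close>

lemma nn_integral_reflected: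
  assumes m: "posterior_law m" and E[measurable]: "E \<in> sets borel" and sub: "E \<subseteq> {- \<infinity><..<\<infinity>}"
  shows "(\<integral>\<^sup>+ r. exp_neg r * indicator E (- r) \<partial>llr m) = emeasure (llr (scale (- 1) m)) E"
proof -
  have [measurable_cong]: "sets m = sets borel" using posterior_lawD(2)[OF m] .
  have "(\<integral>\<^sup>+ r. exp_neg r * indicator E (- r) \<partial>llr m)
      = (\<integral>\<^sup>+ a. ennreal (1 + a) * (exp_neg (bias_llr a) * indicator E (- bias_llr a)) \<partial>m)"
    by (rule nn_integral_llr[OF m]) measurable
  also have "\<dots> = (\<integral>\<^sup>+ a. ennreal (1 + - 1 * a) * indicator E (bias_llr (- 1 * a)) \<partial>m)"
  proof (rule nn_integral_cong)
    fix a
    show "ennreal (1 + a) * (exp_neg (bias_llr a) * indicator E (- bias_llr a))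
        = ennreal (1 + - 1 * a) * indicator E (bias_llr (- 1 * a))"
    proof (cases "- bias_llr a \<in> E")
      case True
      then have "- 1 < a" "a \<le> 1" using sub by (auto simp: bias_llr_def split: if_splits)
      from exp_neg_bias_llr[OF this] show ?thesis by (simp add: indicator_def bias_llr_uminus)
    qed (simp add: bias_llr_uminus)
  qed
  also have "\<dots> = emeasure (llr (scale (- 1) m)) E"
    unfolding emeasure_llr[OF posterior_law_scale[OF m, of "- 1", simplified] E] unfolding scale_def
    by (subst nn_integral_distr) auto
  finally show ?thesis .
qed

text \<open>Without mass at -\<infinity>, the mass at \<infinity> is what the finite part leaves of
  the total 1.\<close>

lemma distribution_gt_MInf_eqI:
  assumes "distribution_gt_MInf \<mu>" "distribution_gt_MInf \<nu>"
    and eq: "\<And>E. E \<in> sets borel \<Longrightarrow> E \<subseteq> {- \<infinity><..<\<infinity>} \<Longrightarrow> emeasure \<mu> E = emeasure \<nu> E"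
  shows "\<mu> = \<nu>"
proof -
  have split: "emeasure \<rho> E = emeasure \<rho> (E \<inter> {- \<infinity><..<\<infinity>})
      + (1 - emeasure \<rho> {- \<infinity><..<\<infinity>}) * indicator E \<infinity>"
    if "distribution_gt_MInf \<rho>" "E \<in> sets borel" for \<rho> E
  proof -
    have s: "sets \<rho> = sets borel" and n: "emeasure \<rho> {- \<infinity>} = 0" and "prob_space \<rho>"
      using that by (auto simp: distribution_gt_MInf_def)
    then interpret prob_space \<rho> by simp
    have sp: "space \<rho> = UNIV" using sets_eq_imp_space_eq[OF s] by simp
    have ae: "AE r in \<rho>. r \<noteq> - \<infinity>" using n s by (intro AE_I[where N="{- \<infinity>}"]) auto
    have dec: "emeasure \<rho> A = emeasure \<rho> (A \<inter> {- \<infinity><..<\<infinity>}) + emeasure \<rho> (A \<inter> {\<infinity>})"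
        if A: "A \<in> sets borel" for A
    proof -
      have "emeasure \<rho> A = emeasure \<rho> (A \<inter> {- \<infinity><..<\<infinity>} \<union> A \<inter> {\<infinity>})"
      proof (rule emeasure_eq_AE)
        show "AE r in \<rho>. r \<in> A \<longleftrightarrow> r \<in> A \<inter> {- \<infinity><..<\<infinity>} \<union> A \<inter> {\<infinity>}"
          using ae
        proof eventually_elim
          case (elim r)
          then show ?case by (cases r) auto
        qed
      qed (use A s in auto)
      also have "\<dots> = emeasure \<rho> (A \<inter> {- \<infinity><..<\<infinity>}) + emeasure \<rho> (A \<inter> {\<infinity>})"
        using A s by (intro plus_emeasure[symmetric]) auto
      finally show ?thesis .
    qed
    have "1 = emeasure \<rho> {- \<infinity><..<\<infinity>} + emeasure \<rho> {\<infinity>}"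
      using dec[of UNIV] emeasure_space_1 sp by simp
    then have "emeasure \<rho> {\<infinity>} = 1 - emeasure \<rho> {- \<infinity><..<\<infinity>}"
      by (metis emeasure_finite ennreal_add_diff_cancel_left)
    then show ?thesis using dec[OF that(2)] by (auto simp: indicator_def)
  qed
  have "emeasure \<mu> E = emeasure \<nu> E" if "E \<in> sets borel" for E
    using split[OF assms(1) that] split[OF assms(2) that] eq[of "E \<inter> {-\<infinity><..<\<infinity>}"] eq[of "{-\<infinity><..<\<infinity>}"] that
    by simp
  then show ?thesis using assms by (intro measure_eqI) (auto simp: distribution_gt_MInf_def)
qed

text \<open>Symmetry for the set of all finite values identifies the integral of e^(-r) with the
  mass of that set.\<close>

lemma symmetric_dist_imp_LLR_dist:
  assumes "symmetric_dist \<mu>"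
  shows "LLR_dist \<mu>"
proof -
  have s[measurable_cong]: "sets \<mu> = sets borel" and "emeasure \<mu> {- \<infinity>} = 0" and p: "prob_space \<mu>"
    and gt: "distribution_gt_MInf \<mu>"
    using assms by (auto simp: symmetric_dist_def distribution_gt_MInf_def)
  then have ae: "AE r in \<mu>. r \<noteq> - \<infinity>" by (intro AE_I[where N="{- \<infinity>}"]) auto
  let ?R = "{- \<infinity><..<\<infinity>} :: ereal set"
  have "(\<integral>\<^sup>+ r. exp_neg r \<partial>\<mu>) = (\<integral>\<^sup>+ r. exp_neg r * indicator ?R (- r) \<partial>\<mu>)"
  proof (rule nn_integral_cong_AE)
    show "AE r in \<mu>. exp_neg r = exp_neg r * indicator ?R (- r)"
      using ae
    proof eventually_elim
      case (elim r)
      then show ?case by (cases r) auto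
    qed
  qed
  also have "\<dots> = emeasure \<mu> ?R" using assms by (auto simp: symmetric_dist_def)
  also have "\<dots> \<le> 1" using prob_space.emeasure_le_1[OF p] .
  finally show ?thesis using gt by (simp add: LLR_dist_def)
qed

lemma symmetric_dist_llr_iff:
  assumes m: "posterior_law m"
  shows "symmetric_dist (llr m) \<longleftrightarrow> sym_law m"
proof -
  have p: "posterior_law (scale (- 1) m)" using posterior_law_scale[OF m, of "- 1"] by simp
  have gt: "distribution_gt_MInf (llr m)" "distribution_gt_MInf (llr (scale (- 1) m))"
    using LLR_dist_llr[OF m] LLR_dist_llr[OF p] by (auto simp: LLR_dist_def)
  have "symmetric_dist (llr m) \<longleftrightarrow> (\<forall>E \<in> sets borel. E \<subseteq> {- \<infinity><..<\<infinity>} \<longrightarrow>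
      emeasure (llr m) E = emeasure (llr (scale (- 1) m)) E)"
    using gt nn_integral_reflected[OF m] by (auto simp: symmetric_dist_def)
  also have "\<dots> \<longleftrightarrow> llr m = llr (scale (- 1) m)"
    using distribution_gt_MInf_eqI[OF gt] by auto
  also have "\<dots> \<longleftrightarrow> sym_law m"
    using llr_inject[OF m p] m by (auto simp: sym_law_def)
  finally show ?thesis .
qed

section \<open>The trivial law\<close>

abbreviation trivial_law :: "real measure" where
  "trivial_law \<equiv> return borel 0"

lemma posterior_law_trivial: "posterior_law trivial_law"
proof -
  interpret prob_space trivial_law by (rule prob_space_return) simp
  have "real_distribution trivial_law"
    by (simp add: real_distribution_def real_distribution_axioms_def prob_space_axioms)
  then show ?thesis by (simp add: posterior_law_def AE_return integral_return)
qed

lemma absdev_trivial: "absdev trivial_law x y = \<bar>x\<bar>"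
  by (simp add: absdev_def integral_return)

lemma llr_trivial: "llr trivial_law = trivial_dist"
proof (rule measure_eqI)
  fix E assume "E \<in> sets (llr trivial_law)"
  then have [measurable]: "E \<in> sets borel" by simp
  have "bias_llr 0 = 0" by (simp add: bias_llr_def zero_ereal_def)
  then show "emeasure (llr trivial_law) E = emeasure trivial_dist E"
    by (simp add: emeasure_llr[OF posterior_law_trivial] trivial_dist_def nn_integral_return)
qed (simp add: trivial_dist_def)

lemma combine_trivial:
  assumes "posterior_law m"
  shows "combine m trivial_law = m" "combine trivial_law m = m"
proof -
  show "combine m trivial_law = m"
    by (intro absdev_unique posterior_law_combine posterior_law_trivial assms)
      (simp add: absdev_combine[OF assms posterior_law_trivial] integral_return absdev_measurable assms)
  then show "combine trivial_law m = m"
    using combine_commute[OF assms posterior_law_trivial] by simp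
qed

lemma scale_trivial: "scale s trivial_law = trivial_law"
  unfolding scale_def by (subst distr_return) auto

lemma sym_law_trivial: "sym_law trivial_law"
  by (simp add: sym_law_def posterior_law_trivial scale_trivial)

lemma absdev_zero_imp_trivial:
  assumes "posterior_law m" "absdev m 0 1 = 0"
  shows "m = trivial_law"
proof (rule absdev_unique[OF assms(1) posterior_law_trivial])
  have [measurable_cong]: "sets m = sets borel" using posterior_lawD(2)[OF assms(1)] .
  interpret prob_space m using posterior_lawD(1)[OF assms(1)] .
  have "AE a in m. \<bar>a\<bar> = 0"
    using assms(2) absdev_integrable[OF assms(1), of 0 1]
        by (simp add: absdev_def integral_nonneg_eq_0_iff_AE)
  then have "absdev m x y = (LINT a|m. \<bar>x\<bar>)" for x y
    unfolding absdev_def by (intro integral_cong_AE) (auto elim!: eventually_mono)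
  then show "absdev m x y = absdev trivial_law x y" for x y
    by (simp add: absdev_trivial prob_space)
qed

section \<open>The law at a node as an iterated combination\<close>

definition edge_input :: "real \<times> ereal measure \<Rightarrow> ereal measure" where
  "edge_input x = mixture (fst x) (snd x) (complement (snd x))"

text \<open>Splitting off the last factor of the product measure turns the sum at a node into
  repeated convolution of two laws, the form in which \<open>llr_convolution\<close> applies and in
  which measurability is proved.\<close>

lemma BP_node_snoc:
  assumes s: "prob_space s" "sets s = sets borel"
    and xs: "\<And>x. x \<in> set (xs @ [x0]) \<Longrightarrow> prob_space (edge_input x) \<and> sets (edge_input x) = sets borel
      \<and> F_edge (fst x) \<in> borel_measurable borel"
  shows "BP_node s (xs @ [x0])
    = distr (BP_node s xs \<Otimes>\<^sub>M distr (edge_input x0) borel (F_edge (fst x0))) borel (\<lambda>(r, s). r + s)"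
    (is "?L = ?R")
proof -
  define n where "n = length xs"
  define ys where "ys = xs @ [x0]"
  \<comment> \<open>The product locale asks for a probability measure at every index, so the family
    is continued by a unit mass beyond the last child.\<close>
  define M where "M i = (if i < Suc n then edge_input (ys ! i) else return borel 0)" for i
  have pM: "prob_space (M i)" and sM[measurable_cong]: "sets (M i) = sets borel" for i
    using xs[of "ys ! i"] nth_mem[of i ys]
    by (auto simp: M_def ys_def n_def prob_space_return simp del: nth_mem)
  interpret M: product_prob_space M "{..<n}"
    using pM by (simp add: product_prob_space_def product_prob_space_axioms_def
        product_sigma_finite_def prob_space_imp_sigma_finite)
  have F: "F_edge (fst (ys ! i)) \<in> borel_measurable borel" if "i < Suc n" for i
    using xs[of "ys ! i"] nth_mem[of i ys] that by (auto simp: ys_def n_def simp del: nth_mem)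
  have x0: "prob_space (edge_input x0)" "sets (edge_input x0) = sets borel"
      "F_edge (fst x0) \<in> borel_measurable borel"
    using xs[of x0] by auto
  note [measurable_cong] = s(2) x0(2) and [measurable] = x0(3)
  have ysn: "ys ! n = x0" "M n = edge_input x0" "\<And>i. i < n \<Longrightarrow> ys ! i = xs ! i"
    by (auto simp: ys_def n_def M_def nth_append)
  interpret s: prob_space s by fact
  interpret PP: prob_space "Pi\<^sub>M I M" for I
    using pM by (intro prob_space_PiM)
  have ly: "length ys = Suc n" by (simp add: ys_def n_def)
  have eqs: "(\<Pi>\<^sub>M u\<in>{..<length (xs @ [x0])}. mixture (fst ((xs @ [x0]) ! u)) (snd ((xs @ [x0]) ! u))
      (complement (snd ((xs @ [x0]) ! u))))
      = Pi\<^sub>M {..<Suc n} M"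
    "(\<Pi>\<^sub>M u\<in>{..<length xs}. mixture (fst (xs ! u)) (snd (xs ! u)) (complement (snd (xs ! u))))
        = Pi\<^sub>M {..<n} M"
    using ysn(3) unfolding ys_def[symmetric] ly n_def[symmetric]
    by (auto intro!: PiM_cong simp: M_def edge_input_def)
  have L: "?L = distr (s \<Otimes>\<^sub>M Pi\<^sub>M {..<Suc n} M) borel (\<lambda>z. fst z + (\<Sum>u<Suc n. F_edge (fst (ys ! u)) (snd z u)))"
    unfolding BP_node_def eqs by (simp add: n_def ys_def case_prod_unfold)
  have N: "BP_node s xs = distr (s \<Otimes>\<^sub>M Pi\<^sub>M {..<n} M) borel (\<lambda>z. fst z + (\<Sum>u<n. F_edge (fst (ys ! u)) (snd z u)))"
    unfolding BP_node_def eqs using ysn(3) by (simp add: n_def case_prod_unfold)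
  have meas: "(\<lambda>z. fst z + (\<Sum>u<k. F_edge (fst (ys ! u)) (snd z u))) \<in> borel_measurable (s \<Otimes>\<^sub>M Pi\<^sub>M {..<k} M)"
    if "k \<le> Suc n" for k
  proof (intro borel_measurable_ereal_add borel_measurable_ereal_sum)
    show "(\<lambda>z. F_edge (fst (ys ! u)) (snd z u)) \<in> borel_measurable (s \<Otimes>\<^sub>M Pi\<^sub>M {..<k} M)"
        if "u \<in> {..<k}" for u
    proof -
      have "(\<lambda>z. snd z u) \<in> borel_measurable (s \<Otimes>\<^sub>M Pi\<^sub>M {..<k} M)"
        using measurable_compose[OF measurable_snd measurable_component_singleton[OF that], of s M]
          measurable_cong_sets[OF refl sM] by blast
      then show ?thesis
        using that \<open>k \<le> Suc n\<close> by (intro measurable_compose[OF _ F]) auto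
    qed
  qed measurable
  interpret E: prob_space "distr (edge_input x0) borel (F_edge (fst x0))"
    using x0(1) by (rule prob_space.prob_space_distr) measurable
  interpret x0: prob_space "edge_input x0" by (rule x0(1))
  show ?thesis
  proof (rule measure_eqI)
    show "sets ?L = sets ?R" unfolding L by simp
    fix A assume "A \<in> sets ?L"
    then have A[measurable]: "A \<in> sets borel" unfolding L by simp
    let ?S = "\<lambda>x. \<Sum>u<n. F_edge (fst (ys ! u)) (x u)"
    note m1 = meas[OF order_refl] and m2[measurable] = meas[of n, simplified]
    have "emeasure ?L A = (\<integral>\<^sup>+ z. indicator A (fst z + (\<Sum>u<Suc n. F_edge (fst (ys ! u)) (snd z u)))
        \<partial>(s \<Otimes>\<^sub>M Pi\<^sub>M {..<Suc n} M))"
      unfolding L using nn_integral_distr[OF m1, of "indicator A"] by simp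
    also have "\<dots> = (\<integral>\<^sup>+ r. \<integral>\<^sup>+ x. indicator A (r + (\<Sum>u<Suc n. F_edge (fst (ys ! u)) (x u)))
        \<partial>Pi\<^sub>M {..<Suc n} M \<partial>s)"
      using measurable_compose[OF m1, of "indicator A" borel]
      by (subst PP.nn_integral_fst[symmetric]) auto
    also have "\<dots> = (\<integral>\<^sup>+ r. \<integral>\<^sup>+ x. \<integral>\<^sup>+ y. indicator A (r + ?S x + F_edge (fst x0) y) \<partial>edge_input x0
        \<partial>Pi\<^sub>M {..<n} M \<partial>s)"
    proof (rule nn_integral_cong)
      fix r assume r: "r \<in> space s"
      have mr: "(\<lambda>x. indicator A (r + (\<Sum>u<Suc n. F_edge (fst (ys ! u)) (x u)))) \<in> borel_measurable (Pi\<^sub>M {..<Suc n} M)"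
        using measurable_compose[OF measurable_Pair1'[OF r] measurable_compose[OF m1, of "indicator A" borel]]
        by simp
      have "(\<integral>\<^sup>+ x. indicator A (r + (\<Sum>u<Suc n. F_edge (fst (ys ! u)) (x u))) \<partial>Pi\<^sub>M {..<Suc n} M)
        = (\<integral>\<^sup>+ x. \<integral>\<^sup>+ y. indicator A (r + (\<Sum>u<Suc n. F_edge (fst (ys ! u)) ((x(n := y)) u))) \<partial>M n
            \<partial>Pi\<^sub>M {..<n} M)"
        using mr unfolding lessThan_Suc by (intro M.product_nn_integral_insert) auto
      also have "\<dots> = (\<integral>\<^sup>+ x. \<integral>\<^sup>+ y. indicator A (r + ?S x + F_edge (fst x0) y) \<partial>edge_input x0
          \<partial>Pi\<^sub>M {..<n} M)"
        by (simp add: ysn add.assoc)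
      finally show "(\<integral>\<^sup>+ x. indicator A (r + (\<Sum>u<Suc n. F_edge (fst (ys ! u)) (x u)))
          \<partial>Pi\<^sub>M {..<Suc n} M)
        = (\<integral>\<^sup>+ x. \<integral>\<^sup>+ y. indicator A (r + ?S x + F_edge (fst x0) y) \<partial>edge_input x0
            \<partial>Pi\<^sub>M {..<n} M)" .
    qed
    also have "\<dots> = (\<integral>\<^sup>+ z. \<integral>\<^sup>+ y. indicator A (fst z + ?S (snd z) + F_edge (fst x0) y)
        \<partial>edge_input x0 \<partial>(s \<Otimes>\<^sub>M Pi\<^sub>M {..<n} M))"
    proof (subst PP.nn_integral_fst[symmetric])
      have [measurable]: "(\<lambda>p. fst (fst p) + ?S (snd (fst p))) \<in> borel_measurable ((s \<Otimes>\<^sub>M Pi\<^sub>M {..<n} M) \<Otimes>\<^sub>M edge_input x0)"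
        by (rule measurable_compose[OF measurable_fst m2])
      show "(\<lambda>z. \<integral>\<^sup>+ y. indicator A (fst z + ?S (snd z) + F_edge (fst x0) y) \<partial>edge_input x0)
        \<in> borel_measurable (s \<Otimes>\<^sub>M Pi\<^sub>M {..<n} M)"
        by (rule x0.borel_measurable_nn_integral_fst[where f="\<lambda>p. indicator A (fst (fst p) + ?S (snd
            (fst p)) + F_edge (fst x0) (snd p))", simplified])
           measurable
    qed simp
    also have "\<dots> = (\<integral>\<^sup>+ p. \<integral>\<^sup>+ y. indicator A (p + F_edge (fst x0) y) \<partial>edge_input x0 \<partial>BP_node s xs)"
    proof -
      have "(\<lambda>p. \<integral>\<^sup>+ y. indicator A (p + F_edge (fst x0) y)
          \<partial>edge_input x0) \<in> borel_measurable borel"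
        by measurable
      from nn_integral_distr[OF m2, of "\<lambda>p. \<integral>\<^sup>+ y. indicator A (p + F_edge (fst x0) y)
          \<partial>edge_input x0"] this
      show ?thesis unfolding N by simp
    qed
    also have "\<dots> = (\<integral>\<^sup>+ p. \<integral>\<^sup>+ q. indicator A (p + q) \<partial>distr (edge_input x0) borel (F_edge (fst x0))
        \<partial>BP_node s xs)"
      by (subst nn_integral_distr) auto
    also have "\<dots> = (\<integral>\<^sup>+ z. indicator A (fst z + snd z)
        \<partial>(BP_node s xs \<Otimes>\<^sub>M distr (edge_input x0) borel (F_edge (fst x0))))"
    proof (subst E.nn_integral_fst[symmetric])
      have [measurable_cong]: "sets (BP_node s xs) = sets borel" by (simp add: BP_node_def)
      show "(\<lambda>z. indicator A (fst z + snd z)) \<in> borel_measurable (BP_node s xs \<Otimes>\<^sub>M distr (edge_input x0) borel (F_edge (fst x0)))"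
        by measurable
    qed simp
    also have "\<dots> = emeasure ?R A"
    proof -
      have [measurable_cong]: "sets (BP_node s xs) = sets borel" by (simp add: BP_node_def)
      have "(\<lambda>(r, s). r + s) \<in> borel_measurable (BP_node s xs \<Otimes>\<^sub>M distr (edge_input x0) borel (F_edge (fst x0)))"
        by measurable
      from nn_integral_distr[OF this, of "indicator A"] show ?thesis by (simp add: case_prod_unfold)
    qed
    finally show "emeasure ?L A = emeasure ?R A" .
  qed
qed

lemma BP_node_Nil:
  assumes "prob_space s" "sets s = sets borel"
  shows "BP_node s [] = s"
proof -
  interpret s: prob_space s by fact
  have "BP_node s [] = distr (s \<Otimes>\<^sub>M count_space {\<lambda>_::nat. undefined :: ereal}) s fst"
    unfolding BP_node_def using assms by (intro distr_cong) (auto simp: case_prod_unfold PiM_empty)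
  also have "\<dots> = s"
  proof (rule measure_eqI)
    interpret C: finite_measure "count_space {\<lambda>_::nat. undefined :: ereal}"
        by (rule finite_measure_count_space) simp
    fix A assume "A \<in> sets (distr (s \<Otimes>\<^sub>M count_space {\<lambda>_::nat. undefined :: ereal}) s fst)"
    then have A: "A \<in> sets s" by simp
    have "fst -` A \<inter> space (s \<Otimes>\<^sub>M count_space {\<lambda>_::nat. undefined :: ereal})
        = A \<times> {\<lambda>_::nat. undefined :: ereal}"
      using sets.sets_into_space[OF A] by (auto simp: space_pair_measure)
    then show "emeasure (distr (s \<Otimes>\<^sub>M count_space {\<lambda>_::nat. undefined :: ereal}) s fst) A
        = emeasure s A"
      using A by (simp add: emeasure_distr C.emeasure_pair_measure_Times)
  qed simp
  finally show ?thesis .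
qed

fun posterior_BP :: "etree \<Rightarrow> real measure \<Rightarrow> real measure" where
  "posterior_BP Growing m = m"
| "posterior_BP (Node s cs) m
    = foldl combine (posterior s) (map (\<lambda>(\<delta>, T). scale (1 - 2 * \<delta>) (posterior_BP T m)) cs)"

lemma posterior_law_foldl_combine:
  "posterior_law m0 \<Longrightarrow> (\<And>m. m \<in> set ms \<Longrightarrow> posterior_law m) \<Longrightarrow> posterior_law (foldl combine m0 ms)"
  by (induction ms arbitrary: m0) (auto simp: posterior_law_combine)

lemma BP_node_llr:
  assumes "posterior_law m0" "\<And>\<delta> m. (\<delta>, m) \<in> set xs \<Longrightarrow> 0 \<le> \<delta> \<and> \<delta> \<le> 1 \<and> posterior_law m"
  shows "BP_node (llr m0) (map (\<lambda>(\<delta>, m). (\<delta>, llr m)) xs)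
      = llr (foldl combine m0 (map (\<lambda>(\<delta>, m). scale (1 - 2 * \<delta>) m) xs))"
  using assms(2)
proof (induction xs rule: rev_induct)
  case Nil
  have "prob_space (llr m0)" using LLR_dist_llr[OF assms(1)]
      by (simp add: LLR_dist_def distribution_gt_MInf_def)
  then show ?case by (simp add: BP_node_Nil)
next
  case (snoc x xs)
  obtain \<delta> m where x: "x = (\<delta>, m)" by (cases x)
  have m: "posterior_law m" "0 \<le> \<delta>" "\<delta> \<le> 1" using snoc.prems[of \<delta> m] by (auto simp: x)
  have p0: "prob_space (llr m0)" using LLR_dist_llr[OF assms(1)]
      by (simp add: LLR_dist_def distribution_gt_MInf_def)
  have "BP_node (llr m0) (map (\<lambda>(\<delta>, m). (\<delta>, llr m)) (xs @ [x]))
    = distr (BP_node (llr m0) (map (\<lambda>(\<delta>, m). (\<delta>, llr m)) xs) \<Otimes>\<^sub>M distr (edge_input (\<delta>, llr m)) borel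
        (F_edge \<delta>)) borel (\<lambda>(r, s). r + s)"
    unfolding map_append list.map x case_prod_conv
  proof (subst BP_node_snoc[OF p0 sets_llr])
    fix z assume "z \<in> set (map (\<lambda>(\<delta>, m). (\<delta>, llr m)) xs @ [(\<delta>, llr m)])"
    then have "z \<in> (\<lambda>(\<delta>, m). (\<delta>, llr m)) ` set (xs @ [x])" by (auto simp: x)
    then obtain \<delta>' m' where z: "z = (\<delta>', llr m')" "(\<delta>', m') \<in> set (xs @ [x])"
        by (metis (no_types, lifting) imageE surj_pair case_prod_conv)
    then have "posterior_law m'" "0 \<le> \<delta>'" "\<delta>' \<le> 1" using snoc.prems[of \<delta>' m'] by auto
    from edge_law[OF this]
    show "prob_space (edge_input z) \<and> sets (edge_input z) = sets borel
        \<and> F_edge (fst z) \<in> borel_measurable borel"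
      by (simp add: z(1) edge_input_def)
  qed simp
  also have "BP_node (llr m0) (map (\<lambda>(\<delta>, m). (\<delta>, llr m)) xs)
      = llr (foldl combine m0 (map (\<lambda>(\<delta>, m). scale (1 - 2 * \<delta>) m) xs))"
    using snoc by auto
  also have "distr (edge_input (\<delta>, llr m)) borel (F_edge \<delta>) = llr (scale (1 - 2 * \<delta>) m)"
    using edge_law(1)[OF m] by (simp add: edge_input_def)
  also have "distr (llr (foldl combine m0 (map (\<lambda>(\<delta>, m). scale (1 - 2 * \<delta>) m) xs)) \<Otimes>\<^sub>M llr (scale (1
      - 2 * \<delta>) m)) borel (\<lambda>(r, s). r + s)
    = llr (combine (foldl combine m0 (map (\<lambda>(\<delta>, m). scale (1 - 2 * \<delta>) m) xs)) (scale (1 - 2 * \<delta>) m))"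
  proof (rule llr_convolution)
    show "posterior_law (foldl combine m0 (map (\<lambda>(\<delta>, m). scale (1 - 2 * \<delta>) m) xs))"
      using snoc.prems by (intro posterior_law_foldl_combine assms(1)) (force intro!: posterior_law_scale)
    show "posterior_law (scale (1 - 2 * \<delta>) m)" using m by (intro posterior_law_scale) auto
  qed
  finally show ?case by (simp add: x)
qed

lemma posterior_BP_tree:
  assumes "posterior_law m" "element_tree T"
  shows "posterior_law (posterior_BP T m)" "BP_tree T (llr m) = llr (posterior_BP T m)"
proof -
  have "posterior_law (posterior_BP T m) \<and> BP_tree T (llr m) = llr (posterior_BP T m)"
    using assms(2)
  proof (induction T rule: element_tree.induct)
    case 1
    then show ?case using assms(1) by simp
  next
    case (2 s cs)
    have s: "LLR_dist s" using 2 by (auto intro: symmetric_dist_imp_LLR_dist)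
    note ps = posterior_law_posterior[OF s]
    define xs where "xs = map (\<lambda>(\<delta>, T). (\<delta>, posterior_BP T m)) cs"
    have c: "0 \<le> \<delta> \<and> \<delta> \<le> 1 \<and> \<bar>1 - 2 * \<delta>\<bar> \<le> 1 \<and> posterior_law (posterior_BP T m) \<and> BP_tree T (llr m)
        = llr (posterior_BP T m)"
      if "(\<delta>, T) \<in> set cs" for \<delta> T
      using 2 that by (auto simp: abs_le_iff)
    then have xs: "0 \<le> \<delta> \<and> \<delta> \<le> 1 \<and> posterior_law m'" if "(\<delta>, m') \<in> set xs" for \<delta> m'
      using that by (auto simp: xs_def)
    have "BP_tree (Node s cs) (llr m) = BP_node (llr (posterior s)) (map (\<lambda>(\<delta>, m). (\<delta>, llr m)) xs)"
      using c by (auto simp: xs_def ps(2) intro!: arg_cong[where f="BP_node s"])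
    also have "\<dots> = llr (foldl combine (posterior s) (map (\<lambda>(\<delta>, m). scale (1 - 2 * \<delta>) m) xs))"
      by (rule BP_node_llr[OF ps(1) xs])
    also have "map (\<lambda>(\<delta>, m). scale (1 - 2 * \<delta>) m) xs
        = map (\<lambda>(\<delta>, T). scale (1 - 2 * \<delta>) (posterior_BP T m)) cs"
      by (simp add: xs_def case_prod_unfold)
    finally have "BP_tree (Node s cs) (llr m) = llr (posterior_BP (Node s cs) m)" by simp
    moreover have "posterior_law (posterior_BP (Node s cs) m)"
      using c by (auto intro!: posterior_law_foldl_combine ps posterior_law_scale)
    ultimately show ?case by blast
  qed
  then show "posterior_law (posterior_BP T m)" "BP_tree T (llr m) = llr (posterior_BP T m)" by auto
qed

section \<open>Measurability of the BP operator\<close>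

definition rectangle :: "ereal measure set \<Rightarrow> (real set \<times> etree set) list \<Rightarrow> etree set" where
  "rectangle S DCs = {Node s cs | s cs. s \<in> S \<and> list_all2 (\<lambda>(\<delta>, T) (D, C). \<delta> \<in> D \<and> T \<in> C) cs DCs}"

lemma rectangle_in:
  "S \<in> sets (prob_algebra borel) \<Longrightarrow> (\<And>D C. (D, C) \<in> set DCs \<Longrightarrow> D \<in> sets borel \<and> C \<in> etree_rectangles)
    \<Longrightarrow> rectangle S DCs \<in> etree_rectangles"
  unfolding rectangle_def by (rule etree_rectangles.intros(2)) auto

lemma Node_in_rectangle:
  "Node s cs \<in> rectangle S DCs \<longleftrightarrow> s \<in> S \<and> length cs = length DCs \<and>
    (\<forall>i<length cs. fst (cs ! i) \<in> fst (DCs ! i) \<and> snd (cs ! i) \<in> snd (DCs ! i))"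
  unfolding rectangle_def by (auto simp: list_all2_conv_all_nth case_prod_unfold)

lemma Growing_notin_rectangle: "Growing \<notin> rectangle S DCs"
  by (simp add: rectangle_def)

text \<open>A rectangle constrains every child. To constrain a single one, the others must range
  over rectangles that together exhaust the element trees; one for each shape suffices, and there
  are only countably many shapes.\<close>

datatype shape = Leaf | Branch "shape list"

instance shape :: countable
  by countable_datatype

fun shape_of :: "etree \<Rightarrow> shape" where
  "shape_of Growing = Leaf"
| "shape_of (Node s cs) = Branch (map (\<lambda>(\<delta>, T). shape_of T) cs)"

fun shape_set :: "shape \<Rightarrow> etree set" where
  "shape_set Leaf = {Growing}"
| "shape_set (Branch ss) = rectangle (space (prob_algebra borel)) (map (\<lambda>\<sigma>. (UNIV, shape_set \<sigma>)) ss)"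

lemma shape_set_in: "shape_set \<sigma> \<in> etree_rectangles"
proof (induction \<sigma> rule: shape_set.induct)
  case 1
  then show ?case by (simp add: etree_rectangles.intros)
next
  case (2 ss)
  then show ?case by (auto intro!: rectangle_in)
qed

lemma symmetric_dist_in_prob_algebra: "symmetric_dist s \<Longrightarrow> s \<in> space (prob_algebra borel)"
  by (auto simp: symmetric_dist_def distribution_gt_MInf_def space_prob_algebra)

lemma in_shape_set: "element_tree T \<Longrightarrow> T \<in> shape_set (shape_of T)"
proof (induction T rule: element_tree.induct)
  case (2 s cs)
  have "snd (cs ! i) \<in> shape_set (shape_of (snd (cs ! i)))" if "i < length cs" for i
  proof (rule 2(1))
    show "cs ! i \<in> set cs" "(fst (cs ! i), snd (cs ! i)) = cs ! i" using that by auto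
    then show "element_tree (snd (cs ! i))" using 2(2) by (auto simp: case_prod_unfold)
  qed
  then show ?case using 2(2)
      by (simp add: Node_in_rectangle symmetric_dist_in_prob_algebra case_prod_unfold)
qed simp

lemma space_etree_space: "space etree_space = {T. element_tree T}"
  by (simp add: etree_space_def space_restrict_space)

lemma rectangle_sets: "A \<in> etree_rectangles \<Longrightarrow> A \<inter> space etree_space \<in> sets etree_space"
  unfolding etree_space_def by (auto simp: sets_restrict_space space_restrict_space)

definition survey :: "etree \<Rightarrow> ereal measure" where
  "survey T = (case T of Growing \<Rightarrow> return borel 0 | Node s cs \<Rightarrow> s)"

definition children :: "etree \<Rightarrow> (real \<times> etree) list" where
  "children T = (case T of Growing \<Rightarrow> [] | Node s cs \<Rightarrow> cs)"

definition nodes :: "nat \<Rightarrow> etree set" where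
  "nodes n = {T. element_tree T \<and> T \<noteq> Growing \<and> length (children T) = n}"

text \<open>The guard \<open>j < n\<close> lets the choice j = n express a condition on the survey
  distribution alone.\<close>

lemma nodes_sets_rectangle:
  assumes S: "S \<in> sets (prob_algebra borel)" and D: "D \<in> sets borel" and C: "C \<in> etree_rectangles"
  shows "{T \<in> nodes n. survey T \<in> S \<and> (j < n \<longrightarrow> fst (children T ! j) \<in> D
      \<and> snd (children T ! j) \<in> C)} \<in> sets etree_space"
proof -
  define R where "R ss = rectangle S (map (\<lambda>i. (if i = j then D else UNIV, if i
      = j then C else shape_set (ss ! i))) [0..<n])"
    for ss :: "shape list"
  have "R ss \<in> etree_rectangles" for ss
    unfolding R_def using D C by (intro rectangle_in S) (auto simp: shape_set_in)
  then have "(\<Union>ss. R ss \<inter> space etree_space) \<in> sets etree_space"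
    by (intro sets.countable_UN'' rectangle_sets) auto
  also have "(\<Union>ss. R ss \<inter> space etree_space)
    = {T \<in> nodes n. survey T \<in> S \<and> (j < n \<longrightarrow> fst (children T ! j) \<in> D \<and> snd (children T ! j) \<in> C)}"
        (is "?L = ?R")
  proof
    show "?L \<subseteq> ?R"
    proof
      fix T assume "T \<in> ?L"
      then obtain ss where T: "T \<in> R ss" "element_tree T" by (auto simp: space_etree_space)
      then show "T \<in> ?R"
        by (cases T) (auto simp: R_def Growing_notin_rectangle Node_in_rectangle nodes_def survey_def children_def)
    qed
    show "?R \<subseteq> ?L"
    proof
      fix T assume T: "T \<in> ?R"
      then obtain s cs where Tn: "T = Node s cs" by (cases T) (auto simp: nodes_def)
      have cs: "element_tree (snd (cs ! i))" if "i < length cs" for i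
        using T nth_mem[OF that] by (auto simp: Tn nodes_def case_prod_unfold)
      have "T \<in> R (map (\<lambda>x. shape_of (snd x)) cs)"
        using T cs by (auto simp: R_def Tn Node_in_rectangle nodes_def survey_def children_def in_shape_set)
      then show "T \<in> ?L" using T by (auto simp: space_etree_space nodes_def)
    qed
  qed
  finally show ?thesis .
qed

lemma nodes_sets:
  assumes S: "S \<in> sets (prob_algebra borel)" and D: "D \<in> sets borel"
  shows "{T \<in> nodes n. survey T \<in> S \<and> (j < n \<longrightarrow> fst (children T ! j) \<in> D)} \<in> sets etree_space"
proof -
  let ?A = "\<lambda>\<sigma>. {T \<in> nodes n. survey T \<in> S \<and> (j < n \<longrightarrow> fst (children T ! j) \<in> D
      \<and> snd (children T ! j) \<in> shape_set \<sigma>)}"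
  have "(\<Union>\<sigma>. ?A \<sigma>) \<in> sets etree_space"
    by (intro sets.countable_UN'' nodes_sets_rectangle S D shape_set_in) auto
  also have "(\<Union>\<sigma>. ?A \<sigma>) = {T \<in> nodes n. survey T \<in> S \<and> (j < n \<longrightarrow> fst (children T ! j) \<in> D)}"
  proof -
    have "element_tree (snd (children T ! j))" if "T \<in> nodes n" "j < n" for T
      using that nth_mem[of j "children T"] by (cases T) (auto
          simp: nodes_def children_def case_prod_unfold)
    then show ?thesis using in_shape_set by blast
  qed
  finally show ?thesis .
qed

lemma survey_in: "T \<in> nodes n \<Longrightarrow> survey T \<in> space (prob_algebra borel)"
  by (cases T) (auto simp: nodes_def survey_def symmetric_dist_in_prob_algebra)

lemma child_in:
  "T \<in> nodes n \<Longrightarrow> j < n \<Longrightarrow> 0 \<le> fst (children T ! j) \<and> fst (children T ! j) \<le> 1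
      \<and> element_tree (snd (children T ! j))"
  using nth_mem[of j "children T"] by (cases T) (auto simp: nodes_def children_def case_prod_unfold)

lemma nodes_in_sets: "nodes n \<in> sets etree_space"
proof -
  have "{T \<in> nodes n. survey T \<in> space (prob_algebra borel) \<and> (n < n
      \<longrightarrow> fst (children T ! n) \<in> UNIV)} \<in> sets etree_space"
    by (rule nodes_sets) auto
  also have "{T \<in> nodes n. survey T \<in> space (prob_algebra borel) \<and> (n < n
      \<longrightarrow> fst (children T ! n) \<in> UNIV)} = nodes n"
    using survey_in by auto
  finally show ?thesis .
qed

lemma space_nodes: "space (restrict_space etree_space (nodes n)) = nodes n"
  by (auto simp: space_restrict_space space_etree_space nodes_def)

lemma nodes_restrict_setsI:
  assumes "{T \<in> nodes n. Q T} \<in> sets etree_space"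
  shows "{T \<in> nodes n. Q T} \<in> sets (restrict_space etree_space (nodes n))"
  using assms nodes_in_sets[of n] sets.sets_into_space[OF nodes_in_sets[of n]]
  by (subst sets_restrict_space_iff) (auto simp: Int_absorb2)

lemma measurable_survey: "survey \<in> restrict_space etree_space (nodes n) \<rightarrow>\<^sub>M prob_algebra borel"
proof (rule measurableI)
  fix T assume "T \<in> space (restrict_space etree_space (nodes n))"
  then show "survey T \<in> space (prob_algebra borel)" using survey_in by (auto simp: space_nodes)
next
  fix S :: "ereal measure set" assume S: "S \<in> sets (prob_algebra borel)"
  have "{T \<in> nodes n. survey T \<in> S \<and> (n < n
      \<longrightarrow> fst (children T ! n) \<in> UNIV)} \<in> sets (restrict_space etree_space (nodes n))"
    by (intro nodes_restrict_setsI nodes_sets S) auto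
  also have "{T \<in> nodes n. survey T \<in> S \<and> (n < n \<longrightarrow> fst (children T ! n) \<in> UNIV)}
    = survey -` S \<inter> space (restrict_space etree_space (nodes n))"
    by (auto simp: space_nodes)
  finally show "survey -` S \<inter> space (restrict_space etree_space (nodes n)) \<in> sets (restrict_space etree_space (nodes n))" .
qed

lemma measurable_edge:
  assumes j: "j < n"
  shows "(\<lambda>T. fst (children T ! j)) \<in> borel_measurable (restrict_space etree_space (nodes n))"
proof (rule measurableI)
  fix D :: "real set" assume D: "D \<in> sets borel"
  have "{T \<in> nodes n. survey T \<in> space (prob_algebra borel) \<and> (j < n \<longrightarrow> fst (children T ! j) \<in> D)}
      \<in> sets (restrict_space etree_space (nodes n))"
    by (intro nodes_restrict_setsI nodes_sets D) auto
  also have "{T \<in> nodes n. survey T \<in> space (prob_algebra borel) \<and> (j < n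
      \<longrightarrow> fst (children T ! j) \<in> D)}
    = (\<lambda>T. fst (children T ! j)) -` D \<inter> space (restrict_space etree_space (nodes n))"
    using j survey_in by (auto simp: space_nodes)
  finally show "(\<lambda>T. fst (children T ! j)) -` D \<inter> space (restrict_space etree_space (nodes n))
    \<in> sets (restrict_space etree_space (nodes n))" .
qed simp

lemma measurable_child:
  assumes j: "j < n"
  shows "(\<lambda>T. snd (children T ! j)) \<in> restrict_space etree_space (nodes n) \<rightarrow>\<^sub>M etree_space"
proof -
  let ?f = "\<lambda>T. snd (children T ! j)" and ?M = "restrict_space etree_space (nodes n)"
  have "?f \<in> ?M \<rightarrow>\<^sub>M restrict_space (sigma UNIV etree_rectangles) {T. element_tree T}"
  proof (rule measurable_restrict_space2)
    show "?f \<in> space ?M \<rightarrow> {T. element_tree T}" using child_in j by (auto simp: space_nodes)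
    show "?f \<in> ?M \<rightarrow>\<^sub>M sigma UNIV etree_rectangles"
    proof (rule measurable_measure_of)
      fix C assume C: "C \<in> etree_rectangles"
      have "{T \<in> nodes n. survey T \<in> space (prob_algebra borel) \<and> (j < n
          \<longrightarrow> fst (children T ! j) \<in> UNIV \<and> snd (children T ! j) \<in> C)}
          \<in> sets ?M"
        by (intro nodes_restrict_setsI nodes_sets_rectangle C) auto
      also have "{T \<in> nodes n. survey T \<in> space (prob_algebra borel) \<and> (j < n
          \<longrightarrow> fst (children T ! j) \<in> UNIV \<and> snd (children T ! j) \<in> C)}
        = ?f -` C \<inter> space ?M"
        using j survey_in by (auto simp: space_nodes)
      finally show "?f -` C \<inter> space ?M \<in> sets ?M" .
    qed auto
  qed
  then show ?thesis by (simp add: etree_space_def)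
qed

text \<open>Trees of bounded depth allow an induction on the depth; every tree is the eventual value of its truncations.\<close>

fun truncate_tree :: "nat \<Rightarrow> etree \<Rightarrow> etree" where
  "truncate_tree 0 T = Growing"
| "truncate_tree (Suc d) Growing = Growing"
| "truncate_tree (Suc d) (Node s cs) = Node s (map (\<lambda>(\<delta>, T). (\<delta>, truncate_tree d T)) cs)"

text \<open>The sum over the children dominates the height of each of them, which is what
  \<open>truncate_tree_id\<close> asks for.\<close>

fun tree_height :: "etree \<Rightarrow> nat" where
  "tree_height Growing = 0"
| "tree_height (Node s cs) = Suc (\<Sum>(\<delta>, T) \<leftarrow> cs. tree_height T)"

lemma truncate_tree_id: "tree_height T \<le> d \<Longrightarrow> truncate_tree d T = T"
proof (induction d T rule: truncate_tree.induct)
  case (1 T)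
  then show ?case by (cases T) auto
next
  case (3 d s cs)
  have "truncate_tree d T = T" if "(\<delta>, T) \<in> set cs" for \<delta> T
  proof -
    have "tree_height T \<in> set (map (\<lambda>(\<delta>, T). tree_height T) cs)" using that by force
    then have "tree_height T \<le> (\<Sum>(\<delta>, T) \<leftarrow> cs. tree_height T)" by (rule member_le_sum_list) simp
    then show ?thesis using 3 that by auto
  qed
  then have "map (\<lambda>(\<delta>, T). (\<delta>, truncate_tree d T)) cs = cs" by (intro map_idI) auto
  then show ?case by simp
qed auto

lemma element_tree_truncate: "element_tree T \<Longrightarrow> element_tree (truncate_tree d T)"
  by (induction d T rule: truncate_tree.induct) auto

text \<open>The complement is given by a definite description. Writing the edge law through
  integrals against \<mu> alone, with the mass missing from the finite part placed at -\<infinity>,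
  makes its measurability in \<delta> and \<mu> visible.\<close>

lemma emeasure_edge_law:
  assumes \<mu>: "LLR_dist \<mu>" and \<delta>: "0 \<le> \<delta>" "\<delta> \<le> 1" and A[measurable]: "A \<in> sets borel"
  defines "h \<equiv> \<lambda>r. indicator A (bias_llr ((1 - 2 * \<delta>) * bias r)) :: ennreal"
  shows "emeasure (distr (edge_input (\<delta>, \<mu>)) borel (F_edge \<delta>)) A
    = ennreal (1 - \<delta>) * (\<integral>\<^sup>+ r. h r \<partial>\<mu>)
      + ennreal \<delta> * ((\<integral>\<^sup>+ r. exp_neg r * (h r * indicator (- {- \<infinity>}) r) \<partial>\<mu>)
        + h (- \<infinity>) * (1 - (\<integral>\<^sup>+ r. exp_neg r * indicator (- {- \<infinity>}) r \<partial>\<mu>)))"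
proof -
  have s[measurable_cong]: "sets \<mu> = sets borel" using \<mu> by (auto
      simp: LLR_dist_def distribution_gt_MInf_def)
  note C = nn_integral_complement[OF \<mu>]
  have cs[measurable_cong]: "sets (complement \<mu>) = sets borel" and cp: "prob_space (complement \<mu>)"
    using C(2,3)[of "\<lambda>_. 0"] by auto
  interpret C: prob_space "complement \<mu>" by (rule cp)
  have csp: "space (complement \<mu>) = UNIV" using sets_eq_imp_space_eq[OF cs] by simp
  have hm[measurable]: "h \<in> borel_measurable borel" unfolding h_def by measurable
  have split: "(\<integral>\<^sup>+ r. g r \<partial>complement \<mu>)
    = (\<integral>\<^sup>+ r. exp_neg r * (g r * indicator (- {- \<infinity>}) r)
        \<partial>\<mu>) + g (- \<infinity>) * emeasure (complement \<mu>) {- \<infinity>}"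
    if [measurable]: "g \<in> borel_measurable borel" for g
  proof -
    have "(\<integral>\<^sup>+ r. g r \<partial>complement \<mu>)
      = (\<integral>\<^sup>+ r. g r * indicator (- {- \<infinity>}) r + g (- \<infinity>) * indicator {- \<infinity>} r \<partial>complement \<mu>)"
      by (intro nn_integral_cong) (auto simp: indicator_def)
    also have "\<dots> = (\<integral>\<^sup>+ r. g r * indicator (- {- \<infinity>}) r
        \<partial>complement \<mu>) + g (- \<infinity>) * emeasure (complement \<mu>) {- \<infinity>}"
      by (subst nn_integral_add) (auto simp: cs nn_integral_cmult_indicator)
    also have "(\<integral>\<^sup>+ r. g r * indicator (- {- \<infinity>}) r \<partial>complement \<mu>)
      = (\<integral>\<^sup>+ r. exp_neg r * (g r * indicator (- {- \<infinity>}) r) \<partial>\<mu>)"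
      by (rule C(1)) auto
    finally show ?thesis .
  qed
  have "1 = (\<integral>\<^sup>+ r. exp_neg r * indicator (- {- \<infinity>}) r \<partial>\<mu>) + emeasure (complement \<mu>) {- \<infinity>}"
    using split[of "\<lambda>_. 1"] C.emeasure_space_1 csp by simp
  moreover have "(\<integral>\<^sup>+ r. exp_neg r * indicator (- {- \<infinity>}) r \<partial>\<mu>) \<noteq> \<top>"
    using calculation by (metis ennreal_add_eq_top ennreal_one_neq_top)
  ultimately have null: "emeasure (complement \<mu>) {- \<infinity>}
      = 1 - (\<integral>\<^sup>+ r. exp_neg r * indicator (- {- \<infinity>}) r \<partial>\<mu>)"
    by (metis ennreal_add_diff_cancel_left)
  have F: "F_edge \<delta> r = bias_llr ((1 - 2 * \<delta>) * bias r)" for r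
    using F_edge_bias_llr[OF \<delta> bias_bound, of r] by (simp add: bias_llr_bias)
  have sm[measurable_cong]: "sets (edge_input (\<delta>, \<mu>)) = sets borel"
    unfolding edge_input_def by (simp add: sets_mixture s cs)
  have Fm: "F_edge \<delta> \<in> borel_measurable (edge_input (\<delta>, \<mu>))" unfolding F by measurable
  have "emeasure (distr (edge_input (\<delta>, \<mu>)) borel (F_edge \<delta>)) A = (\<integral>\<^sup>+ r. indicator A (F_edge \<delta> r)
      \<partial>edge_input (\<delta>, \<mu>))"
    using nn_integral_distr[OF Fm, of "indicator A"] by simp
  also have "\<dots> = (\<integral>\<^sup>+ r. h r \<partial>mixture \<delta> \<mu> (complement \<mu>))"
    by (simp add: h_def F edge_input_def)
  also have "\<dots> = ennreal (1 - \<delta>) * (\<integral>\<^sup>+ r. h r \<partial>\<mu>) + ennreal \<delta> * (\<integral>\<^sup>+ r. h r \<partial>complement \<mu>)"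
    by (rule nn_integral_mixture[OF s cs hm])
  finally show ?thesis unfolding split[OF hm] null .
qed

lemma edge_input_prob:
  assumes "LLR_dist \<mu>" "0 \<le> \<delta>" "\<delta> \<le> 1"
  shows "prob_space (edge_input (\<delta>, \<mu>))" "sets (edge_input (\<delta>, \<mu>)) = sets borel"
      "F_edge \<delta> \<in> borel_measurable borel"
  using edge_law[OF posterior_law_posterior(1)[OF assms(1)] assms(2,3)] posterior_law_posterior(2)[OF assms(1)]
  by (auto simp: edge_input_def)

lemma measurable_edge_law:
  assumes K: "K \<in> M \<rightarrow>\<^sub>M prob_algebra borel" and d[measurable]: "d \<in> borel_measurable M"
    and LLR: "\<And>x. x \<in> space M \<Longrightarrow> LLR_dist (K x)" and d01: "\<And>x. x \<in> space M \<Longrightarrow> 0 \<le> d x \<and> d x \<le> 1"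
  shows "(\<lambda>x. distr (edge_input (d x, K x)) borel (F_edge (d x))) \<in> M \<rightarrow>\<^sub>M prob_algebra borel"
proof (rule measurable_prob_algebraI)
  have Ks[measurable]: "K \<in> M \<rightarrow>\<^sub>M subprob_algebra borel" by (rule measurable_prob_algebraD[OF K])
  have p: "prob_space (distr (edge_input (d x, K x)) borel (F_edge (d x)))" if "x \<in> space M" for x
    using edge_input_prob[OF LLR[OF that], of "d x"] d01[OF that]
    by (intro prob_space.prob_space_distr) (auto cong: measurable_cong_sets)
  then show "prob_space (distr (edge_input (d x, K x)) borel (F_edge (d x)))" if "x \<in> space M" for x
    using that .
  show "(\<lambda>x. distr (edge_input (d x, K x)) borel (F_edge (d x))) \<in> M \<rightarrow>\<^sub>M subprob_algebra borel"
  proof (rule measurable_subprob_algebra)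
    show "subprob_space (distr (edge_input (d x, K x)) borel (F_edge (d x)))" if "x \<in> space M" for x
      using p[OF that] by (rule prob_space_imp_subprob_space)
    fix A :: "ereal set" assume A[measurable]: "A \<in> sets borel"
    have "(\<lambda>x. ennreal (1 - d x) * (\<integral>\<^sup>+ r. indicator A (bias_llr ((1 - 2 * d x) * bias r)) \<partial>K x)
      + ennreal (d x) * ((\<integral>\<^sup>+ r. exp_neg r * (indicator A (bias_llr ((1 - 2 * d x) * bias r)) * indicator (- {- \<infinity>}) r) \<partial>K x)
        + indicator A (bias_llr ((1 - 2 * d x) * bias (- \<infinity>))) * (1 - (\<integral>\<^sup>+ r. exp_neg r * indicator (- {- \<infinity>}) r \<partial>K x))))
      \<in> borel_measurable M"
    proof -
      have [measurable]: "(\<lambda>x. \<integral>\<^sup>+ r. indicator A (bias_llr ((1 - 2 * d x) * bias r))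
          \<partial>K x) \<in> borel_measurable M"
        "(\<lambda>x. \<integral>\<^sup>+ r. exp_neg r * (indicator A (bias_llr ((1 - 2 * d x) * bias r)) * indicator (- {-
            \<infinity>}) r) \<partial>K x) \<in> borel_measurable M"
        "(\<lambda>x. \<integral>\<^sup>+ r. exp_neg r * indicator (- {- \<infinity>}) r \<partial>K x) \<in> borel_measurable M"
        by (intro nn_integral_measurable_subprob_algebra2[OF _ Ks]; measurable)+
      show ?thesis by measurable
    qed
    then show "(\<lambda>x. emeasure (distr (edge_input (d x, K x)) borel (F_edge (d x))) A) \<in> borel_measurable M"
      using d01 by (subst measurable_cong[OF emeasure_edge_law[OF LLR _ _ A]]) auto
  qed simp
qed

lemma LLR_dist_BP_tree:
  assumes "posterior_law m" "element_tree T"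
  shows "LLR_dist (BP_tree T (llr m))"
  using posterior_BP_tree[OF assms] LLR_dist_llr by simp

text \<open>The depth bound makes the kernels of the children available by induction. On the trees
  with exactly n children, the node law is obtained by convolving in one edge at a time, which is a
  measurable operation on kernels.\<close>

lemma measurable_BP_truncate:
  assumes m: "posterior_law m"
  shows "(\<lambda>T. BP_tree (truncate_tree d T) (llr m)) \<in> etree_space \<rightarrow>\<^sub>M prob_algebra borel"
proof (induction d)
  have l: "llr m \<in> space (prob_algebra borel)"
    using LLR_dist_llr[OF m] by (auto
        simp: LLR_dist_def distribution_gt_MInf_def space_prob_algebra)
  case 0
  then show ?case using l by simp
next
  case (Suc d)
  note IH = Suc.IH
  let ?f = "\<lambda>T. BP_tree (truncate_tree (Suc d) T) (llr m)" and ?g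
      = "\<lambda>T. BP_tree (truncate_tree d T) (llr m)"
  have l: "llr m \<in> space (prob_algebra borel)"
    using LLR_dist_llr[OF m] by (auto
        simp: LLR_dist_def distribution_gt_MInf_def space_prob_algebra)
  show ?case
  proof (rule measurable_piecewise_restrict[where C="insert {Growing} (range nodes)"])
    show "\<Omega> \<inter> space etree_space \<in> sets etree_space" if "\<Omega> \<in> insert {Growing} (range nodes)" for \<Omega>
      using that rectangle_sets[OF etree_rectangles.intros(1)] nodes_in_sets by auto
    show "space etree_space \<subseteq> \<Union> (insert {Growing} (range nodes))"
      by (auto simp: space_etree_space nodes_def)
    fix \<Omega> assume "\<Omega> \<in> insert {Growing} (range nodes)"
    then consider "\<Omega> = {Growing}" | n where "\<Omega> = nodes n" by auto
    then show "?f \<in> restrict_space etree_space \<Omega> \<rightarrow>\<^sub>M prob_algebra borel"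
    proof cases
      case 1
      then have "?f \<in> restrict_space etree_space \<Omega> \<rightarrow>\<^sub>M prob_algebra borel
        \<longleftrightarrow> (\<lambda>_. llr m) \<in> restrict_space etree_space \<Omega> \<rightarrow>\<^sub>M prob_algebra borel"
        by (intro measurable_cong) (auto simp: space_restrict_space)
      then show ?thesis using l by simp
    next
      case 2
      let ?M = "restrict_space etree_space (nodes n)"
      let ?e = "\<lambda>T j. (fst (children T ! j), ?g (snd (children T ! j)))"
      have LLR: "LLR_dist (?g (snd (children T ! j)))" if "T \<in> nodes n" "j < n" for T j
        using child_in[OF that] by (intro LLR_dist_BP_tree m element_tree_truncate) auto
      have "k \<le> n \<Longrightarrow> (\<lambda>T. BP_node (survey T) (map (?e T) [0..<k])) \<in> ?M \<rightarrow>\<^sub>M prob_algebra borel" for k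
      proof (induction k)
        case 0
        have "(\<lambda>T. BP_node (survey T) (map (?e T) [0..<0])) \<in> ?M \<rightarrow>\<^sub>M prob_algebra borel
          \<longleftrightarrow> survey \<in> ?M \<rightarrow>\<^sub>M prob_algebra borel"
          using survey_in by (intro measurable_cong) (auto
              simp: space_nodes space_prob_algebra intro!: BP_node_Nil)
        then show ?case using measurable_survey by simp
      next
        case (Suc k)
        then have k: "k < n" by simp
        let ?E = "\<lambda>T. distr (edge_input (?e T k)) borel (F_edge (fst (?e T k)))"
        let ?B = "\<lambda>T. BP_node (survey T) (map (?e T) [0..<k])"
        have "BP_node (survey T) (map (?e T) [0..<Suc k])
            = distr (?B T \<Otimes>\<^sub>M ?E T) borel (\<lambda>(r, s). r + s)"
          if T: "T \<in> nodes n" for T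
        proof -
          have "BP_node (survey T) (map (?e T) [0..<k] @ [?e T k])
              = distr (?B T \<Otimes>\<^sub>M ?E T) borel (\<lambda>(r, s). r + s)"
          proof (rule BP_node_snoc)
            show "prob_space (survey T)" "sets (survey T) = sets borel"
              using survey_in[OF T] by (auto simp: space_prob_algebra)
            fix x assume "x \<in> set (map (?e T) [0..<k] @ [?e T k])"
            then have "x \<in> ?e T ` {0..<Suc k}" by auto
            then obtain j where "x = ?e T j" "j \<in> {0..<Suc k}" by (rule imageE)
            then have j: "j < n" "x = ?e T j" using k by auto
            show "prob_space (edge_input x) \<and> sets (edge_input x) = sets borel
                \<and> F_edge (fst x) \<in> borel_measurable borel"
              using edge_input_prob[OF LLR[OF T j(1)], of "fst (children T ! j)"] child_in[OF T j(1)] by (simp add: j(2))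
          qed
          then show ?thesis by simp
        qed
        then have "(\<lambda>T. BP_node (survey T) (map (?e T) [0..<Suc k])) \<in> ?M \<rightarrow>\<^sub>M prob_algebra borel
          \<longleftrightarrow> (\<lambda>T. distr (?B T \<Otimes>\<^sub>M ?E T) borel (\<lambda>(r, s). r + s)) \<in> ?M \<rightarrow>\<^sub>M prob_algebra borel"
          by (intro measurable_cong) (auto simp: space_nodes)
        moreover have B: "?B \<in> ?M \<rightarrow>\<^sub>M prob_algebra borel" using Suc by simp
        moreover have E: "?E \<in> ?M \<rightarrow>\<^sub>M prob_algebra borel"
          unfolding fst_conv using k LLR child_in
          by (intro measurable_edge_law measurable_compose[OF measurable_child IH] measurable_edge)
            (auto simp: space_nodes)
        moreover have "(\<lambda>T. distr (?B T \<Otimes>\<^sub>M ?E T) borel (\<lambda>(r, s). r + s)) \<in> ?M \<rightarrow>\<^sub>M prob_algebra borel"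
          by (rule measurable_compose[OF measurable_pair_prob[OF B E] measurable_distr_prob_space]) measurable
        ultimately show ?case by blast
      qed
      from this[of n] have "(\<lambda>T. BP_node (survey T) (map (?e T) [0..<n])) \<in> ?M \<rightarrow>\<^sub>M prob_algebra borel" by simp
      moreover have "?f T = BP_node (survey T) (map (?e T) [0..<n])" if Tn: "T \<in> nodes n" for T
      proof -
        obtain s cs where T: "T = Node s cs" "length cs = n" using Tn by (cases T) (auto
            simp: nodes_def children_def)
        have "map (\<lambda>(\<delta>, T). (\<delta>, ?g T)) cs = map (?e T) [0..<n]"
          by (rule nth_equalityI) (auto simp: T children_def case_prod_unfold)
        then show ?thesis by (simp add: T survey_def comp_def case_prod_unfold)
      qed
      ultimately show ?thesis
        unfolding 2 by (subst measurable_cong) (auto simp: space_nodes)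
    qed
  qed simp
qed

lemma measurable_BP_tree:
  assumes m: "posterior_law m"
  shows "(\<lambda>T. BP_tree T (llr m)) \<in> etree_space \<rightarrow>\<^sub>M prob_algebra borel"
proof (rule measurable_prob_algebraI)
  show p: "prob_space (BP_tree T (llr m))" if "T \<in> space etree_space" for T
    using LLR_dist_BP_tree[OF m, of T] that by (auto
        simp: space_etree_space LLR_dist_def distribution_gt_MInf_def)
  show "(\<lambda>T. BP_tree T (llr m)) \<in> etree_space \<rightarrow>\<^sub>M subprob_algebra borel"
  proof (rule measurable_subprob_algebra)
    show "subprob_space (BP_tree T (llr m))" if "T \<in> space etree_space" for T
      using p[OF that] by (rule prob_space_imp_subprob_space)
    show "sets (BP_tree T (llr m)) = sets borel" if "T \<in> space etree_space" for T
      using LLR_dist_BP_tree[OF m, of T] that by (auto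
          simp: space_etree_space LLR_dist_def distribution_gt_MInf_def)
    fix A :: "ereal set" assume A: "A \<in> sets borel"
    show "(\<lambda>T. emeasure (BP_tree T (llr m)) A) \<in> borel_measurable etree_space"
    proof (rule borel_measurable_LIMSEQ_order)
      show "(\<lambda>d. emeasure (BP_tree (truncate_tree d T) (llr m)) A) \<longlonglongrightarrow> emeasure (BP_tree T (llr m)) A"
          for T
      proof (rule tendsto_eventually)
        show "\<forall>\<^sub>F d in sequentially. emeasure (BP_tree (truncate_tree d T) (llr m)) A
            = emeasure (BP_tree T (llr m)) A"
          using eventually_ge_at_top[of "tree_height T"]
              by eventually_elim (simp add: truncate_tree_id)
      qed
      show "(\<lambda>T. emeasure (BP_tree (truncate_tree d T) (llr m)) A) \<in> borel_measurable etree_space"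
          for d
        using measurable_compose[OF measurable_prob_algebraD[OF measurable_BP_truncate[OF m]]
            measurable_emeasure_subprob_algebra[OF A]] .
    qed
  qed
qed

section \<open>The BP operator on posterior laws\<close>

definition posterior_Q :: "etree measure \<Rightarrow> real measure \<Rightarrow> real measure" where
  "posterior_Q P m = posterior (BP P (llr m))"

lemma etree_distributionD:
  assumes "etree_distribution P"
  shows "prob_space P" "sets P = sets etree_space" "AE T in P. element_tree T"
proof -
  show "prob_space P" and s: "sets P = sets etree_space" using assms by (auto
      simp: etree_distribution_def)
  show "AE T in P. element_tree T"
    using sets_eq_imp_space_eq[OF s] by (intro AE_I2) (simp add: space_etree_space)
qed

context
  fixes P assumes P: "etree_distribution P"
begin

lemma BP_kernel:
  assumes "posterior_law m"
  shows "(\<lambda>T. BP_tree T (llr m)) \<in> P \<rightarrow>\<^sub>M prob_algebra borel"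
  using measurable_BP_tree[OF assms] measurable_cong_sets[OF etree_distributionD(2)[OF P] refl]
      by blast

lemma LLR_dist_BP:
  assumes m: "posterior_law m"
  shows "LLR_dist (BP P (llr m))"
proof -
  interpret prob_space P using etree_distributionD[OF P] by simp
  have Pa: "P \<in> space (prob_algebra P)" by (simp add: space_prob_algebra prob_space_axioms)
  note K = BP_kernel[OF m] and Ks = measurable_prob_algebraD[OF BP_kernel[OF m]]
  have LLR: "AE T in P. LLR_dist (BP_tree T (llr m))"
    using etree_distributionD(3)[OF P] by eventually_elim (rule LLR_dist_BP_tree[OF m])
  show ?thesis
    unfolding LLR_dist_def distribution_gt_MInf_def BP_def
  proof (intro conjI)
    show "prob_space (P \<bind> (\<lambda>T. BP_tree T (llr m)))" by (rule prob_space_bind'[OF Pa K])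
    show "sets (P \<bind> (\<lambda>T. BP_tree T (llr m))) = sets borel" by (rule sets_bind'[OF Pa K])
    have "emeasure (P \<bind> (\<lambda>T. BP_tree T (llr m))) {- \<infinity>} = (\<integral>\<^sup>+ T. emeasure (BP_tree T (llr m)) {- \<infinity>}
        \<partial>P)"
      by (rule emeasure_bind_prob_algebra[OF Pa K]) simp
    also have "\<dots> = (\<integral>\<^sup>+ T. 0 \<partial>P)"
      using LLR by (intro nn_integral_cong_AE) (auto
          simp: LLR_dist_def distribution_gt_MInf_def elim!: eventually_mono)
    finally show "emeasure (P \<bind> (\<lambda>T. BP_tree T (llr m))) {- \<infinity>} = 0" by simp
    have "(\<integral>\<^sup>+ r. exp_neg r \<partial>(P \<bind> (\<lambda>T. BP_tree T (llr m)))) = (\<integral>\<^sup>+ T. \<integral>\<^sup>+ r. exp_neg r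
        \<partial>BP_tree T (llr m) \<partial>P)"
      by (rule nn_integral_bind[OF measurable_exp_neg Ks])
    also have "\<dots> \<le> (\<integral>\<^sup>+ T. 1 \<partial>P)"
      using LLR by (intro nn_integral_mono_AE) (auto simp: LLR_dist_def elim!: eventually_mono)
    finally show "(\<integral>\<^sup>+ r. exp_neg r \<partial>(P \<bind> (\<lambda>T. BP_tree T (llr m)))) \<le> 1"
        by (simp add: emeasure_space_1)
  qed
qed

lemma posterior_Q:
  assumes "posterior_law m"
  shows "posterior_law (posterior_Q P m)" "llr (posterior_Q P m) = BP P (llr m)"
  using posterior_law_posterior[OF LLR_dist_BP[OF assms]] by (auto simp: posterior_Q_def)

text \<open>The operator is an average on the LLR side; \<open>slope\<close> carries this over to
  \<open>absdev\<close>, and so order and limit statements about the operator reduce to statements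
  about single trees.\<close>

lemma absdev_posterior_Q:
  assumes m: "posterior_law m"
  shows "integrable P (\<lambda>T. absdev (posterior_BP T m) x y)"
    and "absdev (posterior_Q P m) x y = (LINT T|P. absdev (posterior_BP T m) x y)"
proof -
  interpret prob_space P using etree_distributionD[OF P] by simp
  note Ks[measurable] = measurable_prob_algebraD[OF BP_kernel[OF m]]
  let ?g = "\<lambda>T. LINT r|BP_tree T (llr m). slope x y r"
  have gm: "?g \<in> borel_measurable P"
    using measurable_compose[OF Ks integral_measurable_subprob_algebra[OF slope_measurable]] .
  have AEW: "AE T in P. absdev (posterior_BP T m) x y = \<bar>x - y\<bar> + ?g T"
    using etree_distributionD(3)[OF P]
  proof eventually_elim
    case (elim T)
    show ?case using absdev_eq_integral_llr[OF posterior_BP_tree(1)[OF m elim], of x y] posterior_BP_tree(2)[OF m elim] by simp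
  qed
  have eqg: "absdev (posterior_BP T m) x y = \<bar>x - y\<bar> + ?g T" if "T \<in> space P" for T
    using absdev_eq_integral_llr[OF posterior_BP_tree(1)[OF m], of T x y] posterior_BP_tree(2)[OF m, of T] that
      sets_eq_imp_space_eq[OF etree_distributionD(2)[OF P]] by (simp add: space_etree_space)
  have Wm: "(\<lambda>T. absdev (posterior_BP T m) x y) \<in> borel_measurable P"
    using gm by (subst measurable_cong[OF eqg]) auto
  show int: "integrable P (\<lambda>T. absdev (posterior_BP T m) x y)"
  proof (rule integrable_const_bound[where B="max \<bar>x\<bar> \<bar>y\<bar>", OF _ Wm])
    show "AE T in P. norm (absdev (posterior_BP T m) x y) \<le> max \<bar>x\<bar> \<bar>y\<bar>"
      using etree_distributionD(3)[OF P]
      by eventually_elim (use absdev_le_max[OF posterior_BP_tree(1)[OF m]] absdev_nonneg in auto)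
  qed
  have "absdev (posterior_Q P m) x y = \<bar>x - y\<bar> + (LINT r|BP P (llr m). slope x y r)"
    using absdev_eq_integral_llr[OF posterior_Q(1)[OF m]] posterior_Q(2)[OF m] by simp
  also have "(LINT r|BP P (llr m). slope x y r) = (LINT T|P. ?g T)"
    unfolding BP_def
  proof (rule integral_bind[where K=borel and B="\<bar>y\<bar>" and B'=1])
    show "finite_measure P" by unfold_locales
    show "AE T in P. emeasure (BP_tree T (llr m)) (space (BP_tree T (llr m))) \<le> ennreal 1"
    proof (rule AE_I2)
      fix T assume "T \<in> space P"
      from measurable_space[OF Ks this]
      show "emeasure (BP_tree T (llr m)) (space (BP_tree T (llr m))) \<le> ennreal 1"
        by (simp add: space_subprob_algebra subprob_space.emeasure_space_le_1)
    qed
  qed (auto simp: slope_bound Ks)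
  also have "\<bar>x - y\<bar> + (LINT T|P. ?g T) = (LINT T|P. \<bar>x - y\<bar> + ?g T)"
  proof -
    have "integrable P ?g"
    proof (rule integrable_const_bound[where B="\<bar>x - y\<bar> + max \<bar>x\<bar> \<bar>y\<bar>", OF _ gm])
      show "AE T in P. norm (?g T) \<le> \<bar>x - y\<bar> + max \<bar>x\<bar> \<bar>y\<bar>"
        using AEW etree_distributionD(3)[OF P]
      proof eventually_elim
        case (elim T)
        have "\<bar>g\<bar> \<le> c + b" if "w = c + g" "w \<le> b" "0 \<le> w" "0 \<le> c" for g c b w :: real
          using that by linarith
        from this[OF elim(1) absdev_le_max[OF posterior_BP_tree(1)[OF m elim(2)]] absdev_nonneg]
        show ?case by simp
      qed
    qed
    then show ?thesis by (simp add: prob_space)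
  qed
  also have "\<dots> = (LINT T|P. absdev (posterior_BP T m) x y)"
    using eqg by (intro Bochner_Integration.integral_cong) auto
  finally show "absdev (posterior_Q P m) x y = (LINT T|P. absdev (posterior_BP T m) x y)" .
qed

lemma posterior_Q_power:
  assumes "posterior_law m"
  shows "posterior_law ((posterior_Q P ^^ h) m)" "llr ((posterior_Q P ^^ h) m)
      = (BP P ^^ h) (llr m)"
  using assms by (induction h) (auto simp: posterior_Q)

end

section \<open>Relations preserved by element trees\<close>

lemma symmetric_dist_posterior:
  assumes "symmetric_dist s" shows "sym_law (posterior s)" "LLR_dist s"
  using symmetric_dist_llr_iff[OF posterior_law_posterior(1)[OF symmetric_dist_imp_LLR_dist[OF assms]]]
    posterior_law_posterior(2)[OF symmetric_dist_imp_LLR_dist[OF assms]] assms symmetric_dist_imp_LLR_dist[OF assms]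
  by auto

lemma edge_scale_bound: "0 \<le> \<delta> \<Longrightarrow> \<delta> \<le> 1 \<Longrightarrow> \<bar>1 - 2 * \<delta>\<bar> \<le> (1::real)"
  by auto

text \<open>
  Used with two-element families for relations between laws, and with families over
  \<^typ>\<open>nat option\<close> for a sequence together with its limit.
\<close>

lemma posterior_BP_family:
  fixes R :: "('i \<Rightarrow> real measure) \<Rightarrow> bool"
  assumes T: "element_tree T" and m: "R m"
    and combine: "\<And>a b. R a \<Longrightarrow> R b \<Longrightarrow> R (\<lambda>i. combine (a i) (b i))"
    and scale: "\<And>a s. R a \<Longrightarrow> \<bar>s\<bar> \<le> 1 \<Longrightarrow> R (\<lambda>i. scale s (a i))"
    and surv: "\<And>a. sym_law a \<Longrightarrow> R (\<lambda>i. a)"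
  shows "R (\<lambda>i. posterior_BP T (m i))"
  using T
proof (induction T rule: element_tree.induct)
  case 1
  then show ?case using m by simp
next
  case (2 s cs)
  have foldl: "R (\<lambda>i. foldl combine (m0 i) (map (f i) xs))"
    if "R m0" "\<And>x. x \<in> set xs \<Longrightarrow> R (\<lambda>i. f i x)" for m0 f and xs :: "(real \<times> etree) list"
    using that by (induction xs arbitrary: m0) (auto intro: combine)
  have "R (\<lambda>i. scale (1 - 2 * \<delta>) (posterior_BP T (m i)))" if "(\<delta>, T) \<in> set cs" for \<delta> T
    using 2 that edge_scale_bound[of \<delta>] by (intro scale) auto
  then show ?case
    unfolding posterior_BP.simps using 2(2) symmetric_dist_posterior(1)[of s]
    by (intro foldl surv) auto
qed

lemma sym_law_posterior_BP: "element_tree T \<Longrightarrow> sym_law m \<Longrightarrow> sym_law (posterior_BP T m)"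
  by (rule posterior_BP_family[where R="\<lambda>a. sym_law (a ())" and m="\<lambda>_. m"])
    (assumption | rule sym_law_combine sym_law_scale)+

lemma degraded_posterior_BP:
  assumes "element_tree T" "posterior_law m" "posterior_law m'" "degraded m m'"
  shows "degraded (posterior_BP T m) (posterior_BP T m')"
proof -
  let ?R = "\<lambda>a. posterior_law (a False) \<and> posterior_law (a True) \<and> degraded (a False) (a True)"
  have "?R (\<lambda>i. posterior_BP T (if i then m' else m))"
  proof (rule posterior_BP_family[OF assms(1), where R="?R"])
    show "?R (\<lambda>i. if i then m' else m)" using assms by simp
    show "?R (\<lambda>i. combine (a i) (b i))" if "?R a" "?R b" for a b :: "bool \<Rightarrow> real measure"
      using that by (intro conjI posterior_law_combine degraded_combine) simp_all
    show "?R (\<lambda>i. scale s (a i))" if "?R a" "\<bar>s\<bar> \<le> 1" for a :: "bool \<Rightarrow> real measure" and s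
      using that by (intro conjI posterior_law_scale degraded_scale) simp_all
    show "?R (\<lambda>i. a)" if "sym_law a" for a
      using sym_lawD[OF that] degraded_refl by simp
  qed
  then show ?thesis by simp
qed

text \<open>Convexity together with the lower bound |x| on \<open>absdev\<close>: x + t y a is the
  convex combination t (x + y a) + (1 - t) x.\<close>

lemma degraded_scale_self:
  assumes m: "posterior_law m" "0 \<le> t" "t \<le> 1"
  shows "degraded (scale t m) m"
  unfolding degraded_def absdev_scale[OF m(1)]
proof (intro allI)
  fix x y
  interpret prob_space m using posterior_lawD(1)[OF m(1)] .
  have "absdev m x (t * y) \<le> (LINT a|m. t * \<bar>x + y * a\<bar> + (1 - t) * \<bar>x\<bar>)"
    unfolding absdev_def
  proof (intro integral_mono)
    fix a
    have "x + t * y * a = t * (x + y * a) + (1 - t) * x" by (simp add: algebra_simps)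
    also have "\<bar>\<dots>\<bar> \<le> t * \<bar>x + y * a\<bar> + (1 - t) * \<bar>x\<bar>"
      using m by (intro order.trans[OF abs_triangle_ineq]) (simp add: abs_mult)
    finally show "\<bar>x + t * y * a\<bar> \<le> t * \<bar>x + y * a\<bar> + (1 - t) * \<bar>x\<bar>" .
  qed (use absdev_integrable[OF m(1)] in auto)
  also have "\<dots> = t * absdev m x y + (1 - t) * \<bar>x\<bar>"
    using absdev_integrable[OF m(1), of x y] by (simp add: absdev_def prob_space)
  also have "\<dots> \<le> t * absdev m x y + (1 - t) * absdev m x y"
    using m absdev_ge_abs[OF m(1)] by (intro add_left_mono mult_left_mono) auto
  also have "\<dots> = absdev m x y" by (simp add: algebra_simps)
  finally show "absdev m x (t * y) \<le> absdev m x y" .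
qed

lemma scale_scale:
  assumes "posterior_law m" "\<bar>s\<bar> \<le> 1" "\<bar>t\<bar> \<le> 1"
  shows "scale s (scale t m) = scale t (scale s m)"
  by (intro absdev_unique posterior_law_scale assms) (simp add: absdev_scale posterior_law_scale assms ac_simps)

text \<open>In the induction the \<open>False\<close> component is the tree applied to m, the
  \<open>True\<close> component the tree applied to the scaled input. Symmetry is carried along for
  \<open>stringy_tree\<close>; a survey distribution satisfies the relation because noise
  degrades.\<close>

lemma stringy_posterior_BP:
  assumes T: "element_tree T" and m: "sym_law m" and t: "0 \<le> t" "t \<le> 1"
  shows "degraded (scale t (posterior_BP T m)) (posterior_BP T (scale t m))"
proof -
  let ?R = "\<lambda>a. sym_law (a False) \<and> sym_law (a True) \<and> degraded (scale t (a False)) (a True)"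
  have t': "\<bar>t\<bar> \<le> 1" using t by simp
  have "?R (\<lambda>i. posterior_BP T (if i then scale t m else m))"
  proof (rule posterior_BP_family[OF T, where R="?R"])
    show "?R (\<lambda>i. if i then scale t m else m)" using m t' by (auto
        intro: sym_law_scale degraded_refl)
    show "?R (\<lambda>i. combine (a i) (b i))" if a: "?R a" and b: "?R b" for a b :: "bool \<Rightarrow> real measure"
    proof (intro conjI)
      show "sym_law (combine (a False) (b False))" "sym_law (combine (a True) (b True))"
        using a b by (auto intro: sym_law_combine)
      have "degraded (scale t (combine (a False) (b False))) (combine (scale t (a False)) (scale t (b False)))"
        using a b t by (intro stringy_tree) auto
      moreover have "degraded (combine (scale t (a False)) (scale t (b False))) (combine (a True) (b True))"
        using a b t' by (intro degraded_combine) (auto intro: sym_lawD posterior_law_scale)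
      ultimately show "degraded (scale t (combine (a False) (b False))) (combine (a True) (b True))"
        by (rule degraded_trans)
    qed
    show "?R (\<lambda>i. scale s (a i))" if a: "?R a" and s: "\<bar>s\<bar> \<le> 1" for a :: "bool \<Rightarrow> real measure" and s
    proof (intro conjI)
      have "degraded (scale s (scale t (a False))) (scale s (a True))"
        using a t' by (intro degraded_scale) (auto intro: sym_lawD posterior_law_scale)
      then show "degraded (scale t (scale s (a False))) (scale s (a True))"
        using a s t' by (simp add: scale_scale[of _ t s] sym_lawD)
    qed (use a s in \<open>auto intro: sym_law_scale\<close>)
    show "?R (\<lambda>i. a)" if "sym_law a" for a
      using that t degraded_scale_self sym_lawD by auto
  qed
  then show ?thesis by simp
qed

text \<open>Pointwise convergence of equi-Lipschitz functions on the compact [-1, 1] is uniform. A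
  finite net of mesh r = e / (4 L) costs e / 4 for each of the two laws and leaves e / 2 for the net
  points.\<close>

lemma absdev_uniform_limit:
  assumes a: "\<And>n. posterior_law (a n)" "posterior_law A"
      and lim: "\<And>x y. (\<lambda>n. absdev (a n) x y) \<longlonglongrightarrow> absdev A x y"
    and e: "0 < e"
  shows "\<forall>\<^sub>F n in sequentially. \<forall>b. \<bar>b\<bar> \<le> 1
      \<longrightarrow> \<bar>absdev (a n) (x + y * b) (y + x * b) - absdev A (x + y * b) (y + x * b)\<bar> \<le> e"
proof -
  define L where "L = \<bar>x\<bar> + \<bar>y\<bar> + 1"
  have L: "0 < L" by (simp add: L_def)
  let ?D = "\<lambda>n b. absdev (a n) (x + y * b) (y + x * b) - absdev A (x + y * b) (y + x * b)"
  have lip: "\<bar>absdev m (x + y * b) (y + x * b) - absdev m (x + y * c) (y + x * c)\<bar> \<le> L * \<bar>b - c\<bar>"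
      if "posterior_law m" for m b c
  proof -
    have "\<bar>absdev m (x + y * b) (y + x * b) - absdev m (x + y * c) (y + x * c)\<bar>
        \<le> \<bar>y * (b - c)\<bar> + \<bar>x * (b - c)\<bar>"
      using absdev_diff_le[OF that, of "x + y * b" "y + x * b" "x + y * c" "y + x * c"]
          by (simp add: algebra_simps)
    also have "\<dots> = (\<bar>x\<bar> + \<bar>y\<bar>) * \<bar>b - c\<bar>" by (simp add: abs_mult distrib_right)
    also have "\<dots> \<le> L * \<bar>b - c\<bar>" by (intro mult_right_mono) (auto simp: L_def)
    finally show ?thesis .
  qed
  define r where "r = e / (4 * L)"
  have r: "0 < r" "L * r = e / 4" using e L by (auto simp: r_def)
  obtain K where K: "finite K" "cball (0::real) 1 \<subseteq> (\<Union>c\<in>K. ball c r)"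
  proof -
    have "\<forall>e>0. \<exists>k. finite k \<and> cball (0::real) 1 \<subseteq> (\<Union>x\<in>k. ball x e)"
      using compact_cball[of "0::real" 1] unfolding compact_eq_totally_bounded by (rule conjunct2)
    from this[rule_format, OF r(1)] show thesis by (elim exE conjE) (rule that, assumption+)
  qed
  have "\<forall>\<^sub>F n in sequentially. \<forall>c\<in>K. \<bar>?D n c\<bar> < e / 2"
  proof (rule eventually_ball_finite[OF K(1)], rule ballI)
    fix c
    have "(\<lambda>n. \<bar>?D n c\<bar>) \<longlonglongrightarrow> \<bar>0\<bar>" using lim by (intro tendsto_rabs LIM_zero) auto
    then show "\<forall>\<^sub>F n in sequentially. \<bar>?D n c\<bar> < e / 2" using e by (intro order_tendstoD(2)) auto
  qed
  then show ?thesis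
  proof eventually_elim
    case (elim n)
    show ?case
    proof (intro allI impI)
      fix b :: real assume "\<bar>b\<bar> \<le> 1"
      then have "b \<in> (\<Union>c\<in>K. ball c r)" by (intro subsetD[OF K(2)]) simp
      then obtain c where "c \<in> K" "b \<in> ball c r" by (rule UN_E)
      then have c: "c \<in> K" "\<bar>b - c\<bar> < r" by (simp_all add: dist_real_def abs_minus_commute)
      have "L * \<bar>b - c\<bar> \<le> L * r" using c L by (intro mult_left_mono) auto
      then have "L * \<bar>b - c\<bar> \<le> e / 4" using r(2) by simp
      moreover have "\<bar>?D n c\<bar> < e / 2" using elim c(1) by blast
      ultimately show "\<bar>?D n b\<bar> \<le> e"
        using lip[OF a(1)[of n], of b c] lip[OF a(2), of b c] by linarith
    qed
  qed
qed

text \<open>The first factor is replaced uniformly in its arguments, hence regardless of the moving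
  law \<open>b n\<close>. After that A is fixed, and dominated convergence applies in the other
  order of integration.\<close>

lemma absdev_tendsto_combine:
  assumes a: "\<And>n. posterior_law (a n)" "posterior_law A"
      "\<And>x y. (\<lambda>n. absdev (a n) x y) \<longlonglongrightarrow> absdev A x y"
    and b: "\<And>n. posterior_law (b n)" "posterior_law B" "\<And>x y. (\<lambda>n. absdev (b n) x y) \<longlonglongrightarrow> absdev B x y"
  shows "(\<lambda>n. absdev (combine (a n) (b n)) x y) \<longlonglongrightarrow> absdev (combine A B) x y"
proof -
  have "(\<lambda>n. absdev (combine (a n) (b n)) x y - absdev (combine A (b n)) x y) \<longlonglongrightarrow> 0"
  proof (rule tendstoI)
    fix e :: real assume "0 < e"
    then have "0 < e / 2" by simp
    from absdev_uniform_limit[OF a this, of x y]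
    show "\<forall>\<^sub>F n in sequentially. dist (absdev (combine (a n) (b n)) x y - absdev (combine A (b n)) x y) 0 < e"
    proof eventually_elim
      case (elim n)
      interpret prob_space "b n" using posterior_lawD(1)[OF b(1)] .
      note i = integrable_absdev_boost[OF a(1)[of n] b(1)[of n], of x y] integrable_absdev_boost[OF a(2) b(1)[of n], of x y]
      let ?D = "\<lambda>c. absdev (a n) (x + y * c) (y + x * c) - absdev A (x + y * c) (y + x * c)"
      have "\<bar>LINT c|b n. ?D c\<bar> \<le> (LINT c|b n. \<bar>?D c\<bar>)" by (rule integral_abs_bound)
      also have "\<dots> \<le> (LINT c|b n. e / 2)"
      proof (rule integral_mono_AE)
        show "AE c in b n. \<bar>?D c\<bar> \<le> e / 2" using posterior_lawD(4)[OF b(1)[of n]]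
            by eventually_elim (use elim in auto)
      qed (use i in auto)
      also have "\<dots> = e / 2" by (simp add: prob_space)
      finally show ?case using \<open>0 < e\<close> i
          by (simp add: absdev_combine[OF a(1) b(1)] absdev_combine[OF a(2) b(1)])
    qed
  qed
  moreover have "(\<lambda>n. absdev (combine A (b n)) x y) \<longlonglongrightarrow> absdev (combine A B) x y"
    unfolding absdev_combine'[OF a(2) b(1)] absdev_combine'[OF a(2) b(2)]
  proof (rule integral_dominated_convergence[where w="\<lambda>_. 2 * (\<bar>x\<bar> + \<bar>y\<bar>)"])
    interpret prob_space A using posterior_lawD(1)[OF a(2)] .
    have [measurable_cong]: "sets A = sets borel" using posterior_lawD(2)[OF a(2)] .
    show "(\<lambda>c. absdev (b n) (x + y * c) (y + x * c)) \<in> borel_measurable A" for n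
      by (intro absdev_measurable b borel_measurable_add borel_measurable_times) measurable
    show "(\<lambda>c. absdev B (x + y * c) (y + x * c)) \<in> borel_measurable A"
      by (intro absdev_measurable b borel_measurable_add borel_measurable_times) measurable
    show "AE c in A. (\<lambda>n. absdev (b n) (x + y * c) (y + x * c)) \<longlonglongrightarrow> absdev B (x + y * c) (y + x * c)"
      using b(3) by simp
    show "AE c in A. norm (absdev (b n) (x + y * c) (y + x * c)) \<le> 2 * (\<bar>x\<bar> + \<bar>y\<bar>)" for n
      using posterior_lawD(4)[OF a(2)]
    proof eventually_elim
      case (elim c)
      then have "\<bar>y * c\<bar> \<le> \<bar>y\<bar>" "\<bar>x * c\<bar> \<le> \<bar>x\<bar>" by (auto simp: abs_mult mult_left_le)
      then show ?case
        using absdev_le_max[OF b(1)[of n], of "x + y * c" "y + x * c"] absdev_nonneg[of "b n"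
            "x + y * c" "y + x * c"]
        by (simp add: max_def split: if_splits)
    qed
    show "integrable A (\<lambda>_. 2 * (\<bar>x\<bar> + \<bar>y\<bar>))" by simp
  qed
  ultimately have "(\<lambda>n. (absdev (combine (a n) (b n)) x y - absdev (combine A (b n)) x y) + absdev
      (combine A (b n)) x y) \<longlonglongrightarrow> 0 + absdev (combine A B) x y"
    by (rule tendsto_add)
  then show ?thesis by simp
qed

lemma absdev_tendsto_posterior_BP:
  assumes T: "element_tree T" and a: "\<And>n. posterior_law (a n)" "posterior_law A"
    and lim: "\<And>x y. (\<lambda>n. absdev (a n) x y) \<longlonglongrightarrow> absdev A x y"
  shows "(\<lambda>n. absdev (posterior_BP T (a n)) x y) \<longlonglongrightarrow> absdev (posterior_BP T A) x y"
proof -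
  let ?R = "\<lambda>f. (\<forall>i. posterior_law (f i))
      \<and> (\<forall>x y. (\<lambda>n. absdev (f (Some n)) x y) \<longlonglongrightarrow> absdev (f None) x y)"
  have "?R (\<lambda>i. posterior_BP T (case i of None \<Rightarrow> A | Some n \<Rightarrow> a n))"
  proof (rule posterior_BP_family[OF T, where R="?R"])
    show "?R (\<lambda>i. case i of None \<Rightarrow> A | Some n \<Rightarrow> a n)" using a lim by (simp split: option.split)
    show "?R (\<lambda>i. combine (f i) (g i))" if "?R f" "?R g" for f g :: "nat option \<Rightarrow> real measure"
      using that by (intro conjI allI posterior_law_combine absdev_tendsto_combine) simp_all
    show "?R (\<lambda>i. scale s (f i))" if "?R f" "\<bar>s\<bar> \<le> 1" for f :: "nat option \<Rightarrow> real measure" and s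
      using that by (intro conjI allI posterior_law_scale) (simp_all add: absdev_scale)
    show "?R (\<lambda>i. f)" if "sym_law f" for f
      using sym_lawD[OF that] by simp
  qed
  then show ?thesis by simp
qed

context
  fixes P assumes P: "etree_distribution P"
begin

text \<open>Common form of two uses: t = 1 gives monotonicity of the operator, and m' =
  \<open>scale t m\<close> gives sublinearity.\<close>

lemma posterior_Q_trans:
  assumes "posterior_law m" "posterior_law m'" "\<And>T. element_tree T
      \<Longrightarrow> degraded (scale t (posterior_BP T m)) (posterior_BP T m')"
  shows "degraded (scale t (posterior_Q P m)) (posterior_Q P m')"
  unfolding degraded_def absdev_scale[OF posterior_Q(1)[OF P assms(1)]] absdev_posterior_Q(2)[OF P
      assms(1)] absdev_posterior_Q(2)[OF P assms(2)]
proof (intro allI integral_mono_AE absdev_posterior_Q(1)[OF P] assms(1,2))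
  fix x y
  show "AE T in P. absdev (posterior_BP T m) x (t * y) \<le> absdev (posterior_BP T m') x y"
    using etree_distributionD(3)[OF P]
  proof eventually_elim
    case (elim T)
    show ?case using degradedD[OF assms(3)[OF elim], of x y]
        by (simp add: absdev_scale posterior_BP_tree(1)[OF assms(1) elim])
  qed
qed

lemma degraded_posterior_Q:
  assumes "posterior_law m" "posterior_law m'" "degraded m m'"
  shows "degraded (posterior_Q P m) (posterior_Q P m')"
  using posterior_Q_trans[OF assms(1,2), of 1] degraded_posterior_BP[OF _ assms]
  by (simp add: scale_one posterior_Q(1)[OF P] posterior_BP_tree(1) assms)

lemma stringy_posterior_Q:
  assumes m: "sym_law m" "0 \<le> t" "t \<le> 1"
  shows "degraded (scale t (posterior_Q P m)) (posterior_Q P (scale t m))"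
  using m by (intro posterior_Q_trans stringy_posterior_BP posterior_law_scale) (auto
      intro: sym_lawD)

lemma sym_law_posterior_Q:
  assumes m: "sym_law m"
  shows "sym_law (posterior_Q P m)"
proof -
  note p = sym_lawD[OF m]
  have "absdev (posterior_Q P m) x (- y) = absdev (posterior_Q P m) x y" for x y
    unfolding absdev_posterior_Q(2)[OF P p]
  proof (rule integral_cong_AE)
    show "AE T in P. absdev (posterior_BP T m) x (- y) = absdev (posterior_BP T m) x y"
      using etree_distributionD(3)[OF P]
          by eventually_elim (simp add: sym_law_absdev sym_law_posterior_BP m)
  qed (use absdev_posterior_Q(1)[OF P p] in auto)
  then show ?thesis using sym_law_iff[OF posterior_Q(1)[OF P p]] by blast
qed

lemma absdev_tendsto_posterior_Q:
  assumes a: "\<And>n. posterior_law (a n)" "posterior_law A"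
      "\<And>x y. (\<lambda>n. absdev (a n) x y) \<longlonglongrightarrow> absdev A x y"
  shows "(\<lambda>n. absdev (posterior_Q P (a n)) x y) \<longlonglongrightarrow> absdev (posterior_Q P A) x y"
  unfolding absdev_posterior_Q(2)[OF P a(1)] absdev_posterior_Q(2)[OF P a(2)]
proof (rule integral_dominated_convergence[where w="\<lambda>_. max \<bar>x\<bar> \<bar>y\<bar>"])
  interpret prob_space P using etree_distributionD[OF P] by simp
  show "integrable P (\<lambda>_. max \<bar>x\<bar> \<bar>y\<bar>)" by simp
  show "AE T in P. (\<lambda>n. absdev (posterior_BP T (a n)) x y) \<longlonglongrightarrow> absdev (posterior_BP T A) x y"
    using etree_distributionD(3)[OF P] by eventually_elim (rule absdev_tendsto_posterior_BP[OF _ a])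
  show "AE T in P. norm (absdev (posterior_BP T (a n)) x y) \<le> max \<bar>x\<bar> \<bar>y\<bar>" for n
    using etree_distributionD(3)[OF P]
    by eventually_elim (use absdev_le_max[OF posterior_BP_tree(1)[OF a(1)]] absdev_nonneg in auto)
qed (use absdev_posterior_Q(1)[OF P a(1)] absdev_posterior_Q(1)[OF P a(2)] in auto)

end

section \<open>Uniqueness of the fixed point\<close>

text \<open>Computed from the tree alone, so that different invariants can be attached to the same
  classification. Since the parameters differ from 1/2, no factor becomes 0 and no component turns
  trivial along an edge; factors enter by absolute value because the inputs are symmetric.\<close>

datatype status = Neutral | Linear real | Mixing

fun combine_status :: "status \<Rightarrow> status \<Rightarrow> status" where
  "combine_status Neutral x = x"
| "combine_status x Neutral = x"
| "combine_status _ _ = Mixing"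

fun scale_status :: "real \<Rightarrow> status \<Rightarrow> status" where
  "scale_status s Neutral = Neutral"
| "scale_status s (Linear r) = Linear (s * r)"
| "scale_status s Mixing = Mixing"

fun status_of :: "etree \<Rightarrow> status" where
  "status_of Growing = Linear 1"
| "status_of (Node s cs) = foldl combine_status (if s = trivial_dist then Neutral else Mixing)
     (map (\<lambda>(\<delta>, T). scale_status \<bar>1 - 2 * \<delta>\<bar> (status_of T)) cs)"

text \<open>The factor of a linear tree is a product of numbers |1 - 2 \<delta>| in (0, 1] along the
  path of its growing point. It is 1 only if each of them is, that is if \<delta> = 0 or \<delta> =
  1; this links the status to simple trees.\<close>

lemma status_linear:
  assumes "element_tree T"
  shows "(status_of T = Neutral \<longrightarrow> growing_points T = 0 \<and> trivial_surveys T) \<and>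
    (\<forall>r. status_of T = Linear r \<longrightarrow> growing_points T = 1 \<and> trivial_surveys T \<and> 0 < r \<and> r \<le> 1 \<and>
       (r = 1 \<longrightarrow> growing_paths_01 T))"
  using assms
proof (induction T rule: element_tree.induct)
  case (2 s cs)
  define Q where "Q T \<longleftrightarrow> (status_of T = Neutral \<longrightarrow> growing_points T = 0 \<and> trivial_surveys T) \<and>
    (\<forall>r. status_of T = Linear r \<longrightarrow> growing_points T = 1 \<and> trivial_surveys T \<and> 0 < r \<and> r \<le> 1 \<and>
       (r = 1 \<longrightarrow> growing_paths_01 T))" for T
  have Q: "Q T \<and> 0 \<le> \<delta> \<and> \<delta> \<le> 1 \<and> \<delta> \<noteq> 1/2" if "(\<delta>, T) \<in> set cs" for \<delta> T
    using 2(1)[OF that refl] 2(2) that by (auto simp: Q_def)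
  have "Q (Node s cs)"
    using Q
  proof (induction cs rule: rev_induct)
    case Nil
    then show ?case by (simp add: Q_def)
  next
    case (snoc x cs)
    obtain \<delta> T where x: "x = (\<delta>, T)" by (cases x)
    have T: "Q T" "0 \<le> \<delta>" "\<delta> \<le> 1" "\<delta> \<noteq> 1/2" using snoc.prems[of \<delta> T] by (auto simp: x)
    have IH: "Q (Node s cs)" using snoc.prems by (intro snoc.IH) auto
    define s0 where "s0 = \<bar>1 - 2 * \<delta>\<bar>"
    have s0: "0 < s0" "s0 \<le> 1" "s0 = 1 \<Longrightarrow> \<delta> = 0 \<or> \<delta> = 1" using T by (auto
        simp: s0_def abs_if split: if_splits)
    have st: "status_of (Node s (cs @ [x]))
        = combine_status (status_of (Node s cs)) (scale_status s0 (status_of T))"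
      by (simp add: x s0_def)
    have gp: "growing_points (Node s (cs @ [x])) = growing_points (Node s cs) + growing_points T"
      "trivial_surveys (Node s (cs @ [x])) \<longleftrightarrow> trivial_surveys (Node s cs) \<and> trivial_surveys T"
      "growing_paths_01 (Node s (cs @ [x])) \<longleftrightarrow> growing_paths_01 (Node s cs) \<and> (growing_points T > 0
          \<longrightarrow> \<delta> \<in> {0, 1} \<and> growing_paths_01 T)"
      by (auto simp: x)
    \<comment> \<open>Without growing points the condition on the paths is vacuous.\<close>
    have zero: "growing_paths_01 T'" if "growing_points T' = 0" for T'
      using that by (cases T') (auto simp: sum_list_eq_0_iff)
    show ?case
    proof (cases "status_of (Node s cs)")
      case N1: Neutral
      then have A: "growing_points (Node s cs) = 0" "trivial_surveys (Node s cs)"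
          "growing_paths_01 (Node s cs)"
        using IH zero[of "Node s cs"] by (auto simp: Q_def)
      show ?thesis
      proof (cases "status_of T")
        case Neutral
        then show ?thesis using T(1) A unfolding Q_def st gp N1 Neutral by simp
      next
        case (Linear r)
        then have B: "growing_points T = 1" "trivial_surveys T" "0 < r" "r \<le> 1" "r = 1
            \<longrightarrow> growing_paths_01 T"
          using T(1) by (auto simp: Q_def)
        have "s0 * r = 1 \<Longrightarrow> s0 = 1 \<and> r = 1"
            using s0 B mult_left_le[of r s0] mult_left_le_one_le[of r s0] by auto
        moreover have "0 < s0 * r" "s0 * r \<le> 1" using s0 B by (auto intro: mult_le_one)
        ultimately show ?thesis using A B s0 unfolding Q_def st gp N1 Linear by auto
      next
        case Mixing
        then show ?thesis unfolding Q_def st N1 Mixing by simp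
      qed
    next
      case L1: (Linear r)
      show ?thesis
      proof (cases "status_of T")
        case Neutral
        then have "growing_points T = 0" "trivial_surveys T" using T(1) by (auto simp: Q_def)
        then show ?thesis using IH unfolding Q_def st gp L1 Neutral by auto
      next
        case Linear
        then show ?thesis unfolding Q_def st L1 Linear by simp
      next
        case Mixing
        then show ?thesis unfolding Q_def st L1 Mixing by simp
      qed
    next
      case Mixing
      then show ?thesis unfolding Q_def st Mixing by (cases "status_of T") auto
    qed
  qed
  then show ?case by (simp only: Q_def)
qed simp

lemma status_simple:
  assumes "element_tree T" "status_of T = Linear 1"
  shows "simple_etree T"
  using status_linear[OF assms(1)] assms(2) by (simp add: simple_etree_def)

lemma scale_abs:
  assumes "sym_law m" "\<bar>s\<bar> \<le> 1"
  shows "scale s m = scale \<bar>s\<bar> m"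
proof (intro absdev_unique posterior_law_scale)
  fix x y
  show "absdev (scale s m) x y = absdev (scale \<bar>s\<bar> m) x y"
    using sym_law_absdev(1)[OF assms(1), of x "s * y"]
        by (simp add: absdev_scale sym_lawD[OF assms(1)] abs_if)
qed (use assms in \<open>auto intro: sym_lawD\<close>)

lemma scale_scale_mult:
  assumes "posterior_law m" "\<bar>s\<bar> \<le> 1" "\<bar>t\<bar> \<le> 1"
  shows "scale s (scale t m) = scale (s * t) m"
proof -
  have "\<bar>s * t\<bar> \<le> 1" using assms by (simp add: abs_mult mult_le_one)
  then show ?thesis
    by (intro absdev_unique posterior_law_scale assms)
      (simp_all add: absdev_scale[OF posterior_law_scale[OF assms(1,3)]] absdev_scale[OF assms(1)] ac_simps)
qed

text \<open>
  An element tree acts trivially, as a scaling, or else combines at least two nontrivial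
  components; \<open>I\<close> is an invariant of the pairs of laws produced in the last case from the inputs
  \<open>\<nu>\<close> and \<open>\<mu>\<close>.
\<close>

locale status_invariant =
  fixes \<nu> \<mu> :: "real measure" and I :: "real measure \<Rightarrow> real measure \<Rightarrow> bool"
  assumes sym: "sym_law \<nu>" "sym_law \<mu>"
    and I_survey: "\<And>a. sym_law a \<Longrightarrow> a \<noteq> trivial_law \<Longrightarrow> I a a"
    and I_scale: "\<And>A B s. sym_law A \<Longrightarrow> sym_law B \<Longrightarrow> I A B \<Longrightarrow> 0 < s \<Longrightarrow> s \<le> 1 \<Longrightarrow> I (scale s A) (scale s B)"
    and I_combine: "\<And>A1 B1 A2 B2. \<lbrakk>sym_law A1; sym_law B1; sym_law A2; sym_law B2;
      I A1 B1 \<or> (\<exists>r. 0 < r \<and> r \<le> 1 \<and> A1 = scale r \<nu> \<and> B1 = scale r \<mu>);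
      I A2 B2 \<or> (\<exists>r. 0 < r \<and> r \<le> 1 \<and> A2 = scale r \<nu> \<and> B2 = scale r \<mu>)\<rbrakk>
          \<Longrightarrow> I (combine A1 A2) (combine B1 B2)"
begin

definition rel :: "status \<Rightarrow> real measure \<Rightarrow> real measure \<Rightarrow> bool" where
  "rel st A B \<longleftrightarrow> sym_law A \<and> sym_law B \<and> (case st of Neutral \<Rightarrow> A = trivial_law \<and> B = trivial_law
     | Linear r \<Rightarrow> 0 < r \<and> r \<le> 1 \<and> A = scale r \<nu> \<and> B = scale r \<mu>
     | Mixing \<Rightarrow> I A B)"

lemma rel_combine:
  assumes "rel s1 A1 B1" "rel s2 A2 B2"
  shows "rel (combine_status s1 s2) (combine A1 A2) (combine B1 B2)"
proof -
  have s: "sym_law A1" "sym_law B1" "sym_law A2" "sym_law B2" using assms by (auto simp: rel_def)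
  then have c: "sym_law (combine A1 A2)" "sym_law (combine B1 B2)" by (auto intro: sym_law_combine)
  show ?thesis
  proof (cases "s1 = Neutral")
    case True
    then have "A1 = trivial_law" "B1 = trivial_law" using assms by (auto simp: rel_def)
    then show ?thesis using True assms s by (simp add: combine_trivial sym_lawD)
  next
    case 1: False
    show ?thesis
    proof (cases "s2 = Neutral")
      case True
      then have "A2 = trivial_law" "B2 = trivial_law" using assms by (auto simp: rel_def)
      then show ?thesis using True assms s by (cases s1) (simp_all add: combine_trivial sym_lawD)
    next
      case 2: False
      have "I (combine A1 A2) (combine B1 B2)"
        by (rule I_combine[OF s]) (use assms 1 2 in \<open>cases s1; cases s2; auto simp: rel_def\<close>)+
      then show ?thesis using 1 2 c by (cases s1; cases s2) (auto simp: rel_def)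
    qed
  qed
qed

lemma rel_scale:
  assumes "rel st A B" "\<bar>s\<bar> \<le> 1" "s \<noteq> 0"
  shows "rel (scale_status \<bar>s\<bar> st) (scale s A) (scale s B)"
proof -
  have s: "sym_law A" "sym_law B" using assms by (auto simp: rel_def)
  then have c: "sym_law (scale s A)" "sym_law (scale s B)" using assms by (auto
      intro: sym_law_scale)
  have s0: "0 < \<bar>s\<bar>" using assms by simp
  have e: "scale s A = scale \<bar>s\<bar> A" "scale s B = scale \<bar>s\<bar> B" using s assms by (auto
      intro: scale_abs)
  show ?thesis
  proof (cases st)
    case Neutral
    then show ?thesis using assms c by (simp add: rel_def scale_trivial)
  next
    case (Linear r)
    then have r: "0 < r" "r \<le> 1" "A = scale r \<nu>" "B = scale r \<mu>" using assms by (auto simp: rel_def)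
    have "scale s A = scale (\<bar>s\<bar> * r) \<nu>" "scale s B = scale (\<bar>s\<bar> * r) \<mu>"
      unfolding e unfolding r using r assms sym by (auto intro!: scale_scale_mult sym_lawD)
    then show ?thesis using Linear c s0 r assms by (simp add: rel_def mult_le_one)
  next
    case Mixing
    then have "I (scale \<bar>s\<bar> A) (scale \<bar>s\<bar> B)" using assms s s0 by (intro I_scale) (auto
        simp: rel_def)
    then show ?thesis using Mixing c by (simp add: rel_def e)
  qed
qed

lemma rel_status_of:
  assumes "element_tree T"
  shows "rel (status_of T) (posterior_BP T \<nu>) (posterior_BP T \<mu>)"
  using assms
proof (induction T rule: element_tree.induct)
  case 1
  then show ?case using sym by (simp add: rel_def scale_one sym_lawD)
next
  case (2 s cs)
  have foldl: "rel (foldl combine_status s0 (map h xs)) (foldl combine m0 (map f xs)) (foldl combine m0' (map g xs))"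
    if "rel s0 m0 m0'" "\<And>x. x \<in> set xs \<Longrightarrow> rel (h x) (f x) (g x)" for s0 m0 m0' h f g
        and xs :: "(real \<times> etree) list"
    using that
  proof (induction xs arbitrary: s0 m0 m0')
    case (Cons x xs)
    have "rel (combine_status s0 (h x)) (combine m0 (f x)) (combine m0' (g x))"
      using Cons.prems(1) Cons.prems(2)[of x] by (intro rel_combine) simp_all
    then show ?case using Cons.IH Cons.prems(2) by simp
  qed simp
  have c: "rel (scale_status \<bar>1 - 2 * \<delta>\<bar> (status_of T)) (scale (1 - 2 * \<delta>) (posterior_BP T \<nu>))
      (scale (1 - 2 * \<delta>) (posterior_BP T \<mu>))"
    if "(\<delta>, T) \<in> set cs" for \<delta> T
    using 2(1)[OF that refl] 2(2) that by (intro rel_scale) (auto simp: abs_le_iff)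
  have s: "sym_law (posterior s)" "llr (posterior s) = s"
    using 2(2) symmetric_dist_posterior[of s] posterior_law_posterior(2)[of s] by auto
  have "s = trivial_dist \<longleftrightarrow> posterior s = trivial_law"
    using llr_trivial s(2) posterior_llr[OF posterior_law_trivial] by auto
  then have "rel (if s = trivial_dist then Neutral else Mixing) (posterior s) (posterior s)"
    using s(1) by (auto simp: rel_def I_survey sym_law_trivial)
  then show ?case unfolding posterior_BP.simps status_of.simps using c by (intro foldl) auto
qed

end

text \<open>The potential of a fixed point at k is the average of the potentials of the tree
  outputs. If almost none exceeds it, almost all are equal to it, and by \<open>le\<close> equality
  leaves only simple trees.\<close>

lemma fixed_point_AE_simple:
  assumes P: "etree_distribution P" and \<nu>: "sym_law \<nu>" and fp: "posterior_Q P \<nu> = \<nu>" and k: "0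
      < excess \<nu> k"
    and le: "AE T in P. excess (posterior_BP T \<nu>) k < excess \<nu> k \<or> (excess (posterior_BP T \<nu>) k
        = excess \<nu> k \<and> simple_etree T)"
  shows "trivial_etree_distribution P"
proof -
  interpret prob_space P using etree_distributionD[OF P] by simp
  note i = absdev_posterior_Q[OF P sym_lawD[OF \<nu>], of k 1]
  have int: "integrable P (\<lambda>T. excess \<nu> k - excess (posterior_BP T \<nu>) k)"
      unfolding excess_def[of "posterior_BP _ _"] using i(1) by simp
  have "(LINT T|P. excess \<nu> k - excess (posterior_BP T \<nu>) k)
      = excess \<nu> k - ((LINT T|P. absdev (posterior_BP T \<nu>) k 1) - k)"
    unfolding excess_def[of "posterior_BP _ _"] using i(1) by (simp add: prob_space)
  also have "\<dots> = 0" using i(2) fp by (simp add: excess_def)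
  finally have "AE T in P. excess \<nu> k - excess (posterior_BP T \<nu>) k = 0"
    using le by (subst (asm) integral_nonneg_eq_0_iff_AE[OF int]) (auto elim!: eventually_mono)
  then show ?thesis unfolding trivial_etree_distribution_def
    using le by eventually_elim auto
qed

section \<open>Comparison of radii\<close>

lemma sym_law_nontrivial:
  assumes "sym_law m" "m \<noteq> trivial_law"
  shows "0 < excess m 0"
  using absdev_zero_imp_trivial[OF sym_lawD[OF assms(1)]] assms absdev_nonneg[of m 0 1] by (auto
      simp: excess_def less_le)

lemma excess_trivial: "0 \<le> k \<Longrightarrow> excess trivial_law k = 0"
  by (simp add: excess_def absdev_trivial)

lemma excess_scale_le:
  assumes "sym_law m" "0 < r" "r \<le> 1" "0 \<le> k" "0 < excess m k"
  shows "excess (scale r m) k \<le> excess m k" "r < 1 \<Longrightarrow> excess (scale r m) k < excess m k"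
proof -
  have "k \<le> k / r" using assms by (simp add: le_divide_eq mult_left_le)
  then have "r * excess m (k / r) \<le> r * excess m k" using assms
      by (intro mult_left_mono excess_antimono) auto
  then have *: "excess (scale r m) k \<le> r * excess m k" using assms
      by (simp add: excess_scale sym_lawD)
  also have "\<dots> \<le> excess m k" using assms by (simp add: mult_left_le_one_le)
  finally show "excess (scale r m) k \<le> excess m k" .
  assume "r < 1"
  then have "r * excess m k < excess m k" using assms by simp
  with * show "excess (scale r m) k < excess m k" by linarith
qed

text \<open>The weight w compares the output with the input at x0; a multiple r of the input has w =
  r and w x0 = y. Under combination the weights pick up the factors 1 - y2 and 1 - y1 of
  \<open>excess_combine_le\<close>, whereas the radii add up to (y1 + y2) / (1 + y1 y2). So weak
  inequalities for the components become the strict w x0 < y.\<close>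

lemma status_invariant_radius:
  assumes sym: "sym_law \<nu>" "sym_law \<mu>" and r0: "is_radius \<nu> x0"
  shows "status_invariant \<nu> \<mu> (\<lambda>A B. \<exists>y w. is_radius A y \<and> 0 \<le> w \<and> w * x0 < y \<and> excess B y
      \<le> w * excess \<mu> x0)"
    (is "status_invariant \<nu> \<mu> ?I")
proof
  have x0: "0 < x0" using r0 by (simp add: is_radius_def)
  show "sym_law \<nu>" "sym_law \<mu>" by fact+
  show "?I a a" if a: "sym_law a" "a \<noteq> trivial_law" for a
  proof -
    obtain y where y: "is_radius a y" using radius_exists[OF a(1) sym_law_nontrivial[OF a]] .
    \<comment> \<open>The potential of a survey distribution vanishes at its own radius, so the
      weight 0 serves.\<close>
    then show ?thesis by (intro exI[of _ y] exI[of _ 0]) (simp add: is_radius_def)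
  qed
  show "?I (scale s A) (scale s B)" if s: "sym_law A" "sym_law B" "?I A B" "0 < s" "s \<le> 1" for A B s
  proof -
    obtain y w where yw: "is_radius A y" "0 \<le> w" "w * x0 < y" "excess B y \<le> w * excess \<mu> x0"
        using s(3) by blast
    have "excess (scale s B) (s * y) = s * excess B y" using s by (simp add: excess_scale sym_lawD)
    also have "\<dots> \<le> s * w * excess \<mu> x0" using yw s by (simp add: mult_left_mono)
    finally have 1: "excess (scale s B) (s * y) \<le> s * w * excess \<mu> x0" .
    show ?thesis
      by (intro exI[of _ "s * y"] exI[of _ "s * w"] conjI radius_scale[OF s(1) yw(1) s(4,5)] 1) (use yw s in auto)
  qed
  fix A1 B1 A2 B2
  assume s: "sym_law A1" "sym_law B1" "sym_law A2" "sym_law B2"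
    and J: "?I A1 B1 \<or> (\<exists>r. 0 < r \<and> r \<le> 1 \<and> A1 = scale r \<nu> \<and> B1 = scale r \<mu>)"
      "?I A2 B2 \<or> (\<exists>r. 0 < r \<and> r \<le> 1 \<and> A2 = scale r \<nu> \<and> B2 = scale r \<mu>)"
  have weak: "\<exists>y w. is_radius A y \<and> 0 \<le> w \<and> w * x0 \<le> y \<and> excess B y \<le> w * excess \<mu> x0"
    if "?I A B \<or> (\<exists>r. 0 < r \<and> r \<le> 1 \<and> A = scale r \<nu> \<and> B = scale r \<mu>)" for A B
    using that
  proof
    assume "?I A B" then show ?thesis by (auto intro: less_imp_le)
  next
    assume "\<exists>r. 0 < r \<and> r \<le> 1 \<and> A = scale r \<nu> \<and> B = scale r \<mu>"
    then obtain r where r: "0 < r" "r \<le> 1" "A = scale r \<nu>" "B = scale r \<mu>" by blast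
    have "excess B (r * x0) = r * excess \<mu> x0" using r sym by (simp add: excess_scale sym_lawD)
    then show ?thesis using radius_scale[OF sym(1) r0 r(1,2)] r
      by (intro exI[of _ "r * x0"] exI[of _ r]) simp
  qed
  obtain y1 w1 where 1: "is_radius A1 y1" "0 \<le> w1" "w1 * x0 \<le> y1" "excess B1 y1 \<le> w1 * excess \<mu> x0"
      using weak[OF J(1)] by blast
  obtain y2 w2 where 2: "is_radius A2 y2" "0 \<le> w2" "w2 * x0 \<le> y2" "excess B2 y2 \<le> w2 * excess \<mu> x0"
      using weak[OF J(2)] by blast
  have y: "0 < y1" "y1 \<le> 1" "0 < y2" "y2 \<le> 1" using 1 2 by (auto simp: is_radius_def)
  define D where "D = 1 + y1 * y2"
  have D: "0 < D" using y by (simp add: D_def add_pos_pos)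
  let ?y = "(y1 + y2) / D" and ?w = "((1 - y2) * w1 + (1 - y1) * w2) / D"
  have "((1 - y2) * w1 + (1 - y1) * w2) * x0 = (1 - y2) * (w1 * x0) + (1 - y1) * (w2 * x0)"
      by (simp add: algebra_simps)
  also have "\<dots> \<le> (1 - y2) * y1 + (1 - y1) * y2" using 1 2 y by (intro add_mono mult_left_mono) auto
  also have "\<dots> < y1 + y2" using y mult_pos_pos[of y1 y2] by (simp add: algebra_simps)
  finally have lt: "?w * x0 < ?y" using D by (simp add: divide_strict_right_mono)
  have "excess (combine B1 B2) ?y \<le> ((1 - y2) * excess B1 y1 + (1 - y1) * excess B2 y2) / D"
    unfolding D_def using y by (intro excess_combine_le s) auto
  also have "\<dots> \<le> ((1 - y2) * (w1 * excess \<mu> x0) + (1 - y1) * (w2 * excess \<mu> x0)) / D"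
    using 1 2 y D by (intro divide_right_mono add_mono mult_left_mono) auto
  also have "\<dots> = ?w * excess \<mu> x0" by (simp add: algebra_simps add_divide_distrib)
  finally have le: "excess (combine B1 B2) ?y \<le> ?w * excess \<mu> x0" .
  have "0 \<le> ?w" using 1 2 y D by simp
  with radius_combine[OF s(1,3) 1(1) 2(1), folded D_def] lt le
  show "?I (combine A1 A2) (combine B1 B2)" by blast
qed

text \<open>Almost every tree maps \<nu> to a law on [-x0, x0], so a mixing tree has y \<le> x0 and
  therefore w < 1. If the potential of \<mu> at x0 were positive, such a tree would lower it, as
  would every other tree that is not simple, and P would be trivial.\<close>

lemma fixed_point_radius:
  assumes P: "etree_distribution P" "\<not> trivial_etree_distribution P"
    and sym: "sym_law \<nu>" "sym_law \<mu>" and fp: "posterior_Q P \<nu> = \<nu>" "posterior_Q P \<mu> = \<mu>"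
    and r0: "is_radius \<nu> x0"
  shows "excess \<mu> x0 = 0"
proof (rule ccontr)
  interpret prob_space P using etree_distributionD[OF P(1)] by simp
  have x0: "0 < x0" "x0 \<le> 1" "excess \<nu> x0 = 0" using r0 by (auto simp: is_radius_def)
  assume "excess \<mu> x0 \<noteq> 0"
  then have pos: "0 < excess \<mu> x0" using excess_nonneg[OF sym(2), of x0] x0 by simp
  interpret status_invariant \<nu> \<mu> "\<lambda>A B. \<exists>y w. is_radius A y \<and> 0 \<le> w \<and> w * x0 < y \<and> excess B y
      \<le> w * excess \<mu> x0"
    by (rule status_invariant_radius[OF sym r0])
  note i = absdev_posterior_Q[OF P(1) sym_lawD[OF sym(1)], of x0 1]
  have "AE T in P. absdev (posterior_BP T \<nu>) x0 1 - x0 = 0"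
  proof (subst integral_nonneg_eq_0_iff_AE[symmetric])
    show "integrable P (\<lambda>T. absdev (posterior_BP T \<nu>) x0 1 - x0)" using i(1) by simp
    show "AE T in P. 0 \<le> absdev (posterior_BP T \<nu>) x0 1 - x0"
      using etree_distributionD(3)[OF P(1)]
      by eventually_elim (use absdev_ge_abs[of _ x0 1] sym_lawD[OF sym_law_posterior_BP[OF _ sym(1)]] in force)
    show "(LINT T|P. absdev (posterior_BP T \<nu>) x0 1 - x0) = 0" using i x0 fp
        by (simp add: prob_space excess_def)
  qed
  then have "AE T in P. excess (posterior_BP T \<mu>) x0 < excess \<mu> x0 \<or> (excess (posterior_BP T \<mu>) x0
      = excess \<mu> x0 \<and> simple_etree T)"
    using etree_distributionD(3)[OF P(1)]
  proof eventually_elim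
    case (elim T)
    have A0: "excess (posterior_BP T \<nu>) x0 = 0" using elim by (simp add: excess_def)
    note R = rel_status_of[OF elim(2), unfolded rel_def]
    then have s: "sym_law (posterior_BP T \<nu>)" "sym_law (posterior_BP T \<mu>)" by blast+
    show ?case
    proof (cases "status_of T")
      case Neutral
      then show ?thesis using R pos x0 by (simp add: excess_trivial)
    next
      case (Linear r)
      then have r: "0 < r" "r \<le> 1" "posterior_BP T \<mu> = scale r \<mu>" using R by auto
      show ?thesis
      proof (cases "r = 1")
        case True
        then show ?thesis using r status_simple[OF elim(2)] Linear sym
            by (simp add: scale_one sym_lawD)
      next
        case False
        then show ?thesis using r excess_scale_le(2)[OF sym(2) r(1,2) _ pos] x0 by simp
      qed
    next
      case Mixing
      then obtain y w where yw: "is_radius (posterior_BP T \<nu>) y" "0 \<le> w" "w * x0 < y"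
          "excess (posterior_BP T \<mu>) y \<le> w * excess \<mu> x0"
        using R by auto
      have yx: "y \<le> x0" using radius_le[OF yw(1) _ A0] x0 by simp
      have "0 < y" using yw(1) by (simp add: is_radius_def)
      then have "excess (posterior_BP T \<mu>) x0 \<le> w * excess \<mu> x0"
          using excess_antimono[OF s(2) _ yx] yw(4) by simp
      also have "w * x0 < 1 * x0" using yw yx by simp
      then have "w < 1" using x0 by (simp only: mult_less_cancel_right)
      then have "w * excess \<mu> x0 < excess \<mu> x0" using pos by simp
      finally show ?thesis by simp
    qed
  qed
  from fixed_point_AE_simple[OF P(1) sym(2) fp(2) pos this] P(2) show False by simp
qed

section \<open>Contacts of a fixed point with a multiple of another\<close>

definition contact :: "real \<Rightarrow> real measure \<Rightarrow> real measure \<Rightarrow> real \<Rightarrow> bool" where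
  "contact t A B k \<longleftrightarrow> excess A k = excess (scale t B) k \<and> 0 < excess A k"

text \<open>Besides the order, this records that the support of \<open>scale t B\<close> ends
  strictly before that of A, as witnessed by c, and that B is nontrivial. These are the side
  conditions of \<open>contact_combine\<close>, bundled because they are stable under scaling and
  combination.\<close>

definition dominates :: "real \<Rightarrow> real measure \<Rightarrow> real measure \<Rightarrow> bool" where
  "dominates t A B \<longleftrightarrow> degraded (scale t B) A \<and> (\<exists>c\<ge>0. excess (scale t B) c = 0 \<and> 0 < excess A c) \<and> 0
      < excess B 0"

lemma contact_scale:
  assumes "sym_law A" "sym_law B" "0 < s" "s \<le> 1" "0 < t" "t < 1"
  shows "contact t (scale s A) (scale s B) k \<longleftrightarrow> contact t A B (k / s)"
proof -
  have "scale t (scale s B) = scale s (scale t B)" using assms by (intro scale_scale sym_lawD) auto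
  moreover have "posterior_law (scale t B)" using assms by (intro posterior_law_scale sym_lawD) auto
  ultimately show ?thesis using assms by (auto
      simp: contact_def excess_scale sym_lawD zero_less_mult_iff)
qed

lemma dominates_scale:
  assumes "sym_law A" "sym_law B" "0 < s" "s \<le> 1" "0 < t" "t < 1" "dominates t A B"
  shows "dominates t (scale s A) (scale s B)"
proof -
  have c: "scale t (scale s B) = scale s (scale t B)" using assms
      by (intro scale_scale sym_lawD) auto
  have p: "posterior_law A" "posterior_law (scale t B)"
    using assms sym_lawD posterior_law_scale[of B t] by auto
  obtain k where k: "0 \<le> k" "excess (scale t B) k = 0" "0 < excess A k" using assms(7) by (auto
      simp: dominates_def)
  have "degraded (scale s (scale t B)) (scale s A)"
    using assms p by (intro degraded_scale) (auto simp: dominates_def)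
  moreover have "0 \<le> s * k" "excess (scale s (scale t B)) (s * k) = 0" "0
      < excess (scale s A) (s * k)"
    using k assms by (simp_all add: excess_scale[OF p(1)] excess_scale[OF p(2)])
  moreover have "0 < excess (scale s B) 0" using assms
      by (simp add: excess_scale sym_lawD dominates_def)
  ultimately show ?thesis unfolding dominates_def c by blast
qed

text \<open>The order survives by \<open>stringy_tree\<close> and monotonicity. For the gap between
  the supports, t times the combined radius of B1 and B2 is at most the combination of t y1 and t
  y2, which lies below that of the strictly larger radii z1 and z2 of A1 and A2.\<close>

lemma dominates_combine:
  assumes s: "sym_law A1" "sym_law B1" "sym_law A2" "sym_law B2" and t: "0 < t" "t < 1"
    and d: "dominates t A1 B1" "dominates t A2 B2"
  shows "dominates t (combine A1 A2) (combine B1 B2)"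
proof -
  have t1: "\<bar>t\<bar> \<le> 1" using t by simp
  have st: "sym_law (scale t B1)" "sym_law (scale t B2)" using s t1 by (auto intro: sym_law_scale)
  have deg1: "degraded (scale t (combine B1 B2)) (combine (scale t B1) (scale t B2))"
    using s t by (intro stringy_tree) auto
  have deg2: "degraded (combine (scale t B1) (scale t B2)) (combine A1 A2)"
    using d s st by (intro degraded_combine sym_lawD) (auto simp: dominates_def)
  have nt: "0 < excess B1 0" "0 < excess B2 0" using d by (auto simp: dominates_def)
  obtain y1 where y1: "is_radius B1 y1" using radius_exists[OF s(2) nt(1)] .
  obtain y2 where y2: "is_radius B2 y2" using radius_exists[OF s(4) nt(2)] .
  note rB = radius_combine[OF s(2,4) y1 y2]
  have y: "0 < y1" "y1 \<le> 1" "0 < y2" "y2 \<le> 1" using y1 y2 by (auto simp: is_radius_def)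
  have U0: "excess A1 (t * y1) > 0" "excess A2 (t * y2) > 0"
  proof -
    have *: "0 < excess A (t * y)" if H: "sym_law A" "sym_law B" "dominates t A B" "is_radius B y"
        for A B y
    proof -
      obtain c where c: "0 \<le> c" "excess (scale t B) c = 0" "0 < excess A c" using H by (auto
          simp: dominates_def)
      then have "excess B (c / t) = 0" using H t by (simp add: excess_scale sym_lawD)
      then have "y \<le> c / t" using c t by (intro radius_le[OF H(4)]) auto
      then have "t * y \<le> c" using t by (simp add: le_divide_eq mult.commute)
      moreover have "0 \<le> t * y" using H(4) t by (simp add: is_radius_def)
      ultimately show ?thesis using excess_antimono[OF H(1), of "t * y" c] c by simp
    qed
    show "excess A1 (t * y1) > 0" "excess A2 (t * y2) > 0" using * s d y1 y2 by blast+
  qed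
  have ntA: "0 < excess A1 0" "0 < excess A2 0"
    using U0 excess_antimono[OF s(1), of 0 "t * y1"] excess_antimono[OF s(3), of 0 "t * y2"] y t
        by auto
  obtain z1 where z1: "is_radius A1 z1" using radius_exists[OF s(1) ntA(1)] .
  obtain z2 where z2: "is_radius A2 z2" using radius_exists[OF s(3) ntA(2)] .
  have z: "z1 \<le> 1" "z2 \<le> 1" "0 < z1" "0 < z2" using z1 z2 by (auto simp: is_radius_def)
  have tz: "t * y1 < z1" "t * y2 < z2"
  proof -
    have *: "u < z" if "is_radius A z" "0 < excess A u" "0 \<le> u" "sym_law A" for A z u
      using that excess_antimono[OF that(4), of z u] by (auto simp: is_radius_def intro: ccontr)
    show "t * y1 < z1" "t * y2 < z2" using *[OF z1 U0(1)] *[OF z2 U0(2)] s y t by auto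
  qed
  let ?c = "t * ((y1 + y2) / (1 + y1 * y2))"
  have "?c < (z1 + z2) / (1 + z1 * z2)"
  proof -
    have D: "0 < 1 + y1 * y2" "0 < 1 + z1 * z2" "0 < 1 + (t * y1) * (t * y2)"
      using y z t by (auto intro!: add_pos_pos)
    have "(t * y1) * (t * y2) \<le> y1 * y2" using y t by (intro mult_mono) (auto
        simp: mult_left_le_one_le)
    then have "?c \<le> (t * y1 + t * y2) / (1 + (t * y1) * (t * y2))"
      using y t D by (simp add: distrib_left[symmetric] frac_le)
    also have "\<dots> < (z1 + z2) / (1 + z1 * z2)"
    proof -
      have mono: "(a + b) / (1 + a * b) \<le> (a' + b) / (1 + a' * b)" if "0 \<le> a" "a \<le> a'" "a' \<le> 1" "0
          \<le> b" "b \<le> 1" for a a' b :: real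
      proof -
        have "0 \<le> (a' - a) * (1 - b * b)" using that by (intro mult_nonneg_nonneg) (auto
            intro: mult_le_one)
        then have "(a + b) * (1 + a' * b) \<le> (a' + b) * (1 + a * b)" by (simp add: algebra_simps)
        then show ?thesis using that by (simp add: divide_simps add_pos_nonneg add_nonneg_eq_0_iff)
      qed
      have smono: "(a + b) / (1 + a * b) < (a' + b) / (1 + a' * b)" if "0 \<le> a" "a < a'" "a' \<le> 1" "0
          \<le> b" "b < 1" for a a' b :: real
      proof -
        have "b * b \<le> b" using that by (simp add: mult_left_le)
        then have "0 < (a' - a) * (1 - b * b)" using that by (intro mult_pos_pos) auto
        then have "(a + b) * (1 + a' * b) < (a' + b) * (1 + a * b)" by (simp add: algebra_simps)
        moreover have "0 < 1 + a * b" "0 < 1 + a' * b" using that by (auto simp: add_pos_nonneg)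
        ultimately show ?thesis by (simp add: divide_less_eq less_divide_eq mult.commute)
      qed
      \<comment> \<open>The strict replacement comes first, while the other coordinate t y2 is below
        1. Afterwards z1 may be 1, where (z1 + b) / (1 + z1 b) is constant in b and only the weak
        inequality remains.\<close>
      have "(t * y1 + t * y2) / (1 + (t * y1) * (t * y2)) < (z1 + t * y2) / (1 + z1 * (t * y2))"
        using tz z y t by (intro smono) (auto
            intro: mult_le_one le_less_trans[of _ "z2"] less_le_trans)
      also have "\<dots> \<le> (z1 + z2) / (1 + z1 * z2)"
        using mono[of "t * y2" z2 z1] tz z y t by (simp add: add.commute mult.commute)
      finally show ?thesis .
    qed
    finally show ?thesis .
  qed
  moreover have c0: "0 \<le> ?c" using y t by simp
  ultimately have "0 < excess (combine A1 A2) ?c" using radius_combine[OF s(1,3) z1 z2]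
      by (simp add: is_radius_def)
  moreover have "excess (scale t (combine B1 B2)) ?c = 0"
    using rB t s by (simp add: excess_scale posterior_law_combine sym_lawD is_radius_def)
  moreover have "0 < excess (combine B1 B2) 0" using rB by (simp add: is_radius_def)
  ultimately show ?thesis using degraded_trans[OF deg1 deg2] c0 unfolding dominates_def by blast
qed

text \<open>For surveys: scaling by t < 1 shrinks the radius and strictly lowers every positive
  value of the potential.\<close>

lemma dominates_self:
  assumes "sym_law a" "a \<noteq> trivial_law" "0 < t" "t < 1"
  shows "dominates t a a" "0 \<le> k \<Longrightarrow> \<not> contact t a a k"
proof -
  have nt: "0 < excess a 0" using sym_law_nontrivial[OF assms(1,2)] .
  obtain y where y: "is_radius a y" using radius_exists[OF assms(1) nt] .
  then have "0 < y" by (simp add: is_radius_def)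
  then have "excess (scale t a) (t * y) = 0" "0 < excess a (t * y)" "0 \<le> t * y"
    using y assms by (simp_all add: excess_scale sym_lawD is_radius_def)
  then show "dominates t a a"
    using nt degraded_scale_self[OF sym_lawD[OF assms(1)], of t] assms unfolding dominates_def
        by auto
  show "\<not> contact t a a k" if "0 \<le> k"
    using excess_scale_le(2)[OF assms(1,3) _ that] assms by (auto simp: contact_def)
qed

text \<open>For a multiple r of the input, a contact at k comes from a contact of the input at k / r
  \<ge> k, possibly k itself. The strict increase is due to combination, where
  \<open>contact_combine\<close> finds a contact of a component strictly above k.\<close>

lemma status_invariant_contact:
  assumes sym: "sym_law \<nu>" "sym_law \<mu>" and t: "0 < t" "t < 1" and d: "dominates t \<nu> \<mu>"
  shows "status_invariant \<nu> \<mu> (\<lambda>A B. dominates t A B \<and> (\<forall>k\<ge>0. contact t A B k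
      \<longrightarrow> (\<exists>k'>k. contact t \<nu> \<mu> k')))"
    (is "status_invariant \<nu> \<mu> ?I")
proof
  show "sym_law \<nu>" "sym_law \<mu>" by fact+
  show "?I a a" if a: "sym_law a" "a \<noteq> trivial_law" for a
    using dominates_self[OF a t] by blast
  show "?I (scale s A) (scale s B)" if s: "sym_law A" "sym_law B" "?I A B" "0 < s" "s \<le> 1" for A B s
  proof (intro conjI allI impI)
    show "dominates t (scale s A) (scale s B)" using dominates_scale[OF s(1,2,4,5) t] s(3) by blast
    fix k assume k: "0 \<le> k" "contact t (scale s A) (scale s B) k"
    then have "contact t A B (k / s)" using contact_scale[OF s(1,2,4,5) t] by simp
    moreover have "k \<le> k / s" using k s by (simp add: le_divide_eq mult_left_le)
    moreover have "0 \<le> k / s" using k s by simp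
    ultimately show "\<exists>k'>k. contact t \<nu> \<mu> k'" using s(3) by (meson le_less_trans)
  qed
  fix A1 B1 A2 B2
  assume s: "sym_law A1" "sym_law B1" "sym_law A2" "sym_law B2"
    and J: "?I A1 B1 \<or> (\<exists>r. 0 < r \<and> r \<le> 1 \<and> A1 = scale r \<nu> \<and> B1 = scale r \<mu>)"
      "?I A2 B2 \<or> (\<exists>r. 0 < r \<and> r \<le> 1 \<and> A2 = scale r \<nu> \<and> B2 = scale r \<mu>)"
  have weak: "dominates t A B \<and> (\<forall>k\<ge>0. contact t A B k \<longrightarrow> (\<exists>k'\<ge>k. contact t \<nu> \<mu> k'))"
    if "?I A B \<or> (\<exists>r. 0 < r \<and> r \<le> 1 \<and> A = scale r \<nu> \<and> B = scale r \<mu>)" for A B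
    using that
  proof
    assume "?I A B" then show ?thesis by (meson less_imp_le)
  next
    assume "\<exists>r. 0 < r \<and> r \<le> 1 \<and> A = scale r \<nu> \<and> B = scale r \<mu>"
    then obtain r where r: "0 < r" "r \<le> 1" "A = scale r \<nu>" "B = scale r \<mu>" by blast
    show ?thesis
    proof (intro conjI allI impI)
      show "dominates t A B" using dominates_scale[OF sym r(1,2) t d] r by simp
      fix k assume k: "0 \<le> k" "contact t A B k"
      then have "contact t \<nu> \<mu> (k / r)" using contact_scale[OF sym r(1,2) t] r by simp
      moreover have "k \<le> k / r" using k r by (simp add: le_divide_eq mult_left_le)
      ultimately show "\<exists>k'\<ge>k. contact t \<nu> \<mu> k'" by blast
    qed
  qed
  note w1 = weak[OF J(1)] and w2 = weak[OF J(2)]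
  show "?I (combine A1 A2) (combine B1 B2)"
  proof (intro conjI allI impI)
    show "dominates t (combine A1 A2) (combine B1 B2)" using dominates_combine[OF s t] w1 w2
        by blast
    fix k assume k: "0 \<le> k" "contact t (combine A1 A2) (combine B1 B2) k"
    obtain c1 where c1: "0 \<le> c1" "excess (scale t B1) c1 = 0" "0 < excess A1 c1" using w1 by (auto
        simp: dominates_def)
    obtain c2 where c2: "0 \<le> c2" "excess (scale t B2) c2 = 0" "0 < excess A2 c2" using w2 by (auto
        simp: dominates_def)
    have "\<exists>k'>k. contact t A1 B1 k' \<or> contact t A2 B2 k'"
      unfolding contact_def
      by (rule contact_combine[OF s(1,3,2,4) t _ _ c1 c2])
        (use w1 w2 k in \<open>auto simp: dominates_def contact_def\<close>)
    then obtain k' where k': "k < k'" "contact t A1 B1 k' \<or> contact t A2 B2 k'" by blast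
    then have "\<exists>k''\<ge>k'. contact t \<nu> \<mu> k''" using w1 w2 k(1) by (meson le_less_trans less_imp_le)
    then show "\<exists>k'>k. contact t \<nu> \<mu> k'" using k'(1) by (meson less_le_trans)
  qed
qed

text \<open>Both fixed points are averages of tree outputs, so equality at k makes the order between
  the outputs an equality at k for almost every tree. Maximality of k excludes a contact at a
  positive value for a mixing tree, whose output potential is therefore 0. Hence almost every tree
  that is not simple strictly lowers the potential of \<nu> at k.\<close>

lemma fixed_points_no_contact:
  assumes P: "etree_distribution P" "\<not> trivial_etree_distribution P"
    and sym: "sym_law \<nu>" "sym_law \<mu>" and fp: "posterior_Q P \<nu> = \<nu>" "posterior_Q P \<mu> = \<mu>"
    and t: "0 < t" "t < 1" and d: "dominates t \<nu> \<mu>"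
    and k: "0 \<le> k" "contact t \<nu> \<mu> k" and max: "\<And>k'. k < k' \<Longrightarrow> \<not> contact t \<nu> \<mu> k'"
  shows False
proof -
  interpret prob_space P using etree_distributionD[OF P(1)] by simp
  interpret status_invariant \<nu> \<mu> "\<lambda>A B. dominates t A B \<and> (\<forall>k\<ge>0. contact t A B k
      \<longrightarrow> (\<exists>k'>k. contact t \<nu> \<mu> k'))"
    by (rule status_invariant_contact[OF sym t d])
  have pos: "0 < excess \<nu> k" using k(2) by (simp add: contact_def)
  have t1: "\<bar>t\<bar> \<le> 1" "0 \<le> t" "t \<le> 1" using t by auto
  have p: "posterior_law \<nu>" "posterior_law \<mu>" "posterior_law (scale t \<mu>)"
    using sym t1 by (auto intro: sym_lawD posterior_law_scale)
  note i = absdev_posterior_Q[OF P(1) p(1), of k 1] absdev_posterior_Q[OF P(1) p(2), of k t]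
  have dT: "absdev (posterior_BP T \<mu>) k t \<le> absdev (posterior_BP T \<nu>) k 1" if T: "element_tree T"
      for T
  proof -
    have "degraded (scale t (posterior_BP T \<mu>)) (posterior_BP T \<nu>)"
      using d by (intro degraded_trans[OF stringy_posterior_BP[OF T sym(2) t1(2,3)]] degraded_posterior_BP T p)
        (simp add: dominates_def)
    from degradedD[OF this, of k 1] show ?thesis
        by (simp add: absdev_scale posterior_BP_tree(1)[OF p(2) T])
  qed
  have "AE T in P. absdev (posterior_BP T \<nu>) k 1 - absdev (posterior_BP T \<mu>) k t = 0"
  proof (subst integral_nonneg_eq_0_iff_AE[symmetric])
    show "integrable P (\<lambda>T. absdev (posterior_BP T \<nu>) k 1 - absdev (posterior_BP T \<mu>) k t)" using i
        by simp
    show "AE T in P. 0 \<le> absdev (posterior_BP T \<nu>) k 1 - absdev (posterior_BP T \<mu>) k t"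
      using etree_distributionD(3)[OF P(1)] by eventually_elim (simp add: dT)
    show "(LINT T|P. absdev (posterior_BP T \<nu>) k 1 - absdev (posterior_BP T \<mu>) k t) = 0"
      using i fp k(2) p by (simp add: contact_def excess_def absdev_scale)
  qed
  then have "AE T in P. excess (posterior_BP T \<nu>) k < excess \<nu> k \<or> (excess (posterior_BP T \<nu>) k
      = excess \<nu> k \<and> simple_etree T)"
    using etree_distributionD(3)[OF P(1)]
  proof eventually_elim
    case (elim T)
    note R = rel_status_of[OF elim(2), unfolded rel_def]
    then have s: "sym_law (posterior_BP T \<nu>)" "sym_law (posterior_BP T \<mu>)" by blast+
    have eq: "excess (posterior_BP T \<nu>) k = excess (scale t (posterior_BP T \<mu>)) k"
      using elim(1) s by (simp add: excess_def absdev_scale sym_lawD)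
    show ?case
    proof (cases "status_of T")
      case Neutral
      then show ?thesis using R pos k by (simp add: excess_trivial)
    next
      case (Linear r)
      then have r: "0 < r" "r \<le> 1" "posterior_BP T \<nu> = scale r \<nu>" using R by auto
      show ?thesis
      proof (cases "r = 1")
        case True
        then show ?thesis using r status_simple[OF elim(2)] Linear sym
            by (simp add: scale_one sym_lawD)
      next
        case False
        then show ?thesis using r excess_scale_le(2)[OF sym(1) r(1,2) k(1) pos] by simp
      qed
    next
      case Mixing
      then have "\<not> contact t (posterior_BP T \<nu>) (posterior_BP T \<mu>) k"
        using R k(1) max by auto
      then have "excess (posterior_BP T \<nu>) k \<le> 0" using eq by (simp add: contact_def)
      then show ?thesis using pos by simp
    qed
  qed
  from fixed_point_AE_simple[OF P(1) sym(1) fp(1) pos this] P(2) show False by simp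
qed

lemma closed_scale_degraded:
  assumes "posterior_law m"
  shows "closed {t \<in> {0..1}. degraded (scale t m) m'}"
proof -
  have "closed {t. absdev m x (t * y) \<le> absdev m' x y}" for x y
    by (intro closed_Collect_le continuous_on_absdev assms continuous_intros)
  then have "closed ({0..1} \<inter> (\<Inter>x y. {t. absdev m x (t * y) \<le> absdev m' x y}))"
      by (intro closed_Int closed_INT) auto
  also have "{0..1} \<inter> (\<Inter>x y. {t. absdev m x (t * y) \<le> absdev m' x y})
      = {t \<in> {0..1}. degraded (scale t m) m'}"
    by (auto simp: degraded_def absdev_scale[OF assms])
  finally show ?thesis .
qed

lemma fixed_points_degraded:
  assumes P: "etree_distribution P" "\<not> trivial_etree_distribution P"
    and sym: "sym_law \<nu>" "sym_law \<mu>" and fp: "posterior_Q P \<nu> = \<nu>" "posterior_Q P \<mu> = \<mu>"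
    and nt: "0 < excess \<nu> 0" "0 < excess \<mu> 0" and t0: "0 < t0" "t0 \<le> 1"
        and d0: "degraded (scale t0 \<mu>) \<nu>"
  shows "degraded \<mu> \<nu>"
proof -
  note p = sym_lawD[OF sym(1)] sym_lawD[OF sym(2)]
  define S where "S = {t \<in> {0..1}. degraded (scale t \<mu>) \<nu>}"
  have S0: "t0 \<in> S" using t0 d0 by (simp add: S_def)
  have bd: "bdd_above S" by (auto simp: S_def intro: bdd_aboveI[of _ 1])
  define t where "t = Sup S"
  have "t \<in> S" unfolding t_def
      using closed_contains_Sup[OF _ bd] S0 closed_scale_degraded[OF p(2), of \<nu>] by (auto
      simp: S_def)
  then have t: "t \<le> 1" "degraded (scale t \<mu>) \<nu>" by (auto simp: S_def)
  have tpos: "0 < t" using cSup_upper[OF S0 bd] t0 by (simp add: t_def)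
  show ?thesis
  proof (cases "t = 1")
    case True
    then show ?thesis using t(2) by (simp add: scale_one p)
  next
    case False
    then have t1: "t < 1" using t by simp
    obtain x0 where r0: "is_radius \<nu> x0" using radius_exists[OF sym(1) nt(1)] .
    then have x0: "0 < x0" "x0 \<le> 1" by (auto simp: is_radius_def)
    have \<mu>0: "excess \<mu> x0 = 0" by (rule fixed_point_radius[OF P sym fp r0])
    have pos: "0 < excess \<nu> k" if "0 \<le> k" "k < x0" for k using r0 that by (simp add: is_radius_def)
    have tx: "0 \<le> t * x0" "t * x0 < x0" using x0 tpos t1 by auto
    have ps: "sym_law (scale t \<mu>)" using sym tpos t by (intro sym_law_scale) auto
    have st0: "excess (scale t \<mu>) (t * x0) = 0" using \<mu>0 tpos by (simp add: excess_scale p)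
    then have st0': "excess (scale t \<mu>) k = 0" if "t * x0 \<le> k" for k
      using excess_antimono[OF ps tx(1) that] excess_nonneg[OF ps, of k] tx(1) that by simp
    have dom: "dominates t \<nu> \<mu>"
      unfolding dominates_def using t(2) nt(2) st0 tx pos by blast
    \<comment> \<open>From t x0 on the potential of \<open>scale t \<mu>\<close> is 0, while a
      contact needs a positive value. So contacts at k \<ge> 0 lie in the compact set K; conversely
      the points of K are contacts, since the potential of \<nu> is positive below x0.\<close>
    define K where "K = {k \<in> {0..t * x0}. excess \<nu> k - excess (scale t \<mu>) k = 0}"
    have cont: "continuous_on A (\<lambda>k. excess \<nu> k - excess (scale t \<mu>) k)" for A
      unfolding excess_def by (intro continuous_intros continuous_on_absdev p sym_lawD[OF ps])
    show ?thesis
    proof (cases "K = {}")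
      case False
      have "closed K" unfolding K_def by (rule continuous_closed_preimage_constant[OF cont]) simp
      have bdK: "bdd_above K" by (auto simp: K_def intro: bdd_aboveI[of _ "t * x0"])
      define k where "k = Sup K"
      have "k \<in> K" unfolding k_def using closed_contains_Sup[OF False bdK \<open>closed K\<close>] .
      then have k: "0 \<le> k" "k < x0" "excess \<nu> k = excess (scale t \<mu>) k" using tx by (auto
          simp: K_def)
      then have "contact t \<nu> \<mu> k" using pos[OF k(1,2)] by (simp add: contact_def)
      moreover have "\<not> contact t \<nu> \<mu> k'" if "k < k'" for k'
      proof
        assume c: "contact t \<nu> \<mu> k'"
        then have "k' < t * x0" using st0'[of k'] by (auto simp: contact_def not_less[symmetric])
        then have "k' \<in> K" using c that k(1) by (auto simp: K_def contact_def)
        then show False using cSup_upper[OF _ bdK] that by (force simp: k_def)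
      qed
      ultimately show ?thesis using fixed_points_no_contact[OF P sym fp tpos t1 dom k(1)] by blast
    next
      case True
      \<comment> \<open>The midpoint of t x0 and x0: on [0, c] compactness gives a uniform gap, and
        beyond c there is room for a larger multiple of \<mu> whose potential still
        vanishes.\<close>
      define c where "c = (1 + t) / 2 * x0"
      have c: "0 \<le> c" "c < x0" using x0 tpos t1 by (auto simp: c_def)
      have gap: "0 < excess \<nu> k - excess (scale t \<mu>) k" if "k \<in> {0..c}" for k
      proof (cases "k \<le> t * x0")
        case True
        then have "excess \<nu> k - excess (scale t \<mu>) k \<noteq> 0" using that \<open>K = {}\<close> by (auto simp: K_def)
        then show ?thesis using excess_mono[OF t(2), of k] by simp
      next
        case False
        then show ?thesis using st0'[of k] pos[of k] that c by simp
      qed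
      obtain k0 where k0: "k0 \<in> {0..c}" "\<And>k. k \<in> {0..c} \<Longrightarrow> excess \<nu> k0 - excess (scale t \<mu>) k0
          \<le> excess \<nu> k - excess (scale t \<mu>) k"
        using continuous_attains_inf[OF compact_Icc _ cont, of 0 c] c(1) by auto
      define g where "g = excess \<nu> k0 - excess (scale t \<mu>) k0"
      have g: "0 < g" "\<And>k. k \<in> {0..c} \<Longrightarrow> g \<le> excess \<nu> k - excess (scale t \<mu>) k"
        using gap[OF k0(1)] k0(2) by (auto simp: g_def)
      \<comment> \<open>t' - t \<le> g keeps the increase of \<open>absdev\<close> within the gap,
        and t' \<le> (1 + t) / 2 ensures t' x0 \<le> c.\<close>
      define t' where "t' = t + min g ((1 - t) / 2)"
      have t': "t < t'" "t' \<le> (1 + t) / 2" "t' \<le> t + g" using g t1 by (auto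
          simp: t'_def min_def field_simps)
      then have t'1: "0 < t'" "t' \<le> 1" using tpos t1 by auto
      have key: "absdev \<mu> k t' \<le> absdev \<nu> k 1" if k: "0 \<le> k" for k
      proof (cases "k \<le> c")
        case True
        have "absdev \<mu> k t' \<le> absdev \<mu> k t + (t' - t)" using absdev_diff_le[OF p(2), of k t' k t] t'
            by simp
        also have "\<dots> \<le> absdev \<mu> k t + g" using t' by simp
        also have "\<dots> \<le> absdev \<nu> k 1" using g(2)[of k] k True
            by (simp add: excess_def absdev_scale p)
        finally show ?thesis .
      next
        case False
        have "x0 \<le> k / t'"
        proof -
          have "t' * x0 \<le> c" unfolding c_def using t' x0 by (intro mult_right_mono) auto
          then show ?thesis using False t'1 by (simp add: le_divide_eq mult.commute)
        qed
        then have "excess \<mu> (k / t') = 0"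
          using \<mu>0 excess_antimono[OF sym(2) less_imp_le[OF x0(1)], of "k / t'"] excess_nonneg[OF sym(2), of "k / t'"] x0 by simp
        then have "absdev \<mu> k t' = k" using absdev_eq_excess[OF p(2) t'1(1), of k] by simp
        then show ?thesis using absdev_ge_abs[OF p(1), of k 1] k by simp
      qed
      have "absdev \<mu> x (t' * y) \<le> absdev \<nu> x y" for x y
      proof (cases "y = 0")
        case True
        then show ?thesis using absdev_ge_abs[OF p(1), of x 0] absdev_le_max[OF p(2), of x 0]
            by simp
      next
        case False
        \<comment> \<open>Symmetry and homogeneity reduce a general pair (x, y) to (|x| / |y|,
          1).\<close>
        have "absdev \<mu> x (t' * y) = absdev \<mu> \<bar>x\<bar> \<bar>t' * y\<bar>"
            by (simp only: sym_law_absdev_abs[OF sym(2)])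
        also have "\<dots> = absdev \<mu> (\<bar>y\<bar> * (\<bar>x\<bar> / \<bar>y\<bar>)) (\<bar>y\<bar> * t')" using False t'1
            by (simp add: abs_mult mult.commute)
        also have "\<dots> = \<bar>y\<bar> * absdev \<mu> (\<bar>x\<bar> / \<bar>y\<bar>) t'" unfolding absdev_homogeneous by simp
        also have "\<dots> \<le> \<bar>y\<bar> * absdev \<nu> (\<bar>x\<bar> / \<bar>y\<bar>) 1" by (intro mult_left_mono key) auto
        also have "\<dots> = absdev \<nu> (\<bar>y\<bar> * (\<bar>x\<bar> / \<bar>y\<bar>)) (\<bar>y\<bar> * 1)" unfolding absdev_homogeneous by simp
        also have "\<dots> = absdev \<nu> \<bar>x\<bar> \<bar>y\<bar>" using False by simp
        also have "\<dots> = absdev \<nu> x y" by (simp only: sym_law_absdev_abs[OF sym(1)])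
        finally show ?thesis .
      qed
      then have "t' \<in> S" using t'1 by (simp add: S_def degraded_def absdev_scale p)
      then show ?thesis using cSup_upper[OF _ bd, of t'] t'(1) by (simp add: t_def)
    qed
  qed
qed

section \<open>Convergence\<close>

text \<open>Posterior law of an exact observation and top element of the degradation order.\<close>

definition perfect_law :: "real measure" where
  "perfect_law = distr (measure_pmf (bernoulli_pmf (1/2))) borel (\<lambda>b. if b then 1 else - 1)"

lemma integral_perfect_law:
  fixes f :: "real \<Rightarrow> real"
  assumes "f \<in> borel_measurable borel"
  shows "(LINT a|perfect_law. f a) = (f 1 + f (- 1)) / 2"
  unfolding perfect_law_def using assms by (subst integral_distr) (auto simp: add_divide_distrib)

lemma posterior_law_perfect: "posterior_law perfect_law"
proof -
  have "real_distribution perfect_law"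
    unfolding perfect_law_def by (rule prob_space.real_distribution_distr[OF prob_space_measure_pmf]) simp
  moreover have "AE a in perfect_law. \<bar>a\<bar> \<le> 1"
    unfolding perfect_law_def by (subst AE_distr_iff) auto
  moreover have "(LINT a|perfect_law. a) = 0" by (simp add: integral_perfect_law)
  ultimately show ?thesis by (simp add: posterior_law_def)
qed

lemma absdev_perfect: "absdev perfect_law x y = max \<bar>x\<bar> \<bar>y\<bar>"
  unfolding absdev_def by (subst integral_perfect_law) (auto simp: max_def abs_if)

lemma sym_law_perfect: "sym_law perfect_law"
  by (subst sym_law_iff[OF posterior_law_perfect]) (simp add: absdev_perfect)

lemma degraded_perfect: "posterior_law m \<Longrightarrow> degraded m perfect_law"
  by (simp add: degraded_def absdev_perfect absdev_le_max)

text \<open>With e = E|a|, the value \<open>absdev m x y\<close> is at least |x| and at least e |y|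
  - |x|. If |x| < e |y| / 2, the second bound exceeds e |y| / 2; hence t = e / 2 works.\<close>

lemma nontrivial_dominates_perfect:
  assumes m: "posterior_law m" "m \<noteq> trivial_law"
  obtains t where "0 < t" "t \<le> 1" "degraded (scale t perfect_law) m"
proof -
  define e where "e = absdev m 0 1"
  have e: "0 < e" "e \<le> 1"
    using absdev_zero_imp_trivial[OF m(1)] m(2) absdev_nonneg[of m 0 1] absdev_le_max[OF m(1), of 0
        1] by (auto simp: e_def less_le)
  have "max \<bar>x\<bar> \<bar>e / 2 * y\<bar> \<le> absdev m x y" for x y
  proof (cases "\<bar>e / 2 * y\<bar> \<le> \<bar>x\<bar>")
    case True
    then have "max \<bar>x\<bar> \<bar>e / 2 * y\<bar> = \<bar>x\<bar>" by (rule max_absorb1)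
    then show ?thesis using absdev_ge_abs[OF m(1)] by simp
  next
    case False
    have "\<bar>y\<bar> * e = absdev m 0 y" using absdev_homogeneous[of m y 0 1] by (simp add: e_def)
    also have "\<dots> \<le> absdev m x y + \<bar>x\<bar>" using absdev_diff_le[OF m(1), of 0 y x y] by simp
    finally show ?thesis using False e by (simp add: abs_mult max_def mult.commute)
  qed
  then have "degraded (scale (e / 2) perfect_law) m"
    by (simp add: degraded_def absdev_scale[OF posterior_law_perfect] absdev_perfect)
  then show thesis using e that[of "e / 2"] by simp
qed

lemma sym_law_limit:
  assumes "\<And>n. sym_law (m n)" "posterior_law M" "\<And>x y. (\<lambda>n. absdev (m n) x y) \<longlonglongrightarrow> absdev M x y"
  shows "sym_law M"
proof -
  have "absdev M x (- y) = absdev M x y" for x y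
    using assms(3)[of x "- y"] assms(3)[of x y] sym_law_absdev(1)[OF assms(1)] LIMSEQ_unique
        by force
  then show ?thesis using sym_law_iff[OF assms(2)] by blast
qed

text \<open>A test function is continuous on the values above -\<infinity> and may oscillate near
  -\<infinity>. The density 1 + a vanishes at a = -1, so the transported test function g is
  continuous on the whole line.\<close>

lemma weakly_converges_llr:
  assumes m: "\<And>n. posterior_law (m n)" and M: "posterior_law M"
    and lim: "\<And>x y. (\<lambda>n. absdev (m n) x y) \<longlonglongrightarrow> absdev M x y"
  shows "weakly_converges (\<lambda>n. llr (m n)) (llr M)"
  unfolding weakly_converges_def
proof (intro allI impI)
  fix f :: "ereal \<Rightarrow> real"
  assume cont: "continuous_on {- \<infinity><..} f" and bd: "bounded (f ` {- \<infinity><..})"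
  obtain B where B: "\<And>r. - \<infinity> < r \<Longrightarrow> \<bar>f r\<bar> \<le> B" using bd by (auto simp: bounded_iff)
  have B0: "0 \<le> B" using B[of 0] by simp
  define g where "g a = (1 + clamp1 a) * (if a \<le> - 1 then 0 else f (bias_llr a))" for a
  have bias_llr_gt: "- \<infinity> < bias_llr a \<longleftrightarrow> - 1 < a" for a by (auto simp: bias_llr_def)
  have c: "0 \<le> 1 + clamp1 a" "1 + clamp1 a \<le> 2" for a using clamp1_bound[of a] by auto
  have gb: "\<bar>g a\<bar> \<le> B * (1 + clamp1 a)" for a
    using B[of "bias_llr a"] bias_llr_gt[of a] c[of a] B0
    by (auto simp: g_def abs_mult mult.commute intro!: mult_right_mono)
  have gc: "isCont g a" for a
  proof (cases "- 1 < a")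
    case True
    have "continuous_on {- 1<..} (\<lambda>a. (1 + clamp1 a) * f (bias_llr a))"
    proof (intro continuous_intros continuous_on_compose2[OF cont])
      show "continuous_on {- 1<..} clamp1" using isCont_clamp1
          by (simp add: continuous_at_imp_continuous_on)
      show "continuous_on {- 1<..} bias_llr" using continuous_on_bias_llr
          by (rule continuous_on_subset) simp
      show "bias_llr ` {- 1<..} \<subseteq> {- \<infinity><..}" using bias_llr_gt by auto
    qed
    also have "continuous_on {- 1<..} (\<lambda>a. (1 + clamp1 a) * f (bias_llr a))
        \<longleftrightarrow> continuous_on {- 1<..} g"
      by (intro continuous_on_cong) (auto simp: g_def)
    finally show ?thesis using True by (simp add: continuous_on_eq_continuous_at)
  next
    case False
    then have "clamp1 a = - 1" "g a = 0" by (auto simp: clamp1_def g_def)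
    moreover have "((\<lambda>b. B * (1 + clamp1 b)) \<longlongrightarrow> B * (1 + clamp1 a)) (at a)"
      using isCont_clamp1 by (intro tendsto_intros) (simp add: isCont_def)
    ultimately have "((\<lambda>b. B * (1 + clamp1 b)) \<longlongrightarrow> 0) (at a)" by simp
    then have "(g \<longlongrightarrow> 0) (at a)" by (rule Lim_null_comparison[rotated]) (use gb in simp)
    then show ?thesis using \<open>g a = 0\<close> by (simp add: isCont_def)
  qed
  have g_meas: "g \<in> borel_measurable borel"
    using gc by (intro borel_measurable_continuous_onI) (simp add: continuous_at_imp_continuous_on)
  have eq: "(LINT r:{- \<infinity><..}|llr m. f r) = (LINT a|m. g a)" if m: "posterior_law m" for m
  proof -
    have [measurable_cong]: "sets m = sets borel" using posterior_lawD(2)[OF m] .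
    have fm[measurable]: "(\<lambda>r. indicator {- \<infinity><..} r *\<^sub>R f r) \<in> borel_measurable borel"
      by (rule borel_measurable_continuous_on_indicator[OF _ cont]) simp
    have "(LINT r:{- \<infinity><..}|llr m. f r)
        = (LINT a|m. (1 + a) * (indicator {- \<infinity><..} (bias_llr a) *\<^sub>R f (bias_llr a)))"
      unfolding set_lebesgue_integral_def by (rule integral_llr[OF m fm])
    also have "\<dots> = (LINT a|m. g a)"
    proof (rule integral_cong_AE)
      show "(\<lambda>a. (1 + a) * (indicator {- \<infinity><..} (bias_llr a) *\<^sub>R f (bias_llr a))) \<in> borel_measurable m"
        using measurable_compose[OF bias_llr_measurable fm] by measurable
      show "g \<in> borel_measurable m" using g_meas by measurable
      show "AE a in m. (1 + a) * (indicator {- \<infinity><..} (bias_llr a) *\<^sub>R f (bias_llr a)) = g a"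
        using posterior_lawD(4)[OF m]
      proof eventually_elim
        case (elim a)
        have "bias_llr a = - \<infinity> \<longleftrightarrow> a \<le> - 1" by (auto simp: bias_llr_def)
        then show ?case using elim by (auto simp: g_def clamp1_id indicator_def)
      qed
    qed
    finally show ?thesis .
  qed
  have "(\<lambda>n. LINT a|m n. g a) \<longlonglongrightarrow> (LINT a|M. g a)"
  proof (rule weak_conv_imp_integral_bdd_continuous_conv[OF posterior_lawD(6)[OF m] posterior_lawD(6)[OF M]])
    show "weak_conv_m m M" by (rule absdev_tendsto_imp_weak_conv[OF m M lim])
    show "norm (g a) \<le> B * 2" for a
      using gb[of a] mult_left_mono[OF c(2)[of a] B0] by simp
  qed (rule gc)
  then show "(\<lambda>n. LINT r:{- \<infinity><..}|llr (m n). f r) \<longlonglongrightarrow> (LINT r:{- \<infinity><..}|llr M. f r)"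
    by (simp add: eq m M)
qed

section \<open>Monotone iteration of the operator\<close>

context
  fixes P assumes P: "etree_distribution P"
begin

lemma posterior_Q_power_mono:
  assumes "posterior_law m" "posterior_law m'" "degraded m m'"
  shows "degraded ((posterior_Q P ^^ h) m) ((posterior_Q P ^^ h) m')"
  using assms posterior_Q_power(1)[OF P]
  by (induction h) (auto intro: degraded_posterior_Q[OF P])

lemma sym_law_posterior_Q_power: "sym_law m \<Longrightarrow> sym_law ((posterior_Q P ^^ h) m)"
  by (induction h) (auto intro: sym_law_posterior_Q[OF P])

lemma posterior_Q_power_fixed: "posterior_Q P m = m \<Longrightarrow> (posterior_Q P ^^ h) m = m"
  by (induction h) auto

text \<open>By continuity of the operator the shifted orbit converges to the image of the limit, and
  as a shifted orbit it converges to the limit itself.\<close>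

lemma posterior_Q_limit:
  assumes m: "posterior_law m"
      and conv: "\<And>x y. convergent (\<lambda>h. absdev ((posterior_Q P ^^ h) m) x y)"
  obtains M where "posterior_law M" "posterior_Q P M = M"
      "\<And>x y. (\<lambda>h. absdev ((posterior_Q P ^^ h) m) x y) \<longlonglongrightarrow> absdev M x y"
proof -
  note pm = posterior_Q_power(1)[OF P m]
  obtain M where M: "posterior_law M"
      "\<And>x y. (\<lambda>h. absdev ((posterior_Q P ^^ h) m) x y) \<longlonglongrightarrow> absdev M x y"
    using absdev_convergent_imp_limit[OF pm conv] by blast
  have "posterior_Q P M = M"
  proof (rule absdev_unique[OF posterior_Q(1)[OF P M(1)] M(1)])
    fix x y
    have "(\<lambda>h. absdev ((posterior_Q P ^^ Suc h) m) x y) \<longlonglongrightarrow> absdev (posterior_Q P M) x y"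
      using absdev_tendsto_posterior_Q[OF P pm M] by simp
    moreover have "(\<lambda>h. absdev ((posterior_Q P ^^ Suc h) m) x y) \<longlonglongrightarrow> absdev M x y"
      using LIMSEQ_Suc[OF M(2)[of x y]] .
    ultimately show "absdev (posterior_Q P M) x y = absdev M x y" by (rule LIMSEQ_unique)
  qed
  with M that show thesis by blast
qed

lemma posterior_Q_decreasing:
  assumes "posterior_law m" "degraded (posterior_Q P m) m"
  shows "convergent (\<lambda>h. absdev ((posterior_Q P ^^ h) m) x y)"
proof (rule Bseq_mono_convergent[of "\<lambda>h. - absdev ((posterior_Q P ^^ h) m) x y", unfolded convergent_minus_iff[symmetric]])
  note pm = posterior_Q_power(1)[OF P assms(1)]
  show "Bseq (\<lambda>h. - absdev ((posterior_Q P ^^ h) m) x y)"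
    using absdev_le_max[OF pm] absdev_nonneg by (intro BseqI'[where K="max \<bar>x\<bar> \<bar>y\<bar>"]) auto
  have "absdev ((posterior_Q P ^^ Suc h) m) x y \<le> absdev ((posterior_Q P ^^ h) m) x y" for h
    using degradedD[OF posterior_Q_power_mono[OF posterior_Q(1)[OF P assms(1)] assms]]
    by (simp add: funpow_swap1)
  then show "\<forall>h h'. h \<le> h' \<longrightarrow> - absdev ((posterior_Q P ^^ h) m) x y
      \<le> - absdev ((posterior_Q P ^^ h') m) x y"
    using decseq_SucI[of "\<lambda>h. absdev ((posterior_Q P ^^ h) m) x y"] by (auto simp: decseq_def)
qed

lemma posterior_Q_increasing:
  assumes "posterior_law m" "degraded m (posterior_Q P m)"
  shows "convergent (\<lambda>h. absdev ((posterior_Q P ^^ h) m) x y)"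
    and "degraded m ((posterior_Q P ^^ h) m)"
proof -
  note pm = posterior_Q_power(1)[OF P assms(1)]
  have inc: "absdev ((posterior_Q P ^^ h) m) x y \<le> absdev ((posterior_Q P ^^ Suc h) m) x y"
      for h x y
    using degradedD[OF posterior_Q_power_mono[OF assms(1) posterior_Q(1)[OF P assms(1)] assms(2)]]
    by (simp add: funpow_swap1)
  then have I: "incseq (\<lambda>h. absdev ((posterior_Q P ^^ h) m) x y)" for x y by (rule incseq_SucI)
  then show "degraded m ((posterior_Q P ^^ h) m)"
    unfolding degraded_def using incseqD[OF I, of 0 h] by simp
  show "convergent (\<lambda>h. absdev ((posterior_Q P ^^ h) m) x y)"
  proof (rule Bseq_mono_convergent)
    show "Bseq (\<lambda>h. absdev ((posterior_Q P ^^ h) m) x y)"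
      using absdev_le_max[OF pm] absdev_nonneg by (intro BseqI'[where K="max \<bar>x\<bar> \<bar>y\<bar>"]) auto
  qed (use I in \<open>auto simp: incseq_def\<close>)
qed

lemma posterior_Q_convergence:
  assumes nt: "\<not> trivial_etree_distribution P"
  obtains M where "sym_law M" "posterior_Q P M = M"
    "\<And>m x y. posterior_law m \<Longrightarrow> m \<noteq> trivial_law
        \<Longrightarrow> (\<lambda>h. absdev ((posterior_Q P ^^ h) m) x y) \<longlonglongrightarrow> absdev M x y"
proof -
  note pp = posterior_law_perfect
  have "degraded (posterior_Q P perfect_law) perfect_law"
      by (intro degraded_perfect posterior_Q(1)[OF P] pp)
  from posterior_Q_decreasing[OF pp this]
  obtain M where M: "posterior_law M" "posterior_Q P M = M"
    "\<And>x y. (\<lambda>h. absdev ((posterior_Q P ^^ h) perfect_law) x y) \<longlonglongrightarrow> absdev M x y"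
    using posterior_Q_limit[OF pp] by blast
  have sM: "sym_law M" by (rule sym_law_limit[OF sym_law_posterior_Q_power[OF sym_law_perfect] M(1,3)])
  have "(\<lambda>h. absdev ((posterior_Q P ^^ h) m) x y) \<longlonglongrightarrow> absdev M x y" if m: "posterior_law m"
      "m \<noteq> trivial_law" for m x y
  proof -
    note pm = posterior_Q_power(1)[OF P m(1)]
    have up: "absdev ((posterior_Q P ^^ h) m) x y \<le> absdev ((posterior_Q P ^^ h) perfect_law) x y"
        for h
      by (intro degradedD posterior_Q_power_mono m pp degraded_perfect)
    show ?thesis
    proof (cases "M = trivial_law")
      \<comment> \<open>The lower bound |x|, valid for every posterior law, is already the
        limit.\<close>
      case True
      show ?thesis
      proof (rule tendsto_sandwich[OF _ _ _ M(3)])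
        show "\<forall>\<^sub>F h in sequentially. \<bar>x\<bar> \<le> absdev ((posterior_Q P ^^ h) m) x y"
            using absdev_ge_abs[OF pm] by simp
        show "(\<lambda>h. \<bar>x\<bar>) \<longlonglongrightarrow> absdev M x y" by (simp add: True absdev_trivial)
      qed (use up in simp)
    next
      case False
      have ntM: "0 < excess M 0" by (rule sym_law_nontrivial[OF sM False])
      obtain t where t: "0 < t" "t \<le> 1" "degraded (scale t perfect_law) m"
        using nontrivial_dominates_perfect[OF m] .
      define n where "n = scale t M"
      have sn: "sym_law n" unfolding n_def using sM t by (intro sym_law_scale) auto
      note pn = sym_lawD[OF sn]
      have ptp: "posterior_law (scale t perfect_law)" using t by (intro posterior_law_scale pp) auto
      \<comment> \<open>M lies below the perfect law, so t M lies below t times the perfect law and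
        hence below m.\<close>
      have nm: "degraded n m"
        unfolding n_def by (intro degraded_trans[OF degraded_scale t(3)] M(1) pp degraded_perfect)
      have nM: "degraded n M" unfolding n_def using t by (intro degraded_scale_self M(1)) auto
      have "degraded n (posterior_Q P n)"
        using stringy_posterior_Q[OF P sM, of t] t M(2) by (simp add: n_def)
      note inc = posterior_Q_increasing[OF pn this]
      obtain N where N: "posterior_law N" "posterior_Q P N = N"
        "\<And>x y. (\<lambda>h. absdev ((posterior_Q P ^^ h) n) x y) \<longlonglongrightarrow> absdev N x y"
        using posterior_Q_limit[OF pn inc(1)] by blast
      have sN: "sym_law N" by (rule sym_law_limit[OF sym_law_posterior_Q_power[OF sn] N(1,3)])
      have nN: "degraded n N"
        unfolding degraded_def by (intro allI LIMSEQ_le_const[OF N(3)] exI impI degradedD inc(2))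
      have NM: "degraded N M"
        unfolding degraded_def
      proof (intro allI LIMSEQ_le_const2[OF N(3)] exI impI)
        fix x y h
        show "absdev ((posterior_Q P ^^ h) n) x y \<le> absdev M x y"
          using degradedD[OF posterior_Q_power_mono[OF pn M(1) nM], of h x y]
          by (simp add: posterior_Q_power_fixed M(2))
      qed
      have "0 < excess n 0" using ntM t by (simp add: n_def excess_scale M(1))
      then have ntN: "0 < excess N 0" using excess_mono[OF nN, of 0] by simp
      have "degraded M N"
        by (rule fixed_points_degraded[OF P nt sN sM N(2) M(2) ntN ntM t(1,2)]) (use nN in \<open>simp add: n_def\<close>)
      then have "N = M" using NM by (intro degraded_antisym N(1) M(1))
      show ?thesis
      proof (rule tendsto_sandwich[OF _ _ _ M(3)])
        show "(\<lambda>h. absdev ((posterior_Q P ^^ h) n) x y) \<longlonglongrightarrow> absdev M x y" using N(3) \<open>N = M\<close> by simp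
        show "\<forall>\<^sub>F h in sequentially. absdev ((posterior_Q P ^^ h) n) x y
            \<le> absdev ((posterior_Q P ^^ h) m) x y"
          using degradedD[OF posterior_Q_power_mono[OF pn m(1) nm]] by simp
      qed (use up in simp)
    qed
  qed
  with sM M(2) that show thesis by blast
qed

end

theorem theorem43:
  fixes P :: "etree measure"
  assumes "etree_distribution P"
    and "\<not> trivial_etree_distribution P"
  shows "(\<forall>\<mu> \<nu>. nontrivial_fixed_point P \<mu> \<longrightarrow> nontrivial_fixed_point P \<nu> \<longrightarrow> \<mu> = \<nu>)
    \<and> (\<forall>\<mu>s. nontrivial_fixed_point P \<mu>s \<longrightarrow>
          symmetric_dist \<mu>s \<and>
          (\<forall>\<mu>. LLR_dist \<mu> \<longrightarrow> \<mu> \<noteq> trivial_dist \<longrightarrow>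
             weakly_converges (\<lambda>h. (BP P ^^ h) \<mu>) \<mu>s))
    \<and> ((\<nexists>\<mu>s. nontrivial_fixed_point P \<mu>s) \<longrightarrow>
          BP P trivial_dist = trivial_dist \<and>
          (\<forall>\<mu>. LLR_dist \<mu> \<longrightarrow> \<mu> \<noteq> trivial_dist \<longrightarrow>
             weakly_converges (\<lambda>h. (BP P ^^ h) \<mu>) trivial_dist))"
proof -
  obtain M where M: "sym_law M" "posterior_Q P M = M"
    "\<And>m x y. posterior_law m \<Longrightarrow> m \<noteq> trivial_law
        \<Longrightarrow> (\<lambda>h. absdev ((posterior_Q P ^^ h) m) x y) \<longlonglongrightarrow> absdev M x y"
    using posterior_Q_convergence[OF assms] by blast
  note pM = sym_lawD[OF M(1)]
  have MM: "LLR_dist (llr M)" "BP P (llr M) = llr M" "symmetric_dist (llr M)"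
    using LLR_dist_llr[OF pM] posterior_Q(2)[OF assms(1) pM] M(1,2) symmetric_dist_llr_iff[OF pM]
        by auto
  have posterior: "posterior_law (posterior \<mu>)" "llr (posterior \<mu>) = \<mu>" "\<mu> \<noteq> trivial_dist
      \<Longrightarrow> posterior \<mu> \<noteq> trivial_law"
    if "LLR_dist \<mu>" for \<mu>
    using posterior_law_posterior[OF that] llr_trivial by auto
  have conv: "weakly_converges (\<lambda>h. (BP P ^^ h) \<mu>) (llr M)" if \<mu>: "LLR_dist \<mu>" "\<mu> \<noteq> trivial_dist"
      for \<mu>
  proof -
    note p = posterior(1)[OF \<mu>(1)]
    have "weakly_converges (\<lambda>h. llr ((posterior_Q P ^^ h) (posterior \<mu>))) (llr M)"
      by (intro weakly_converges_llr posterior_Q_power(1)[OF assms(1) p] pM M(3) p posterior(3) \<mu>)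
    then show ?thesis by (simp add: posterior_Q_power(2)[OF assms(1) p] posterior(2)[OF \<mu>(1)])
  qed
  have unique: "\<mu> = llr M" if "nontrivial_fixed_point P \<mu>" for \<mu>
  proof -
    have \<mu>: "LLR_dist \<mu>" "\<mu> \<noteq> trivial_dist" "BP P \<mu> = \<mu>" using that by (auto
        simp: nontrivial_fixed_point_def)
    note p = posterior[OF \<mu>(1)]
    have "posterior_Q P (posterior \<mu>) = posterior \<mu>" using p(2) \<mu>(3) by (simp add: posterior_Q_def)
    \<comment> \<open>The orbit of a fixed point is constant, so its limit M is the point
      itself.\<close>
    then have "(\<lambda>h. absdev (posterior \<mu>) x y) \<longlonglongrightarrow> absdev M x y" for x y
      using M(3)[OF p(1) p(3)[OF \<mu>(2)]] by (simp add: posterior_Q_power_fixed[OF assms(1)])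
    then have "posterior \<mu> = M" by (intro absdev_unique p(1) pM) (simp add: LIMSEQ_const_iff)
    then show ?thesis using p(2) by simp
  qed
  \<comment> \<open>\<open>llr M\<close> is always a fixed point; if no nontrivial one exists it
    must be the trivial distribution, and \<open>conv\<close> covers this case too.\<close>
  have "llr M = trivial_dist" if "\<nexists>\<mu>s. nontrivial_fixed_point P \<mu>s"
    using that MM by (auto simp: nontrivial_fixed_point_def)
  then show ?thesis using unique conv MM by metis
qed

end
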